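(* Let $\mathfrak h=\ell^2(\mathbb Z)$ and let $\mathcal A$ be the CAR algebra generated by $b_x,b_x^*$, $x\in\mathbb Z$, with $\{b_x,b_y\}=0$, $\{b_x^*,b_y\}=\delta_{xy}$. Fix inverse temperatures $\beta_L,\beta_R$ and set $\beta=\tfrac12(\beta_R+\beta_L)$, $\delta=\tfrac12(\beta_R-\beta_L)$, and assume $0\le\delta<\beta<\infty$; fix $\gamma\in(-1,1)$ and $\lambda\in\mathbb R$. Let $\omega_+$ be the quasi-free state on $\mathcal A$ with two-point operator $S$ (defined in the context), and for $n\in\mathbb N$ let $\rho^{(n)}$ be the density matrix on the Fock space $\mathfrak F(\mathbb C^n)$ determined by $\omega_+(A)=\operatorname{tr}(\rho^{(n)}A)$ for all $A$ in the CAR algebra $\mathcal A_n$ generated by $b_1,\dots,b_n$ (i.e. the restriction of $\omega_+$ to a block of $n$ neighbouring sites). Let $\mathcal S^{(n)}=-\operatorname{tr}(\rho^{(n)}\log\rho^{(n)})$. Then $$\mathcal S^{(n)}=C\,n+o(n)\qquad(n\to\infty),$$ where $$C=C_{\beta,\delta,\gamma,\lambda}=\frac12\int_0^{2\pi}\frac{d\xi}{2\pi}\Big(h\big(\varphi_{\beta,\delta}(\xi)+\varphi_{\delta,\beta}(\xi)\big)+h\big(\varphi_{\beta,\delta}(\xi)-\varphi_{\delta,\beta}(\xi)\big)\Big),$$ and $C>0$.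
   Context: Notation: $\kappa(\xi)=2\lambda\sin\xi-(1-\gamma^2)\sin2\xi$, $\mu(\xi)=\big((\cos\xi-\lambda)^2+\gamma^2\sin^2\xi\big)^{1/2}$, and for $\alpha,\alpha'\in\mathbb R$, $\varphi_{\alpha,\alpha'}(\xi)=\dfrac{\sinh(\alpha\mu(\xi))}{\cosh(\alpha\mu(\xi))+\cosh(\alpha'\mu(\xi))}$. The entropy function is $h(x)=-\frac{1+x}{2}\log\frac{1+x}{2}-\frac{1-x}{2}\log\frac{1-x}{2}$ for $x\in(-1,1)$. For $f=(f_+,f_-)\in\mathfrak h\oplus\mathfrak h$ put $B(f)=\sum_{x\in\mathbb Z}(f_+(x)b_x^*+f_-(x)b_x)$, so $\{B^*(f),B(g)\}=(f,g)$ and $B^*(f)=B(Jf)$ with $J(f_+,f_-)=(\bar f_-,\bar f_+)$. A state $\omega$ is quasi-free if $\omega(B(f^{(1)})\cdots B(f^{(2m-1)}))=0$ and $\omega(B(f^{(1)})\cdots B(f^{(2m)}))=\sum_\pi\operatorname{sign}\pi\prod_{i=1}^m\omega(B(f^{(\pi(2i-1))})B(f^{(\pi(2i))}))$, the sum over permutations $\pi$ of $\{1,\dots,2m\}$ with $\pi(2i-1)<\pi(2i)$ and $\pi(2i-1)<\pi(2i+1)$ (pairings). The state $\omega_+$ is the quasi-free state with $\omega_+(B^*(f)B(g))=(f,Sg)$, where under the Fourier transform $Ff(\xi)=\sum_x f(x)e^{ix\xi}$ (identifying $\ell^2(\mathbb Z)\otimes\mathbb C^2\simeq L^2(\mathbb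 T)\otimes\mathbb C^2$) $S$ is multiplication by the $2\times2$ matrix function $s(\xi)=\sum_{k=0}^3 s_k(\xi)\sigma_k$ ($\sigma_0$ the identity, $\sigma_1,\sigma_2,\sigma_3$ the Pauli matrices) with $s_0=\tfrac12-\tfrac12\varphi_{\delta,\beta}\operatorname{sign}\kappa$, $s_1=0$, $s_2=\tfrac12\varphi_{\beta,\delta}\,\gamma\sin\xi/\mu$, $s_3=-\tfrac12\varphi_{\beta,\delta}(\cos\xi-\lambda)/\mu$. (Physically, $\omega_+$ is the non-equilibrium steady state of the XY chain obtained by coupling a finite piece to two reservoirs at inverse temperatures $\beta_L,\beta_R$, expressed via Jordan–Wigner fermions; $\mathcal S^{(n)}$ is the von Neumann entropy of a block of $n$ spins.) *)

theory Defs
  imports "HOL-Analysis.Analysis" "HOL-Combinatorics.Permutations" "HOL-Library.Landau_Symbols"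
begin

definition kappa :: "real \<Rightarrow> real \<Rightarrow> real \<Rightarrow> real" where
  "kappa \<gamma> lam \<xi> = 2 * lam * sin \<xi> - (1 - \<gamma>^2) * sin (2 * \<xi>)"

definition mu :: "real \<Rightarrow> real \<Rightarrow> real \<Rightarrow> real" where
  "mu \<gamma> lam \<xi> = sqrt ((cos \<xi> - lam)^2 + \<gamma>^2 * (sin \<xi>)^2)"

definition phi :: "real \<Rightarrow> real \<Rightarrow> real \<Rightarrow> real \<Rightarrow> real \<Rightarrow> real" where
  "phi \<gamma> lam a a' \<xi> =
     sinh (a * mu \<gamma> lam \<xi>) / (cosh (a * mu \<gamma> lam \<xi>) + cosh (a' * mu \<gamma> lam \<xi>))"

text \<open>Binary entropy function (only ever evaluated on (-1,1)).\<close>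
definition hent :: "real \<Rightarrow> real" where
  "hent x = - ((1 + x) / 2) * ln ((1 + x) / 2) - ((1 - x) / 2) * ln ((1 - x) / 2)"

text \<open>Components s_0, s_2, s_3 of the symbol s = s0 sigma0 + s2 sigma2 + s3 sigma3 (s1 = 0).\<close>
definition s0 :: "real \<Rightarrow> real \<Rightarrow> real \<Rightarrow> real \<Rightarrow> real \<Rightarrow> real" where
  "s0 \<beta> \<delta> \<gamma> lam \<xi> = 1/2 - 1/2 * phi \<gamma> lam \<delta> \<beta> \<xi> * sgn (kappa \<gamma> lam \<xi>)"

definition s2 :: "real \<Rightarrow> real \<Rightarrow> real \<Rightarrow> real \<Rightarrow> real \<Rightarrow> real" where
  "s2 \<beta> \<delta> \<gamma> lam \<xi> = 1/2 * phi \<gamma> lam \<beta> \<delta> \<xi> * \<gamma> * sin \<xi> / mu \<gamma> lam \<xi>"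

definition s3 :: "real \<Rightarrow> real \<Rightarrow> real \<Rightarrow> real \<Rightarrow> real \<Rightarrow> real" where
  "s3 \<beta> \<delta> \<gamma> lam \<xi> = - 1/2 * phi \<gamma> lam \<beta> \<delta> \<xi> * (cos \<xi> - lam) / mu \<gamma> lam \<xi>"

text \<open>Entries of the 2x2 matrix s(xi); index True = component "+", False = component "-".
  sigma2 = [[0,-i],[i,0]], sigma3 = [[1,0],[0,-1]].\<close>
definition smat :: "real \<Rightarrow> real \<Rightarrow> real \<Rightarrow> real \<Rightarrow> real \<Rightarrow> bool \<Rightarrow> bool \<Rightarrow> complex" where
  "smat \<beta> \<delta> \<gamma> lam \<xi> a b =
     (if a \<and> b then complex_of_real (s0 \<beta> \<delta> \<gamma> lam \<xi> + s3 \<beta> \<delta> \<gamma> lam \<xi>)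
      else if a \<and> \<not> b then - \<i> * complex_of_real (s2 \<beta> \<delta> \<gamma> lam \<xi>)
      else if \<not> a \<and> b then \<i> * complex_of_real (s2 \<beta> \<delta> \<gamma> lam \<xi>)
      else complex_of_real (s0 \<beta> \<delta> \<gamma> lam \<xi> - s3 \<beta> \<delta> \<gamma> lam \<xi>))"

text \<open>Position-space kernel of S: with F f(xi) = sum_x f(x) e^{i x xi} and the normalised
  measure d xi / 2 pi, (f, S g) = sum_{x,y,a,b} cnj(f_a x) Sker a b x y g_b y.\<close>
definition Sker :: "real \<Rightarrow> real \<Rightarrow> real \<Rightarrow> real \<Rightarrow> bool \<Rightarrow> bool \<Rightarrow> int \<Rightarrow> int \<Rightarrow> complex" where
  "Sker \<beta> \<delta> \<gamma> lam a b x y =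
     integral {0..2*pi} (\<lambda>\<xi>. exp (\<i> * of_int (y - x) * of_real \<xi>) * smat \<beta> \<delta> \<gamma> lam \<xi> a b)
       / complex_of_real (2 * pi)"

text \<open>An element f = (f_+, f_-) of h (+) h; component True = f_+, False = f_-.\<close>
type_synonym testfun = "bool \<Rightarrow> int \<Rightarrow> complex"

definition supported_in :: "nat \<Rightarrow> testfun \<Rightarrow> bool" where
  "supported_in n f \<longleftrightarrow> (\<forall>a x. (x < 1 \<or> x > int n) \<longrightarrow> f a x = 0)"

definition Jop :: "testfun \<Rightarrow> testfun" where
  "Jop f a x = cnj (f (\<not> a) x)"

text \<open>(f, S g) for f, g supported in the block {1..n}.\<close>
definition two_point :: "real \<Rightarrow> real \<Rightarrow> real \<Rightarrow> real \<Rightarrow> nat \<Rightarrow> testfun \<Rightarrow> testfun \<Rightarrow> complex" where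
  "two_point \<beta> \<delta> \<gamma> lam n f g =
     (\<Sum>x\<in>{1..int n}. \<Sum>y\<in>{1..int n}. \<Sum>a\<in>(UNIV::bool set). \<Sum>b\<in>(UNIV::bool set).
        cnj (f a x) * Sker \<beta> \<delta> \<gamma> lam a b x y * g b y)"

text \<open>omega_+(B(f) B(g)) = omega_+(B^*(Jf) B(g)) = (Jf, S g).\<close>
definition pair_fn :: "real \<Rightarrow> real \<Rightarrow> real \<Rightarrow> real \<Rightarrow> nat \<Rightarrow> testfun \<Rightarrow> testfun \<Rightarrow> complex" where
  "pair_fn \<beta> \<delta> \<gamma> lam n f g = two_point \<beta> \<delta> \<gamma> lam n (Jop f) g"

definition pairings :: "nat \<Rightarrow> (nat \<Rightarrow> nat) set" where
  "pairings m = {p. p permutes {..<2*m} \<and> (\<forall>i<m. p (2*i) < p (2*i+1))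
                    \<and> (\<forall>i. i + 1 < m \<longrightarrow> p (2*i) < p (2*i+2))}"

text \<open>The quasi-free state omega_+ on monomials B(f_1)...B(f_k), f_i supported in {1..n}.\<close>
definition omega_mono :: "real \<Rightarrow> real \<Rightarrow> real \<Rightarrow> real \<Rightarrow> nat \<Rightarrow> testfun list \<Rightarrow> complex" where
  "omega_mono \<beta> \<delta> \<gamma> lam n fs =
     (if odd (length fs) then 0
      else (let m = length fs div 2 in
        \<Sum>p\<in>pairings m. of_int (sign p) *
           (\<Prod>i<m. pair_fn \<beta> \<delta> \<gamma> lam n (fs ! p (2*i)) (fs ! p (2*i+1)))))"

type_synonym cmat = "nat \<Rightarrow> nat \<Rightarrow> complex"

definition mmul :: "nat \<Rightarrow> cmat \<Rightarrow> cmat \<Rightarrow> cmat" where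
  "mmul N A B i j = (\<Sum>k<N. A i k * B k j)"

definition mid :: "nat \<Rightarrow> cmat" where
  "mid N i j = (if i = j \<and> i < N then 1 else 0)"

definition madj :: "cmat \<Rightarrow> cmat" where
  "madj A i j = cnj (A j i)"

definition mtrace :: "nat \<Rightarrow> cmat \<Rightarrow> complex" where
  "mtrace N A = (\<Sum>i<N. A i i)"

definition mprod :: "nat \<Rightarrow> cmat list \<Rightarrow> cmat" where
  "mprod N As = foldr (mmul N) As (mid N)"

definition unitary_mat :: "nat \<Rightarrow> cmat \<Rightarrow> bool" where
  "unitary_mat N U \<longleftrightarrow> (\<forall>i<N. \<forall>j<N. mmul N (madj U) U i j = mid N i j)"

definition density_mat :: "nat \<Rightarrow> cmat \<Rightarrow> bool" where
  "density_mat N \<rho> \<longleftrightarrow> (\<forall>i j. (i \<ge> N \<or> j \<ge> N) \<longrightarrow> \<rho> i j = 0)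
     \<and> (\<forall>i<N. \<forall>j<N. \<rho> i j = cnj (\<rho> j i))
     \<and> (\<forall>v::nat \<Rightarrow> complex. 0 \<le> Re (\<Sum>i<N. \<Sum>j<N. cnj (v i) * \<rho> i j * v j))
     \<and> mtrace N \<rho> = 1"

text \<open>Von Neumann entropy -tr(rho log rho), computed through a spectral decomposition
  rho = U diag(d) U^* (with the convention 0 log 0 = 0; note ln 0 = 0 in Isabelle).\<close>
definition vn_entropy :: "nat \<Rightarrow> cmat \<Rightarrow> real" where
  "vn_entropy N \<rho> = (SOME s. \<exists>U (d::nat \<Rightarrow> real). unitary_mat N U \<and>
       (\<forall>i<N. \<forall>j<N. \<rho> i j = (\<Sum>k<N. U i k * of_real (d k) * cnj (U j k))) \<and>
       s = (\<Sum>k<N. - d k * ln (d k)))"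

text \<open>Fock representation of b_j (j = 1..n) via Jordan-Wigner: basis vectors indexed by
  s < 2^n, bit (j-1) of s = occupation of site j.\<close>
definition occ :: "nat \<Rightarrow> nat \<Rightarrow> bool" where
  "occ s k \<longleftrightarrow> odd (s div 2^k)"

definition annih :: "nat \<Rightarrow> int \<Rightarrow> cmat" where
  "annih n x t s = (if 1 \<le> x \<and> x \<le> int n \<and> s < 2^n \<and> occ s (nat x - 1)
                       \<and> t = s - 2^(nat x - 1)
                    then (-1) ^ card {k. k < nat x - 1 \<and> occ s k} else 0)"

definition fockB :: "nat \<Rightarrow> testfun \<Rightarrow> cmat" where
  "fockB n f i j = (\<Sum>x\<in>{1..int n}. f True x * madj (annih n x) i j + f False x * annih n x i j)"

text \<open>The reduced density matrix rho^(n): omega_+(A) = tr(rho A) for all A in A_n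
  (equivalently, for all monomials B(f_1)...B(f_k) with f_i supported in {1..n}).\<close>
definition rho :: "real \<Rightarrow> real \<Rightarrow> real \<Rightarrow> real \<Rightarrow> nat \<Rightarrow> cmat" where
  "rho \<beta> \<delta> \<gamma> lam n = (THE \<rho>. density_mat (2^n) \<rho> \<and>
      (\<forall>fs. (\<forall>f\<in>set fs. supported_in n f) \<longrightarrow>
         mtrace (2^n) (mmul (2^n) \<rho> (mprod (2^n) (map (fockB n) fs))) = omega_mono \<beta> \<delta> \<gamma> lam n fs))"

definition block_entropy :: "real \<Rightarrow> real \<Rightarrow> real \<Rightarrow> real \<Rightarrow> nat \<Rightarrow> real" where
  "block_entropy \<beta> \<delta> \<gamma> lam n = vn_entropy (2^n) (rho \<beta> \<delta> \<gamma> lam n)"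

definition Cconst :: "real \<Rightarrow> real \<Rightarrow> real \<Rightarrow> real \<Rightarrow> real" where
  "Cconst \<beta> \<delta> \<gamma> lam = 1/2 * integral {0..2*pi} (\<lambda>\<xi>.
      (hent (phi \<gamma> lam \<beta> \<delta> \<xi> + phi \<gamma> lam \<delta> \<beta> \<xi>) + hent (phi \<gamma> lam \<beta> \<delta> \<xi> - phi \<gamma> lam \<delta> \<beta> \<xi>)) / (2*pi))"

end

(* Restricted to a block, the two-point operator S becomes a Hermitian matrix on a space of dimension
   2n that is self-dual under the conjugation J. It has an orthonormal eigenbasis u_k, J u_k
   (k < n) with eigenvalues nu_k, 1 - nu_k. The operators B(u_k) again satisfy the CAR, hence they
   are unitarily equivalent to the original fermions, and by Wick's theorem the reduced density
   matrix is unitarily equivalent to a product of two-level densities with weights nu_k, 1 - nu_k.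
   So the block entropy is the sum of h(2 nu_k - 1), i.e. half the trace of h(T_n), where T_n is
   the block Toeplitz matrix with symbol t = 2 s - 1.

   The eigenvalues of t lie in some [-r, r] with r < 1. There h is concave and h(x) + x^2/(1 - r^2)
   is bounded below by its tangents, so Jensen's inequality gives
     0 <= tr h(T_n) - n avg(tr h(t)) <= (n avg(tr t^2) - tr T_n^2) / (1 - r^2).
   The right-hand side is o(n) by Parseval's identity for the entries of t. *)

theory Submission
  imports Defs "HOL-Computational_Algebra.Fundamental_Theorem_Algebra"
begin

section \<open>Diagonalisation of self-dual Hermitian matrices\<close>

text \<open>The symbol jumps where \<open>kappa\<close> changes sign and may be discontinuous where
  \<open>mu\<close> vanishes, so Szego theory for smooth symbols does not apply. The argument uses t
  only through boundedness, measurability and Parseval. No function of an operator is formed: a unit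
  eigenvector of T_n, read as a trigonometric polynomial with values in C^2, spreads mass 1 over the
  circle and over the two eigenvalues of t(xi), and its own eigenvalue is the mean of this
  distribution. Jensen is applied to each such probability measure. Completeness of the eigenbasis
  makes the densities add up to the constant n at each xi, so the averages sum to n avg(tr h(t))
  exactly and the whole error is a sum of variances. The constant 1/(1 - r^2) comes from ln p <= p -
  1 applied to a relative entropy. Two notions are given implicitly: the density matrix is a
  definite description, and the entropy is a choice over all spectral decompositions. Uniqueness of
  both has to be established before the product form can be used.\<close>

lemma underdetermined_system:
  fixes A :: "'k \<Rightarrow> 'i \<Rightarrow> complex"
  assumes "finite K" "finite I" "card K < card I"
  shows "\<exists>c. (\<exists>i\<in>I. c i \<noteq> 0) \<and> (\<forall>k\<in>K. (\<Sum>i\<in>I. A k i * c i) = 0)"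
  using assms
proof (induction K arbitrary: I A rule: finite_induct)
  case empty
  then have "I \<noteq> {}" by auto
  then show ?case by (auto intro!: exI[of _ "\<lambda>_. 1"])
next
  case (insert k K)
  show ?case
  proof (cases "\<forall>i\<in>I. A k i = 0")
    case True
    have "card K < card I" using insert by simp
    from insert.IH[OF \<open>finite I\<close> this, of A] True show ?thesis by auto
  next
    case False
    then obtain i0 where i0: "i0 \<in> I" "A k i0 \<noteq> 0" by auto
    \<comment> \<open>Gaussian elimination with pivot \<open>A k i0\<close>: \<open>B\<close> is the
      system with the unknown \<open>i0\<close> removed, and \<open>d\<close> restores its value so
      that equation \<open>k\<close> holds.\<close>
    define B where "B l i = A l i - A l i0 * A k i / A k i0" for l i
    have "card K < card (I - {i0})" using insert i0 by simp
    then obtain c where c: "\<exists>i\<in>I - {i0}. c i \<noteq> 0"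
      "\<forall>l\<in>K. (\<Sum>i\<in>I - {i0}. B l i * c i) = 0"
      using insert.IH[of "I - {i0}" B] \<open>finite I\<close> by auto
    define d where "d = c(i0 := - (\<Sum>i\<in>I - {i0}. A k i * c i) / A k i0)"
    have split: "(\<Sum>i\<in>I. A l i * d i) = A l i0 * d i0 + (\<Sum>i\<in>I - {i0}. A l i * c i)" for l
    proof -
      have "(\<Sum>i\<in>I. A l i * d i) = A l i0 * d i0 + (\<Sum>i\<in>I - {i0}. A l i * d i)"
        using i0 \<open>finite I\<close> by (simp add: sum.remove)
      also have "(\<Sum>i\<in>I - {i0}. A l i * d i) = (\<Sum>i\<in>I - {i0}. A l i * c i)"
        by (rule sum.cong) (auto simp: d_def)
      finally show ?thesis .
    qed
    have "(\<Sum>i\<in>I. A l i * d i) = (\<Sum>i\<in>I - {i0}. B l i * c i)" for l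
      unfolding split B_def using i0
      by (simp add: d_def sum_subtractf left_diff_distrib right_diff_distrib sum_distrib_left
          sum_divide_distrib mult_ac)
    moreover have "(\<Sum>i\<in>I - {i0}. B k i * c i) = 0" using i0 by (simp add: B_def)
    ultimately have "\<forall>l\<in>insert k K. (\<Sum>i\<in>I. A l i * d i) = 0" using c(2) by auto
    moreover have "\<exists>i\<in>I. d i \<noteq> 0" using c(1) by (auto simp: d_def)
    ultimately show ?thesis by blast
  qed
qed

text \<open>A square isometry is unitary: the part \<open>w\<close> of the \<open>j\<close>-th unit
  vector orthogonal to the family would, if nonzero, give \<open>card I + 1\<close> independent
  vectors in dimension \<open>card I\<close>.\<close>

lemma orthonormal_family_complete:
  fixes u :: "'k \<Rightarrow> 'i \<Rightarrow> complex"
  assumes fin: "finite K" "finite I" and card: "card K = card I"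
    and on: "\<And>k l. k \<in> K \<Longrightarrow> l \<in> K \<Longrightarrow> (\<Sum>i\<in>I. cnj (u k i) * u l i) = (if k = l then 1 else 0)"
    and i: "i \<in> I" and j: "j \<in> I"
  shows "(\<Sum>k\<in>K. u k i * cnj (u k j)) = (if i = j then 1 else 0)"
proof -
  define w where "w i = (if i = j then 1 else 0) - (\<Sum>k\<in>K. cnj (u k j) * u k i)" for i
  have orth: "(\<Sum>i\<in>I. cnj (u l i) * w i) = 0" if l: "l \<in> K" for l
  proof -
    have "(\<Sum>i\<in>I. cnj (u l i) * w i) = cnj (u l j) - (\<Sum>i\<in>I. \<Sum>k\<in>K. cnj (u k j) * (cnj (u l i) * u k i))"
      using fin j by (simp add: w_def right_diff_distrib sum_subtractf sum_distrib_left
          if_distrib[of "\<lambda>x. _ * x"] cong: if_cong) (simp add: mult.left_commute)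
    also have "(\<Sum>i\<in>I. \<Sum>k\<in>K. cnj (u k j) * (cnj (u l i) * u k i))
        = (\<Sum>k\<in>K. cnj (u k j) * (\<Sum>i\<in>I. cnj (u l i) * u k i))"
      by (subst sum.swap) (simp add: sum_distrib_left)
    also have "\<dots> = (\<Sum>k\<in>K. if l = k then cnj (u k j) else 0)"
      using on l by (intro sum.cong) auto
    also have "\<dots> = cnj (u l j)" using fin l by simp
    finally show ?thesis by simp
  qed
  define M where "M i k = (case k of None \<Rightarrow> w i | Some k \<Rightarrow> u k i)" for i k
  have "card I < card (insert None (Some ` K))"
    using fin card by (simp add: card_image)
  from underdetermined_system[OF fin(2) _ this, of M] fin obtain c
    where c: "\<exists>k\<in>insert None (Some ` K). c k \<noteq> 0"
      "\<forall>i\<in>I. (\<Sum>k\<in>insert None (Some ` K). M i k * c k) = 0" by auto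
  have eq: "w i * c None + (\<Sum>k\<in>K. u k i * c (Some k)) = 0" if "i \<in> I" for i
    using c(2) that fin by (simp add: M_def sum.reindex)
  \<comment> \<open>Pairing the linear dependency with \<open>u l\<close> isolates the coefficient
    of \<open>u l\<close>, so only the coefficient of \<open>w\<close> can survive.\<close>
  have c0: "c (Some l) = 0" if l: "l \<in> K" for l
  proof -
    have "0 = (\<Sum>i\<in>I. cnj (u l i) * (w i * c None + (\<Sum>k\<in>K. u k i * c (Some k))))"
      using eq by simp
    also have "\<dots> = (\<Sum>i\<in>I. cnj (u l i) * w i) * c None
        + (\<Sum>i\<in>I. \<Sum>k\<in>K. (cnj (u l i) * u k i) * c (Some k))"
      by (simp add: distrib_left sum.distrib sum_distrib_left sum_distrib_right mult.assoc)
    also have "(\<Sum>i\<in>I. \<Sum>k\<in>K. (cnj (u l i) * u k i) * c (Some k))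
        = (\<Sum>k\<in>K. (\<Sum>i\<in>I. cnj (u l i) * u k i) * c (Some k))"
      by (subst sum.swap) (simp add: sum_distrib_right)
    also have "\<dots> = (\<Sum>k\<in>K. if l = k then c (Some k) else 0)"
      using on l by (intro sum.cong) auto
    also have "\<dots> = c (Some l)" using fin l by simp
    finally show ?thesis using orth[OF l] by simp
  qed
  then have "c None \<noteq> 0" using c(1) by auto
  moreover have "w i * c None = 0" using eq[OF i] c0 by simp
  ultimately have "w i = 0" by simp
  then show ?thesis unfolding w_def by (simp add: mult.commute)
qed

section \<open>Eigenvectors of Hermitian matrices over a finite index set\<close>

definition lin_ap :: "'i set \<Rightarrow> ('i \<Rightarrow> 'i \<Rightarrow> complex) \<Rightarrow> ('i \<Rightarrow> complex) \<Rightarrow> 'i \<Rightarrow> complex" where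
  "lin_ap I S v i = (\<Sum>j\<in>I. S i j * v j)"

definition inn :: "'i set \<Rightarrow> ('i \<Rightarrow> complex) \<Rightarrow> ('i \<Rightarrow> complex) \<Rightarrow> complex" where
  "inn I v w = (\<Sum>i\<in>I. cnj (v i) * w i)"

lemma inn_cnj: "cnj (inn I v w) = inn I w v"
  by (simp add: inn_def mult.commute)

lemma inn_hermitian:
  assumes "finite I" "\<And>i j. i \<in> I \<Longrightarrow> j \<in> I \<Longrightarrow> S j i = cnj (S i j)"
  shows "inn I v (lin_ap I S w) = inn I (lin_ap I S v) w"
proof -
  have "inn I v (lin_ap I S w) = (\<Sum>j\<in>I. \<Sum>i\<in>I. cnj (v i) * (S i j * w j))"
    unfolding inn_def lin_ap_def sum_distrib_left by (rule sum.swap)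
  also have "\<dots> = (\<Sum>j\<in>I. \<Sum>i\<in>I. cnj (S j i * v i) * w j)"
  proof (intro sum.cong refl)
    fix j i assume "j \<in> I" "i \<in> I"
    then have "S i j = cnj (S j i)" by (rule assms(2))
    then show "cnj (v i) * (S i j * w j) = cnj (S j i * v i) * w j" by (metis complex_cnj_mult mult.assoc mult.commute)
  qed
  finally show ?thesis unfolding inn_def lin_ap_def by (simp add: sum_distrib_right)
qed

lemma inn_cong:
  assumes "\<And>i. i \<in> I \<Longrightarrow> v i = v' i" "\<And>i. i \<in> I \<Longrightarrow> w i = w' i"
  shows "inn I v w = inn I v' w'"
  unfolding inn_def using assms by (intro sum.cong) auto

lemma inn_lin_right: "inn I v (\<lambda>i. a * w i + b * w' i) = a * inn I v w + b * inn I v w'"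
  by (simp add: inn_def distrib_left sum.distrib sum_distrib_left mult_ac)

lemma lin_ap_lin: "lin_ap I S (\<lambda>i. a * w i + b * w' i) i = a * lin_ap I S w i + b * lin_ap I S w' i"
  by (simp add: lin_ap_def distrib_left sum.distrib sum_distrib_left mult_ac)

lemma inn_self: "finite I \<Longrightarrow> inn I v v = of_real (\<Sum>i\<in>I. (cmod (v i))^2)"
  unfolding inn_def of_real_sum by (intro sum.cong refl) (subst complex_norm_square, simp)

lemma inn_self_pos: "finite I \<Longrightarrow> i \<in> I \<Longrightarrow> v i \<noteq> 0 \<Longrightarrow> (\<Sum>i\<in>I. (cmod (v i))^2) > 0"
  by (rule sum_pos2[where i=i]) auto

lemma complex_normaliser:
  fixes t :: real
  assumes t: "t > 0"
  shows "\<exists>a. cnj a * a * of_real t = 1"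
proof -
  have "complex_of_real (1 / sqrt t * (1 / sqrt t)) * of_real t = 1" using t by simp
  then have "cnj (of_real (1 / sqrt t)) * of_real (1 / sqrt t) * complex_of_real t = 1"
    by (simp only: complex_cnj_complex_of_real of_real_mult)
  then show ?thesis by blast
qed

text \<open>Factoring an annihilating polynomial into linear factors yields an eigenvector inside any
  invariant subspace.\<close>

lemma eigenvector_of_annihilating_poly:
  fixes p :: "complex poly"
  assumes W: "\<And>v. W v \<Longrightarrow> W (lin_ap I S v)"
      "\<And>v w a b. W v \<Longrightarrow> W w \<Longrightarrow> W (\<lambda>i. a * v i + b * w i)"
  shows "p \<noteq> 0 \<Longrightarrow> degree p \<le> n \<Longrightarrow> W v \<Longrightarrow> (\<exists>i\<in>I. v i \<noteq> 0) \<Longrightarrow>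
     (\<forall>i\<in>I. (\<Sum>k\<le>n. coeff p k * ((lin_ap I S ^^ k) v) i) = 0) \<Longrightarrow>
     \<exists>z w. W w \<and> (\<exists>i\<in>I. w i \<noteq> 0) \<and> (\<forall>i\<in>I. lin_ap I S w i = z * w i)"
proof (induction n arbitrary: p v)
  case 0
  then obtain i where i: "i \<in> I" "v i \<noteq> 0" by blast
  have "coeff p 0 = 0" using "0.prems" i by force
  moreover have "degree p = 0" using "0.prems" by simp
  ultimately have "p = 0" by (metis leading_coeff_0_iff)
  then show ?case using "0.prems" by simp
next
  case (Suc n)
  show ?case
  proof (cases "degree p = 0")
    case True
    obtain i where i: "i \<in> I" "v i \<noteq> 0" using Suc.prems by blast
    have "(\<Sum>k\<le>Suc n. coeff p k * ((lin_ap I S ^^ k) v) i) = coeff p 0 * v i"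
      using True by (subst sum.atMost_Suc_shift) (simp add: coeff_eq_0)
    then have "coeff p 0 = 0" using Suc.prems i by force
    then have "p = 0" using True by (metis leading_coeff_0_iff)
    then show ?thesis using Suc.prems by simp
  next
    case False
    then have "\<not> constant (poly p)" by (simp add: constant_degree)
    then obtain z where "poly p z = 0" using fundamental_theorem_of_algebra by blast
    then obtain q where q: "p = [:-z, 1:] * q" by (auto simp: poly_eq_0_iff_dvd elim: dvdE)
    have q0: "q \<noteq> 0" using q Suc.prems by auto
    have "degree p = Suc (degree q)" unfolding q using q0 by (subst degree_mult_eq) auto
    then have dq: "degree q \<le> n" using Suc.prems by simp
    \<comment> \<open>\<open>v'\<close> is (S - z) v. If it vanishes on \<open>I\<close>, then
      \<open>v\<close> is an eigenvector; otherwise the cofactor \<open>q\<close> annihilates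
      \<open>v'\<close>. The factor 1 keeps the shape required by the closure of \<open>W\<close>
      and by \<open>lin_ap_lin\<close>.\<close>
    define v' where "v' i = 1 * lin_ap I S v i + (-z) * v i" for i
    have Wv': "W v'" unfolding v'_def by (intro W Suc.prems)
    have pw: "(lin_ap I S ^^ k) v' = (\<lambda>i. 1 * (lin_ap I S ^^ Suc k) v i + (-z) * (lin_ap I S ^^ k) v i)" for k
    proof (induction k)
      case 0
      show ?case by (simp add: v'_def fun_eq_iff)
    next
      case (Suc k)
      have "(lin_ap I S ^^ Suc k) v' = lin_ap I S ((lin_ap I S ^^ k) v')" by simp
      also have "\<dots> = lin_ap I S (\<lambda>i. 1 * (lin_ap I S ^^ Suc k) v i + (-z) * (lin_ap I S ^^ k) v i)"
        by (simp only: Suc.IH)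
      also have "\<dots> = (\<lambda>i. 1 * (lin_ap I S ^^ Suc (Suc k)) v i + (-z) * (lin_ap I S ^^ Suc k) v i)"
        by (rule ext) (subst lin_ap_lin, simp)
      finally show ?case .
    qed
    show ?thesis
    proof (cases "\<exists>i\<in>I. v' i \<noteq> 0")
      case False
      then show ?thesis using Suc.prems by (intro exI[of _ z] exI[of _ v]) (auto simp: v'_def)
    next
      case True
      have key: "(\<Sum>k\<le>n. coeff q k * ((lin_ap I S ^^ k) v') i) = 0" if "i \<in> I" for i
      proof -
        let ?f = "\<lambda>k. ((lin_ap I S ^^ k) v) i"
        have cp: "coeff p k = (case k of 0 \<Rightarrow> 0 | Suc m \<Rightarrow> coeff q m) - z * coeff q k" for k
          by (simp add: q coeff_pCons split: nat.split)
        have "0 = (\<Sum>k\<le>Suc n. coeff p k * ?f k)" using Suc.prems that by simp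
        also have "\<dots> = (\<Sum>k\<le>Suc n. (case k of 0 \<Rightarrow> 0 | Suc m \<Rightarrow> coeff q m) * ?f k)
            - (\<Sum>k\<le>Suc n. z * coeff q k * ?f k)"
          by (simp only: cp left_diff_distrib sum_subtractf)
        also have "(\<Sum>k\<le>Suc n. (case k of 0 \<Rightarrow> 0 | Suc m \<Rightarrow> coeff q m) * ?f k)
            = (\<Sum>k\<le>n. coeff q k * ?f (Suc k))"
          by (subst sum.atMost_Suc_shift) simp
        also have "(\<Sum>k\<le>Suc n. z * coeff q k * ?f k) = (\<Sum>k\<le>n. z * coeff q k * ?f k)"
          using dq by (simp add: coeff_eq_0)
        finally show ?thesis unfolding pw by (simp add: sum_subtractf[symmetric] algebra_simps)
      qed
      show ?thesis using Suc.IH[OF q0 dq Wv' True] key by blast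
    qed
  qed
qed

text \<open>The vectors orthogonal to given eigenvectors of a Hermitian matrix form an invariant
  subspace, nonzero because there are fewer constraints than dimensions. Among v, S v, S^2 v, ...
  the first \<open>card I + 1\<close> are dependent, which supplies an annihilating polynomial
  without determinants.\<close>

lemma hermitian_eigenvector_orthogonal:
  fixes g :: "'k \<Rightarrow> 'i \<Rightarrow> complex"
  assumes fin: "finite K" "finite I" "card K < card I"
    and herm: "\<And>i j. i \<in> I \<Longrightarrow> j \<in> I \<Longrightarrow> S j i = cnj (S i j)"
    and ev: "\<And>k i. k \<in> K \<Longrightarrow> i \<in> I \<Longrightarrow> lin_ap I S (g k) i = e k * g k i"
  shows "\<exists>(r::real) w. (\<forall>k\<in>K. inn I (g k) w = 0) \<and> inn I w w = 1
     \<and> (\<forall>i\<in>I. lin_ap I S w i = of_real r * w i)"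
proof -
  define W where "W w \<longleftrightarrow> (\<forall>k\<in>K. inn I (g k) w = 0)" for w
  have W1: "W (lin_ap I S v)" if "W v" for v
    unfolding W_def
  proof
    fix k assume k: "k \<in> K"
    have "inn I (g k) (lin_ap I S v) = inn I (lin_ap I S (g k)) v"
      by (rule inn_hermitian[OF fin(2) herm])
    also have "\<dots> = inn I (\<lambda>i. e k * g k i) v" using ev k by (intro inn_cong) auto
    also have "\<dots> = cnj (e k) * inn I (g k) v"
      by (simp add: inn_def sum_distrib_left mult.assoc)
    finally show "inn I (g k) (lin_ap I S v) = 0" using that k by (simp add: W_def)
  qed
  have W2: "W (\<lambda>i. a * v i + b * w i)" if "W v" "W w" for v w a b
    using that by (simp add: W_def inn_lin_right)
  have Wpow: "W ((lin_ap I S ^^ k) v)" if "W v" for k v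
    by (induction k) (auto simp: that W1)
  obtain v where v: "\<exists>i\<in>I. v i \<noteq> 0" "W v"
    using underdetermined_system[OF fin, of "\<lambda>k i. cnj (g k i)"] by (auto simp: W_def inn_def)
  let ?N = "card I"
  obtain c where c: "\<exists>k\<in>{..?N}. c k \<noteq> 0" "\<forall>i\<in>I. (\<Sum>k\<le>?N. ((lin_ap I S ^^ k) v) i * c k) = 0"
    using underdetermined_system[OF fin(2), of "{..?N}" "\<lambda>i k. ((lin_ap I S ^^ k) v) i"] by auto
  define p where "p = (\<Sum>k\<le>?N. monom (c k) k)"
  have cp: "coeff p k = (if k \<le> ?N then c k else 0)" for k
    by (simp add: p_def coeff_sum if_distrib cong: if_cong)
  have "p \<noteq> 0" using c(1) cp by (metis atMost_iff coeff_0)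
  moreover have "degree p \<le> ?N" by (rule degree_le) (simp add: cp)
  moreover have "\<forall>i\<in>I. (\<Sum>k\<le>?N. coeff p k * ((lin_ap I S ^^ k) v) i) = 0"
    using c(2) by (simp add: cp mult.commute)
  ultimately have "\<exists>z w. W w \<and> (\<exists>i\<in>I. w i \<noteq> 0) \<and> (\<forall>i\<in>I. lin_ap I S w i = z * w i)"
    by (intro eigenvector_of_annihilating_poly[OF W1 W2 _ _ v(2,1)])
  then obtain z w where w: "W w" "\<exists>i\<in>I. w i \<noteq> 0" "\<forall>i\<in>I. lin_ap I S w i = z * w i"
    by (elim exE conjE)
  define t where "t = (\<Sum>i\<in>I. (cmod (w i))^2)"
  have t: "t > 0" using w(2) inn_self_pos[OF fin(2), of _ w] unfolding t_def by auto
  have ww: "inn I w w = of_real t" using fin by (simp add: inn_self t_def)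
  have "inn I w (lin_ap I S w) = inn I w (\<lambda>i. z * w i)" using w by (intro inn_cong) auto
  then have 1: "inn I w (lin_ap I S w) = z * of_real t"
    using inn_lin_right[of I w z w 0 w] ww by simp
  have "inn I w (lin_ap I S w) = inn I (lin_ap I S w) w" by (rule inn_hermitian[OF fin(2) herm])
  also have "\<dots> = cnj (inn I w (lin_ap I S w))" by (simp add: inn_cnj)
  finally have "z * of_real t = cnj z * of_real t" using 1 by simp
  then have "cnj z = z" using t by simp
  then obtain r where z: "z = of_real r" by (metis Reals_cnj_iff Reals_cases)
  obtain a where a: "cnj a * a * of_real t = 1" using complex_normaliser[OF t] by blast
  define w' where "w' = (\<lambda>i. a * w i)"
  have "\<forall>k\<in>K. inn I (g k) w' = 0"
    using w(1) by (simp add: W_def w'_def inn_def mult.left_commute sum_distrib_left[symmetric])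
  moreover have "inn I w' w' = cnj a * a * inn I w w"
    by (simp add: inn_def w'_def sum_distrib_left mult_ac)
  then have "inn I w' w' = 1" using ww a by simp
  moreover have "\<forall>i\<in>I. lin_ap I S w' i = of_real r * w' i"
  proof
    fix i assume "i \<in> I"
    have "lin_ap I S w' i = a * lin_ap I S w i"
      by (simp add: lin_ap_def w'_def sum_distrib_left mult_ac)
    then show "lin_ap I S w' i = of_real r * w' i"
      using w(3) \<open>i \<in> I\<close> z by (simp add: w'_def)
  qed
  ultimately show ?thesis by blast
qed


text \<open>The antilinear conjugation J, for an involution \<open>\<sigma>\<close> of an abstract
  index set; on the block \<open>\<sigma>\<close> will exchange the components + and - at each
  site.\<close>

definition dual_conj :: "('i \<Rightarrow> 'i) \<Rightarrow> ('i \<Rightarrow> complex) \<Rightarrow> 'i \<Rightarrow> complex" where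
  "dual_conj \<sigma> v i = cnj (v (\<sigma> i))"

lemma sum_involution:
  assumes "\<And>i. i \<in> I \<Longrightarrow> \<sigma> i \<in> I" "\<And>i. i \<in> I \<Longrightarrow> \<sigma> (\<sigma> i) = i"
  shows "(\<Sum>i\<in>I. h (\<sigma> i)) = (\<Sum>i\<in>I. h i)"
  by (rule sum.reindex_bij_witness[where i=\<sigma> and j=\<sigma>]) (use assms in auto)

text \<open>The bilinear form (J v, w) is symmetric because J is an involution. This symmetry turns
  isotropy of a combination of two vectors into a quadratic equation.\<close>

lemma inn_dual_conj_sym:
  assumes "\<And>i. i \<in> I \<Longrightarrow> \<sigma> i \<in> I" "\<And>i. i \<in> I \<Longrightarrow> \<sigma> (\<sigma> i) = i"
  shows "inn I (dual_conj \<sigma> v) w = inn I (dual_conj \<sigma> w) v"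
proof -
  have "inn I (dual_conj \<sigma> v) w = (\<Sum>i\<in>I. v (\<sigma> i) * w i)"
    by (simp add: inn_def dual_conj_def)
  also have "\<dots> = (\<Sum>i\<in>I. v (\<sigma> (\<sigma> i)) * w (\<sigma> i))"
    by (rule sum_involution[symmetric]) (use assms in auto)
  also have "\<dots> = (\<Sum>i\<in>I. v i * w (\<sigma> i))" by (rule sum.cong) (use assms in auto)
  finally show ?thesis by (simp add: inn_def dual_conj_def mult.commute)
qed

text \<open>\<open>sd\<close> says J S J = 1 - S: by hermiticity
  \<open>S (\<sigma> j) (\<sigma> i)\<close> is the entry (i, j) of J S J. As J is antilinear and
  \<open>r\<close> is real, the eigenvalue \<open>r\<close> passes to 1 - r.\<close>

lemma dual_conj_eigenvector:
  assumes fin: "finite I"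
    and \<sigma>: "\<And>i. i \<in> I \<Longrightarrow> \<sigma> i \<in> I" "\<And>i. i \<in> I \<Longrightarrow> \<sigma> (\<sigma> i) = i"
    and herm: "\<And>i j. i \<in> I \<Longrightarrow> j \<in> I \<Longrightarrow> S j i = cnj (S i j)"
    and sd: "\<And>i j. i \<in> I \<Longrightarrow> j \<in> I \<Longrightarrow> S (\<sigma> j) (\<sigma> i) + S i j = (if i = j then 1 else 0)"
    and ev: "\<And>i. i \<in> I \<Longrightarrow> lin_ap I S v i = of_real r * v i"
    and i: "i \<in> I"
  shows "lin_ap I S (dual_conj \<sigma> v) i = of_real (1 - r) * dual_conj \<sigma> v i"
proof -
  have "lin_ap I S (dual_conj \<sigma> v) i
      = (\<Sum>j\<in>I. ((if i = j then 1 else 0) - S (\<sigma> j) (\<sigma> i)) * cnj (v (\<sigma> j)))"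
    unfolding lin_ap_def dual_conj_def
  proof (intro sum.cong refl)
    fix j assume "j \<in> I"
    have "S i j = (if i = j then 1 else 0) - S (\<sigma> j) (\<sigma> i)"
      using sd[OF i \<open>j \<in> I\<close>] by (metis add_diff_cancel_left')
    then show "S i j * cnj (v (\<sigma> j)) = ((if i = j then 1 else 0) - S (\<sigma> j) (\<sigma> i)) * cnj (v (\<sigma> j))"
      by (rule arg_cong)
  qed
  also have "\<dots> = (\<Sum>j\<in>I. (if i = j then 1 else 0) * cnj (v (\<sigma> j)))
      - (\<Sum>j\<in>I. S (\<sigma> j) (\<sigma> i) * cnj (v (\<sigma> j)))"
    by (simp only: left_diff_distrib sum_subtractf)
  also have "(\<Sum>j\<in>I. (if i = j then 1 else 0) * cnj (v (\<sigma> j))) = cnj (v (\<sigma> i))"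
    using fin i by (simp add: if_distrib[of "\<lambda>x. x * _"] cong: if_cong)
  also have "(\<Sum>j\<in>I. S (\<sigma> j) (\<sigma> i) * cnj (v (\<sigma> j))) = (\<Sum>j\<in>I. S j (\<sigma> i) * cnj (v j))"
    by (rule sum_involution) (use \<sigma> in auto)
  also have "\<dots> = cnj (lin_ap I S v (\<sigma> i))"
    unfolding lin_ap_def cnj_sum
  proof (intro sum.cong refl)
    fix j assume "j \<in> I"
    then have "S j (\<sigma> i) = cnj (S (\<sigma> i) j)" using \<sigma> i by (intro herm) auto
    then show "S j (\<sigma> i) * cnj (v j) = cnj (S (\<sigma> i) j * v j)" by simp
  qed
  also have "\<dots> = of_real r * cnj (v (\<sigma> i))" using ev \<sigma> i by simp
  finally show ?thesis
    unfolding dual_conj_def[of \<sigma> v i] by (simp add: left_diff_distrib)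
qed

lemma eigenvectors_orthogonal:
  assumes fin: "finite I"
    and herm: "\<And>i j. i \<in> I \<Longrightarrow> j \<in> I \<Longrightarrow> S j i = cnj (S i j)"
    and ev: "\<And>i. i \<in> I \<Longrightarrow> lin_ap I S v i = of_real r * v i"
      "\<And>i. i \<in> I \<Longrightarrow> lin_ap I S w i = of_real s * w i"
    and "r \<noteq> s"
  shows "inn I v w = 0"
proof -
  have "of_real s * inn I v w = inn I v (lin_ap I S w)"
    using inn_cong[of I v v "lin_ap I S w" "\<lambda>i. of_real s * w i"] ev(2)
    by (simp add: inn_def sum_distrib_left mult_ac)
  also have "\<dots> = inn I (lin_ap I S v) w" by (rule inn_hermitian[OF fin herm])
  also have "\<dots> = inn I (\<lambda>i. of_real r * v i) w" using ev(1) by (intro inn_cong) auto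
  also have "\<dots> = of_real r * inn I v w" by (simp add: inn_def sum_distrib_left mult_ac)
  finally show ?thesis using \<open>r \<noteq> s\<close> by simp
qed

lemma complex_quadratic_root: "(c::complex) \<noteq> 0 \<Longrightarrow> \<exists>z. a + 2 * b * z + c * z^2 = 0"
  by (rule exI[of _ "(csqrt (b^2 - a * c) - b) / c"])
     (simp add: field_simps power2_eq_square power2_csqrt[unfolded power2_eq_square])

text \<open>An eigenvector whose eigenvalue is not 1/2 is automatically orthogonal to its dual
  conjugate. Otherwise two orthogonal eigenvectors for 1/2 are combined by solving a quadratic
  equation.\<close>

lemma isotropic_eigenvector:
  fixes g :: "'k \<Rightarrow> 'i \<Rightarrow> complex"
  assumes fin: "finite K" "finite I" and card: "card K + 1 < card I"
    and \<sigma>: "\<And>i. i \<in> I \<Longrightarrow> \<sigma> i \<in> I" "\<And>i. i \<in> I \<Longrightarrow> \<sigma> (\<sigma> i) = i"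
    and herm: "\<And>i j. i \<in> I \<Longrightarrow> j \<in> I \<Longrightarrow> S j i = cnj (S i j)"
    and sd: "\<And>i j. i \<in> I \<Longrightarrow> j \<in> I \<Longrightarrow> S (\<sigma> j) (\<sigma> i) + S i j = (if i = j then 1 else 0)"
    and ev: "\<And>k i. k \<in> K \<Longrightarrow> i \<in> I \<Longrightarrow> lin_ap I S (g k) i = e k * g k i"
  shows "\<exists>(r::real) w. (\<forall>k\<in>K. inn I (g k) w = 0) \<and> inn I w w = 1
     \<and> (\<forall>i\<in>I. lin_ap I S w i = of_real r * w i) \<and> inn I (dual_conj \<sigma> w) w = 0"
proof -
  have half: "inn I (dual_conj \<sigma> w) w = 0"
    if "\<forall>i\<in>I. lin_ap I S w i = of_real r * w i" "r \<noteq> 1/2" for r w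
  proof (rule eigenvectors_orthogonal[where r="1 - r" and s=r, OF fin(2) herm])
    show "lin_ap I S (dual_conj \<sigma> w) i = of_real (1 - r) * dual_conj \<sigma> w i" if "i \<in> I" for i
      by (rule dual_conj_eigenvector[OF fin(2) \<sigma> herm sd _ that])
         (use \<open>\<forall>i\<in>I. lin_ap I S w i = of_real r * w i\<close> in auto)
  qed (use that in auto)
  obtain r1 w1 where w1: "\<forall>k\<in>K. inn I (g k) w1 = 0" "inn I w1 w1 = 1"
     "\<forall>i\<in>I. lin_ap I S w1 i = of_real r1 * w1 i"
    using hermitian_eigenvector_orthogonal[where K=K and g=g and e=e and I=I and S=S, OF fin _ herm ev] card by auto
  \<comment> \<open>Adding \<open>w1\<close> to the constraints yields a second eigenvector
    orthogonal to it; the cardinality hypothesis leaves room for exactly these two searches.\<close>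
  define g' where "g' k = (case k of None \<Rightarrow> w1 | Some k \<Rightarrow> g k)" for k
  define e' where "e' k = (case k of None \<Rightarrow> of_real r1 | Some k \<Rightarrow> e k)" for k
  have "\<exists>(r::real) w. (\<forall>k\<in>insert None (Some ` K). inn I (g' k) w = 0) \<and> inn I w w = 1
     \<and> (\<forall>i\<in>I. lin_ap I S w i = of_real r * w i)"
  proof (rule hermitian_eigenvector_orthogonal[where e=e', OF _ fin(2) _ herm])
    show "card (insert None (Some ` K)) < card I" using card fin by (simp add: card_image)
    show "lin_ap I S (g' k) i = e' k * g' k i" if "k \<in> insert None (Some ` K)" "i \<in> I" for k i
      using that ev w1 by (auto simp: g'_def e'_def)
  qed (use fin in auto)
  then obtain r2 w2 where "\<forall>k\<in>insert None (Some ` K). inn I (g' k) w2 = 0"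
      and w2: "inn I w2 w2 = 1" "\<forall>i\<in>I. lin_ap I S w2 i = of_real r2 * w2 i" by auto
  then have w2K: "\<forall>k\<in>K. inn I (g k) w2 = 0" and w12: "inn I w1 w2 = 0"
    by (auto simp: g'_def)
  then have w21: "inn I w2 w1 = 0" by (metis complex_cnj_zero inn_cnj)
  consider "r1 \<noteq> 1/2" | "r2 \<noteq> 1/2 \<or> inn I (dual_conj \<sigma> w2) w2 = 0"
    | "r1 = 1/2" "r2 = 1/2" "inn I (dual_conj \<sigma> w2) w2 \<noteq> 0" by blast
  then show ?thesis
  proof cases
    case 1
    then show ?thesis using half[OF w1(3)] w1 by blast
  next
    case 2
    then show ?thesis using half[OF w2(2)] w2 w2K by blast
  next
    case 3
    \<comment> \<open>Isotropy of w1 + z w2 under the symmetric form (J v, v) is a quadratic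
      equation in z. The squared norm is 1 + |z|^2 since \<open>w1\<close> and \<open>w2\<close> are
      orthonormal.\<close>
    obtain z where z: "inn I (dual_conj \<sigma> w1) w1 + 2 * inn I (dual_conj \<sigma> w1) w2 * z
        + inn I (dual_conj \<sigma> w2) w2 * z^2 = 0"
      using complex_quadratic_root[OF 3(3)] by blast
    define t where "t = 1 + (cmod z)^2"
    have t: "t > 0" by (simp add: t_def add_pos_nonneg)
    obtain a where a: "cnj a * a * of_real t = 1" using complex_normaliser[OF t] by blast
    define w where "w = (\<lambda>i. a * w1 i + a * z * w2 i)"
    have right: "inn I v w = a * inn I v w1 + a * z * inn I v w2" for v
      unfolding w_def by (rule inn_lin_right)
    have left: "inn I w v = cnj a * inn I w1 v + cnj (a * z) * inn I w2 v" for v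
      using right[of v] by (metis complex_cnj_add complex_cnj_mult inn_cnj)
    have leftd: "inn I (dual_conj \<sigma> w) v
        = a * inn I (dual_conj \<sigma> w1) v + a * z * inn I (dual_conj \<sigma> w2) v" for v
      by (simp add: inn_def dual_conj_def w_def distrib_right distrib_left sum.distrib
          sum_distrib_left mult_ac)
    have "inn I w w = cnj a * a * (1 + cnj z * z)"
      unfolding left right using w1(2) w2(1) w12 w21 by (simp add: algebra_simps)
    also have "1 + cnj z * z = of_real t"
      by (simp add: t_def complex_norm_square[symmetric] mult.commute[of "cnj z"] del: of_real_power)
    finally have "inn I w w = 1" using a by simp
    moreover have "inn I (dual_conj \<sigma> w) w = a * a * (inn I (dual_conj \<sigma> w1) w1
        + 2 * inn I (dual_conj \<sigma> w1) w2 * z + inn I (dual_conj \<sigma> w2) w2 * z^2)"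
      unfolding leftd right inn_dual_conj_sym[OF \<sigma>, of w2 w1, simplified]
      by (simp add: algebra_simps power2_eq_square)
    then have "inn I (dual_conj \<sigma> w) w = 0" using z by simp
    moreover have "\<forall>i\<in>I. lin_ap I S w i = of_real (1/2) * w i"
    proof
      fix i assume "i \<in> I"
      then have e: "lin_ap I S w1 i = of_real (1/2) * w1 i" "lin_ap I S w2 i = of_real (1/2) * w2 i"
        using w1(3) w2(2) 3 by auto
      show "lin_ap I S w i = of_real (1/2) * w i"
        unfolding w_def lin_ap_lin e by (simp add: algebra_simps)
    qed
    moreover have "\<forall>k\<in>K. inn I (g k) w = 0" unfolding right using w1(1) w2K by auto
    ultimately show ?thesis by blast
  qed
qed

text \<open>Induction on the number m of pairs. The 2 m vectors u_k, J u_k are again eigenvectors,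
  and for m < n they leave at least two dimensions free, as \<open>isotropic_eigenvector\<close>
  demands for a possible eigenvalue 1/2.\<close>

lemma self_dual_diagonalisation:
  assumes fin: "finite I" and card: "card I = 2 * n"
    and \<sigma>: "\<And>i. i \<in> I \<Longrightarrow> \<sigma> i \<in> I" "\<And>i. i \<in> I \<Longrightarrow> \<sigma> (\<sigma> i) = i"
    and herm: "\<And>i j. i \<in> I \<Longrightarrow> j \<in> I \<Longrightarrow> S j i = cnj (S i j)"
    and sd: "\<And>i j. i \<in> I \<Longrightarrow> j \<in> I \<Longrightarrow> S (\<sigma> j) (\<sigma> i) + S i j = (if i = j then 1 else 0)"
  shows "\<exists>u (\<nu>::nat \<Rightarrow> real). \<forall>k<n. (\<forall>i\<in>I. lin_ap I S (u k) i = of_real (\<nu> k) * u k i)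
     \<and> (\<forall>l<n. inn I (u k) (u l) = (if k = l then 1 else 0) \<and> inn I (dual_conj \<sigma> (u k)) (u l) = 0)"
proof -
  have "\<exists>u (\<nu>::nat \<Rightarrow> real). \<forall>k<m. (\<forall>i\<in>I. lin_ap I S (u k) i = of_real (\<nu> k) * u k i)
     \<and> (\<forall>l<m. inn I (u k) (u l) = (if k = l then 1 else 0) \<and> inn I (dual_conj \<sigma> (u k)) (u l) = 0)"
    if "m \<le> n" for m
    using that
  proof (induction m)
    case 0
    show ?case by simp
  next
    case (Suc m)
    then obtain u and \<nu> :: "nat \<Rightarrow> real" where
      all: "\<forall>k<m. (\<forall>i\<in>I. lin_ap I S (u k) i = of_real (\<nu> k) * u k i)
        \<and> (\<forall>l<m. inn I (u k) (u l) = (if k = l then 1 else 0) \<and> inn I (dual_conj \<sigma> (u k)) (u l) = 0)"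
      by (metis Suc_leD)
    have ev: "\<And>k i. k < m \<Longrightarrow> i \<in> I \<Longrightarrow> lin_ap I S (u k) i = of_real (\<nu> k) * u k i"
      and on: "\<And>k l. k < m \<Longrightarrow> l < m \<Longrightarrow> inn I (u k) (u l) = (if k = l then 1 else 0)"
      and dual: "\<And>k l. k < m \<Longrightarrow> l < m \<Longrightarrow> inn I (dual_conj \<sigma> (u k)) (u l) = 0"
      using all by blast+
    define g where "g p = (if fst p then u (snd p) else dual_conj \<sigma> (u (snd p)))" for p :: "bool \<times> nat"
    define e :: "bool \<times> nat \<Rightarrow> complex" where
      "e p = of_real (if fst p then \<nu> (snd p) else 1 - \<nu> (snd p))" for p
    have "\<exists>(r::real) w. (\<forall>k\<in>UNIV \<times> {..<m}. inn I (g k) w = 0) \<and> inn I w w = 1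
     \<and> (\<forall>i\<in>I. lin_ap I S w i = of_real r * w i) \<and> inn I (dual_conj \<sigma> w) w = 0"
    proof (rule isotropic_eigenvector[where e=e, OF _ fin _ \<sigma> herm sd])
      show "card ((UNIV::bool set) \<times> {..<m}) + 1 < card I"
        using Suc.prems card by (simp add: card_cartesian_product)
      show "lin_ap I S (g k) i = e k * g k i" if "k \<in> UNIV \<times> {..<m}" "i \<in> I" for k i
      proof (cases "fst k")
        case True
        then show ?thesis using ev that by (auto simp: g_def e_def)
      next
        case False
        have "snd k < m" using that by auto
        have "lin_ap I S (dual_conj \<sigma> (u (snd k))) i
            = of_real (1 - \<nu> (snd k)) * dual_conj \<sigma> (u (snd k)) i"
          by (rule dual_conj_eigenvector[OF fin \<sigma> herm sd ev[OF \<open>snd k < m\<close>] that(2)])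
        then show ?thesis using False by (simp add: g_def e_def)
      qed
    qed auto
    then obtain r w where w: "\<forall>k\<in>UNIV \<times> {..<m}. inn I (g k) w = 0" "inn I w w = 1"
      "\<forall>i\<in>I. lin_ap I S w i = of_real (r::real) * w i" "inn I (dual_conj \<sigma> w) w = 0" by auto
    have w1: "inn I (u k) w = 0" "inn I (dual_conj \<sigma> (u k)) w = 0" if "k < m" for k
      using bspec[OF w(1), of "(True, k)"] bspec[OF w(1), of "(False, k)"] that
      by (auto simp: g_def)
    have w2: "inn I w (u k) = 0" if "k < m" for k
      using w1(1)[OF that] by (metis complex_cnj_zero inn_cnj)
    \<comment> \<open>Orthogonality of J u_k to the new vector is transferred to J w and u_k by the
      symmetry of the form.\<close>
    have w3: "inn I (dual_conj \<sigma> w) (u k) = 0" if "k < m" for k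
      using w1(2)[OF that] inn_dual_conj_sym[OF \<sigma>, of "u k" w] by simp
    show ?case
      by (rule exI[of _ "u(m := w)"], rule exI[of _ "\<nu>(m := r)"])
         (use ev on dual w w1 w2 w3 in \<open>auto simp: less_Suc_eq\<close>)
  qed
  then show ?thesis by blast
qed

section \<open>Canonical anticommutation relations in the Fock representation\<close>

lemma mmul_assoc: "mmul N (mmul N A B) C = mmul N A (mmul N B C)"
proof (intro ext)
  fix i j
  have "mmul N (mmul N A B) C i j = (\<Sum>k<N. \<Sum>l<N. A i l * B l k * C k j)"
    by (simp add: mmul_def sum_distrib_right)
  also have "\<dots> = (\<Sum>l<N. \<Sum>k<N. A i l * B l k * C k j)" by (rule sum.swap)
  finally show "mmul N (mmul N A B) C i j = mmul N A (mmul N B C) i j"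
    by (simp add: mmul_def sum_distrib_left mult.assoc)
qed

lemma mmul_add_left: "mmul N (\<lambda>i j. A i j + B i j) C = (\<lambda>i j. mmul N A C i j + mmul N B C i j)"
  by (simp add: mmul_def distrib_right sum.distrib fun_eq_iff)

lemma mmul_add_right: "mmul N C (\<lambda>i j. A i j + B i j) = (\<lambda>i j. mmul N C A i j + mmul N C B i j)"
  by (simp add: mmul_def distrib_left sum.distrib fun_eq_iff)

lemma mmul_scale_left: "mmul N (\<lambda>i j. c * A i j) B = (\<lambda>i j. c * mmul N A B i j)"
  by (simp add: mmul_def sum_distrib_left mult.assoc fun_eq_iff)

lemma mmul_scale_right: "mmul N A (\<lambda>i j. c * B i j) = (\<lambda>i j. c * mmul N A B i j)"
  by (simp add: mmul_def sum_distrib_left mult.left_commute fun_eq_iff)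

lemma mmul_sum_left: "mmul N (\<lambda>i j. \<Sum>x\<in>X. A x i j) B = (\<lambda>i j. \<Sum>x\<in>X. mmul N (A x) B i j)"
  unfolding mmul_def sum_distrib_right by (intro ext) (rule sum.swap)

lemma mmul_sum_right: "mmul N A (\<lambda>i j. \<Sum>x\<in>X. B x i j) = (\<lambda>i j. \<Sum>x\<in>X. mmul N A (B x) i j)"
  unfolding mmul_def sum_distrib_left by (intro ext) (rule sum.swap)

lemma mtrace_mmul_commute: "mtrace N (mmul N A B) = mtrace N (mmul N B A)"
  unfolding mtrace_def mmul_def by (subst sum.swap) (simp add: mult.commute)

text \<open>The Jordan-Wigner string: the parity of the occupied sites before \<open>k\<close>. For
  \<open>k\<close> equal to the number of sites it is the total fermion parity, and it serves as
  such in \<open>fock_mono_parity\<close>.\<close>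

definition jw_sign :: "nat \<Rightarrow> nat \<Rightarrow> complex" where
  "jw_sign k s = (-1) ^ card {j. j < k \<and> bit s j}"

lemma jw_sign_square [simp]: "jw_sign k s * jw_sign k s = 1"
  by (simp add: jw_sign_def power_mult_distrib[symmetric])

lemma jw_sign_cnj [simp]: "cnj (jw_sign k s) = jw_sign k s"
  by (simp add: jw_sign_def)

lemma jw_sign_insert:
  assumes "y < x" "\<not> bit s y" "\<And>j. j < x \<Longrightarrow> j \<noteq> y \<Longrightarrow> bit t j = bit s j" "bit t y"
  shows "jw_sign x t = - jw_sign x s"
proof -
  have "{j. j < x \<and> bit t j} = insert y {j. j < x \<and> bit s j}" using assms by auto
  moreover have "y \<notin> {j. j < x \<and> bit s j}" using assms by auto
  ultimately show ?thesis by (simp add: jw_sign_def)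
qed

lemma jw_sign_cong: "(\<And>j. j < x \<Longrightarrow> bit t j = bit s j) \<Longrightarrow> jw_sign x t = jw_sign x s"
  unfolding jw_sign_def by (intro arg_cong[where f="\<lambda>A. (-1) ^ card A"]) auto

lemma jw_sign_set_bit:
  "jw_sign x (set_bit y s) = (if y < x \<and> \<not> bit s y then - jw_sign x s else jw_sign x s)"
proof (cases "y < x \<and> \<not> bit s y")
  case True
  then show ?thesis by (subst jw_sign_insert[of y x s]) (auto simp: bit_set_bit_iff)
next
  case False
  then show ?thesis by (auto intro!: jw_sign_cong simp: bit_set_bit_iff)
qed

lemma jw_sign_unset_bit:
  "jw_sign x (unset_bit y s) = (if y < x \<and> bit s y then - jw_sign x s else jw_sign x s)"
proof (cases "y < x \<and> bit s y")
  case True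
  then have "jw_sign x s = - jw_sign x (unset_bit y s)"
    by (intro jw_sign_insert[of y x "unset_bit y s"]) (auto simp: bit_unset_bit_iff)
  then show ?thesis using True by simp
next
  case False
  then show ?thesis by (auto intro!: jw_sign_cong simp: bit_unset_bit_iff)
qed

lemma nat_less_two_power_iff_bit: "(s::nat) < 2 ^ n \<longleftrightarrow> (\<forall>j\<ge>n. \<not> bit s j)"
proof
  assume "s < 2 ^ n"
  then have "take_bit n s = s" by (simp add: take_bit_nat_eq_self_iff)
  then show "\<forall>j\<ge>n. \<not> bit s j" by (metis bit_take_bit_iff not_less)
next
  assume "\<forall>j\<ge>n. \<not> bit s j"
  then have "take_bit n s = s" by (intro bit_eqI) (auto simp: bit_take_bit_iff not_less[symmetric])
  then show "s < 2 ^ n" by (simp add: take_bit_nat_eq_self_iff)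
qed

lemma set_bit_less: "k < n \<Longrightarrow> (s::nat) < 2 ^ n \<Longrightarrow> set_bit k s < 2 ^ n"
  by (auto simp: nat_less_two_power_iff_bit bit_set_bit_iff)

lemma unset_bit_less: "(s::nat) < 2 ^ n \<Longrightarrow> unset_bit k s < 2 ^ n"
  by (auto simp: nat_less_two_power_iff_bit bit_unset_bit_iff)

lemma set_bit_unset_bit: "bit (s::nat) k \<Longrightarrow> set_bit k (unset_bit k s) = s"
  by (rule bit_eqI) (auto simp: bit_set_bit_iff bit_unset_bit_iff)

lemma unset_bit_set_bit: "\<not> bit (s::nat) k \<Longrightarrow> unset_bit k (set_bit k s) = s"
  by (rule bit_eqI) (auto simp: bit_set_bit_iff bit_unset_bit_iff)

lemma unset_bit_commute: "unset_bit x (unset_bit y (s::nat)) = unset_bit y (unset_bit x s)"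
  by (rule bit_eqI) (auto simp: bit_set_bit_iff bit_unset_bit_iff)

lemma set_bit_unset_bit_commute:
  "x \<noteq> y \<Longrightarrow> set_bit x (unset_bit y (s::nat)) = unset_bit y (set_bit x s)"
  by (rule bit_eqI) (auto simp: bit_set_bit_iff bit_unset_bit_iff)

lemma unset_bit_nat_eq: "bit (s::nat) k \<Longrightarrow> unset_bit k s = s - 2 ^ k"
  using set_bit_eq[of k "unset_bit k s"] by (simp add: set_bit_unset_bit bit_unset_bit_iff)

lemma occ_eq_bit: "occ s k = bit s k"
  by (simp add: occ_def bit_iff_odd)

text \<open>The operators \<open>annih\<close> with sites counted from 0 and the subtraction of a
  power of two replaced by \<open>unset_bit\<close>, so that bitwise extensionality applies.\<close>

definition low :: "nat \<Rightarrow> nat \<Rightarrow> cmat" where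
  "low n k t s = (if k < n \<and> s < 2 ^ n \<and> bit s k \<and> t = unset_bit k s then jw_sign k s else 0)"

definition raise :: "nat \<Rightarrow> nat \<Rightarrow> cmat" where
  "raise n k t s = (if k < n \<and> s < 2 ^ n \<and> \<not> bit s k \<and> t = set_bit k s then jw_sign k s else 0)"

lemma annih_eq_low: "k < n \<Longrightarrow> annih n (int k + 1) = low n k"
proof -
  assume "k < n"
  moreover have "nat (int k + 1) - 1 = k" by simp
  ultimately show ?thesis
    unfolding annih_def low_def by (auto simp: occ_eq_bit unset_bit_nat_eq jw_sign_def fun_eq_iff
        simp del: One_nat_def)
qed

lemma madj_low: "madj (low n k) = raise n k"
proof (intro ext)
  fix t s :: nat
  have "k < n \<and> t < 2 ^ n \<and> bit t k \<and> s = unset_bit k t \<longleftrightarrow>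
        k < n \<and> s < 2 ^ n \<and> \<not> bit s k \<and> t = set_bit k s"
    using set_bit_less[of k n s] unset_bit_less[of t n k]
    by (auto simp: set_bit_unset_bit unset_bit_set_bit bit_set_bit_iff bit_unset_bit_iff)
  then show "madj (low n k) t s = raise n k t s"
    unfolding madj_def low_def raise_def by (auto simp: jw_sign_set_bit)
qed

lemma mmul_low_right:
  "mmul (2^n) A (low n k) t s
     = (if k < n \<and> s < 2 ^ n \<and> bit s k then A t (unset_bit k s) * jw_sign k s else 0)"
proof (cases "k < n \<and> s < 2 ^ n \<and> bit s k")
  case True
  then have "mmul (2^n) A (low n k) t s
      = (\<Sum>u<2^n. if u = unset_bit k s then A t u * jw_sign k s else 0)"
    by (simp add: mmul_def low_def if_distrib[of "\<lambda>x. _ * x"] cong: if_cong)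
  then show ?thesis using True by (simp add: unset_bit_less)
qed (auto simp: mmul_def low_def)

lemma mmul_raise_right:
  "mmul (2^n) A (raise n k) t s
     = (if k < n \<and> s < 2 ^ n \<and> \<not> bit s k then A t (set_bit k s) * jw_sign k s else 0)"
proof (cases "k < n \<and> s < 2 ^ n \<and> \<not> bit s k")
  case True
  then have "mmul (2^n) A (raise n k) t s
      = (\<Sum>u<2^n. if u = set_bit k s then A t u * jw_sign k s else 0)"
    by (simp add: mmul_def raise_def if_distrib[of "\<lambda>x. _ * x"] cong: if_cong)
  then show ?thesis using True by (simp add: set_bit_less)
qed (auto simp: mmul_def raise_def)

text \<open>For distinct sites both orders reach the same basis state, and only the string of the
  larger site contains the smaller one, so the two signs are opposite. For equal sites the second
  lowering has nothing to remove.\<close>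

lemma low_low_anticommute:
  "mmul (2^n) (low n x) (low n y) t s + mmul (2^n) (low n y) (low n x) t s = 0"
proof -
  show ?thesis using unset_bit_commute[of x y s]
    unfolding mmul_low_right
    by (auto simp: low_def unset_bit_less bit_unset_bit_iff jw_sign_unset_bit)
qed

lemma madj_mmul: "madj (mmul N A B) = mmul N (madj B) (madj A)"
  by (simp add: madj_def mmul_def fun_eq_iff mult.commute)

lemma raise_raise_anticommute:
  "mmul (2^n) (raise n x) (raise n y) t s + mmul (2^n) (raise n y) (raise n x) t s = 0"
proof -
  have "mmul (2^n) (raise n x) (raise n y) t s + mmul (2^n) (raise n y) (raise n x) t s
      = cnj (mmul (2^n) (low n y) (low n x) s t + mmul (2^n) (low n x) (low n y) s t)"
    unfolding madj_low[symmetric] madj_mmul[symmetric] by (simp add: madj_def)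
  then show ?thesis by (simp only: low_low_anticommute complex_cnj_zero)
qed

lemma raise_low_anticommute:
  assumes "x < n" "y < n"
  shows "mmul (2^n) (raise n x) (low n y) t s + mmul (2^n) (low n y) (raise n x) t s
     = (if x = y then mid (2^n) t s else 0)"
proof (cases "x = y")
  case True
  then show ?thesis using True assms set_bit_unset_bit[of s x] unset_bit_set_bit[of s x]
    unfolding mmul_low_right mmul_raise_right
    by (auto simp: low_def raise_def mid_def unset_bit_less set_bit_less bit_unset_bit_iff
        bit_set_bit_iff jw_sign_unset_bit jw_sign_set_bit)
next
  case False
  then have "set_bit x (unset_bit y s) = unset_bit y (set_bit x s)"
    by (rule set_bit_unset_bit_commute)
  then show ?thesis using False assms
    unfolding mmul_low_right mmul_raise_right
    by (auto simp: low_def raise_def unset_bit_less set_bit_less bit_unset_bit_iff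
        bit_set_bit_iff jw_sign_unset_bit jw_sign_set_bit)
qed

lemma sum_block: "(\<Sum>x\<in>{1..int n}. h x) = (\<Sum>k<n. h (int k + 1))"
  by (rule sum.reindex_bij_witness[where i="\<lambda>k. int k + 1" and j="\<lambda>x. nat (x - 1)"]) auto

lemma fockB_eq:
  "fockB n f = (\<lambda>i j. \<Sum>k<n. f True (int k + 1) * raise n k i j + f False (int k + 1) * low n k i j)"
  unfolding fockB_def sum_block by (intro ext sum.cong) (auto simp: annih_eq_low madj_low)

text \<open>The bilinear form (J f, g) on the block, which is the scalar value of the anticommutator
  of B(f) and B(g). Inner products are recovered as \<open>car_form n (Jop f) g\<close>.\<close>

definition car_form :: "nat \<Rightarrow> testfun \<Rightarrow> testfun \<Rightarrow> complex" where
  "car_form n f g = (\<Sum>k<n. f True (int k + 1) * g False (int k + 1) + f False (int k + 1) * g True (int k + 1))"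

lemma fockB_anticommute:
  "mmul (2^n) (fockB n f) (fockB n g) i j + mmul (2^n) (fockB n g) (fockB n f) i j
     = car_form n f g * mid (2^n) i j"
proof -
  let ?r = "raise n" and ?l = "low n"
  let ?m = "\<lambda>A B. mmul (2^n) A B i j"
  let ?f = "\<lambda>a k. f a (int k + 1)" and ?g = "\<lambda>a k. g a (int k + 1)"
  have expand: "?m (fockB n f) (fockB n g) = (\<Sum>k<n. \<Sum>l<n.
      f True (int k + 1) * g True (int l + 1) * ?m (?r k) (?r l)
    + f True (int k + 1) * g False (int l + 1) * ?m (?r k) (?l l)
    + f False (int k + 1) * g True (int l + 1) * ?m (?l k) (?r l)
    + f False (int k + 1) * g False (int l + 1) * ?m (?l k) (?l l))" for f g :: testfun
    unfolding fockB_eq mmul_sum_left mmul_sum_right mmul_add_left mmul_add_right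
      mmul_scale_left mmul_scale_right
    by (simp add: sum_distrib_left sum.distrib[symmetric] algebra_simps)
  have "?m (fockB n f) (fockB n g) + ?m (fockB n g) (fockB n f) = (\<Sum>k<n. \<Sum>l<n.
      ?f True k * ?g True l * (?m (?r k) (?r l) + ?m (?r l) (?r k))
    + ?f True k * ?g False l * (?m (?r k) (?l l) + ?m (?l l) (?r k))
    + ?f False k * ?g True l * (?m (?r l) (?l k) + ?m (?l k) (?r l))
    + ?f False k * ?g False l * (?m (?l k) (?l l) + ?m (?l l) (?l k)))"
    unfolding expand by (subst (2) sum.swap) (simp add: sum.distrib[symmetric] algebra_simps)
  also have "\<dots> = (\<Sum>k<n. \<Sum>l<n. if k = l then (?f True k * ?g False l + ?f False k * ?g True l) * mid (2^n) i j else 0)"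
    by (intro sum.cong refl)
       (simp add: low_low_anticommute raise_raise_anticommute raise_low_anticommute distrib_right)
  also have "\<dots> = car_form n f g * mid (2^n) i j"
    by (simp add: car_form_def sum_distrib_right)
  finally show ?thesis .
qed

section \<open>Bogoliubov transformations\<close>

text \<open>Matrices are functions on all pairs of naturals. Vanishing outside the N by N block
  makes \<open>mid N\<close> a unit and lets matrix identities be equalities of functions.\<close>

definition supp_mat :: "nat \<Rightarrow> cmat \<Rightarrow> bool" where
  "supp_mat N A \<longleftrightarrow> (\<forall>i j. i \<ge> N \<or> j \<ge> N \<longrightarrow> A i j = 0)"

lemma mmul_mid_right: "supp_mat N A \<Longrightarrow> mmul N A (mid N) = A"
proof (intro ext)
  fix i j assume A: "supp_mat N A"
  have "mmul N A (mid N) i j = (\<Sum>k<N. if k = j then A i k else 0)"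
    unfolding mmul_def mid_def by (intro sum.cong) auto
  then show "mmul N A (mid N) i j = A i j" using A by (auto simp: supp_mat_def)
qed

lemma mmul_mid_left: "supp_mat N A \<Longrightarrow> mmul N (mid N) A = A"
proof (intro ext)
  fix i j assume A: "supp_mat N A"
  have "mmul N (mid N) A i j = (\<Sum>k<N. if k = i then A k j else 0)"
    unfolding mmul_def mid_def by (intro sum.cong) auto
  then show "mmul N (mid N) A i j = A i j" using A by (auto simp: supp_mat_def)
qed

lemma supp_mat_mmul: "supp_mat N A \<Longrightarrow> supp_mat N B \<Longrightarrow> supp_mat N (mmul N A B)"
  by (auto simp: supp_mat_def mmul_def)

lemma supp_mat_madj: "supp_mat N A \<Longrightarrow> supp_mat N (madj A)"
  by (auto simp: supp_mat_def madj_def)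

lemma supp_mat_mid: "supp_mat N (mid N)"
  by (auto simp: supp_mat_def mid_def)

lemma supp_mat_low: "supp_mat (2^n) (low n k)"
  unfolding supp_mat_def low_def by (auto dest: unset_bit_less simp: not_less[symmetric])

lemma supp_mat_raise: "supp_mat (2^n) (raise n k)"
  unfolding supp_mat_def raise_def by (auto dest: set_bit_less simp: not_less[symmetric])

lemma supp_mat_fockB: "supp_mat (2^n) (fockB n f)"
  using supp_mat_low[of n] supp_mat_raise[of n]
  by (auto simp: supp_mat_def fockB_eq intro!: sum.neutral)

lemma madj_madj [simp]: "madj (madj A) = A"
  by (simp add: madj_def fun_eq_iff)

lemma madj_fockB: "madj (fockB n f) = fockB n (Jop f)"
proof -
  have "madj (raise n k) = low n k" for k by (metis madj_low madj_madj)
  moreover have "madj (low n k) = raise n k" for k by (rule madj_low)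
  ultimately have "cnj (raise n k j i) = low n k i j" "cnj (low n k j i) = raise n k i j" for k i j
    unfolding madj_def by (metis (no_types))+
  then show ?thesis by (simp add: fockB_eq Jop_def madj_def fun_eq_iff add.commute)
qed

lemma lin_ap_mmul: "lin_ap {..<N} (mmul N A B) v = lin_ap {..<N} A (lin_ap {..<N} B v)"
  unfolding lin_ap_def mmul_def sum_distrib_left sum_distrib_right
  by (intro ext, subst sum.swap) (simp add: mult.assoc)

lemma lin_ap_add_mat: "lin_ap I (\<lambda>i j. A i j + B i j) v i = lin_ap I A v i + lin_ap I B v i"
  by (simp add: lin_ap_def distrib_right sum.distrib)

lemma lin_ap_scale: "lin_ap I A (\<lambda>i. c * v i) = (\<lambda>i. c * lin_ap I A v i)"
  by (simp add: lin_ap_def sum_distrib_left mult.left_commute fun_eq_iff)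

lemma lin_ap_zero [simp]: "lin_ap I A (\<lambda>_. 0) = (\<lambda>_. 0)"
  by (simp add: lin_ap_def fun_eq_iff)

lemma inn_madj: "inn {..<N} v (lin_ap {..<N} (madj A) w) = inn {..<N} (lin_ap {..<N} A v) w"
proof -
  have "inn {..<N} v (lin_ap {..<N} (madj A) w) = (\<Sum>j<N. \<Sum>i<N. cnj (v i) * (cnj (A j i) * w j))"
    unfolding inn_def lin_ap_def madj_def sum_distrib_left by (rule sum.swap)
  also have "\<dots> = inn {..<N} (lin_ap {..<N} A v) w"
    by (simp add: inn_def lin_ap_def sum_distrib_right sum_distrib_left mult_ac)
  finally show ?thesis .
qed

lemma lin_ap_supp: "supp_mat N A \<Longrightarrow> i \<ge> N \<Longrightarrow> lin_ap {..<N} A v i = 0"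
  by (simp add: lin_ap_def supp_mat_def)

lemma lin_ap_mid: "(\<And>i. i \<ge> N \<Longrightarrow> v i = 0) \<Longrightarrow> lin_ap {..<N} (mid N) v = v"
proof (intro ext)
  fix i assume v: "\<And>i. i \<ge> N \<Longrightarrow> v i = 0"
  have "lin_ap {..<N} (mid N) v i = (\<Sum>j<N. if j = i then v j else 0)"
    unfolding lin_ap_def mid_def by (intro sum.cong) auto
  then show "lin_ap {..<N} (mid N) v i = v i" using v[of i] by auto
qed

text \<open>n fermionic modes on a space of dimension 2^n, the smallest on which they can act. In
  this dimension the representation is unique up to a unitary, which is the aim of the
  locale.\<close>

locale car_family =
  fixes n :: nat and c :: "nat \<Rightarrow> cmat"
  assumes supp: "k < n \<Longrightarrow> supp_mat (2^n) (c k)"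
    and anti: "k < n \<Longrightarrow> l < n \<Longrightarrow>
      mmul (2^n) (c k) (c l) i j + mmul (2^n) (c l) (c k) i j = 0"
    and car: "k < n \<Longrightarrow> l < n \<Longrightarrow>
      mmul (2^n) (madj (c k)) (c l) i j + mmul (2^n) (c l) (madj (c k)) i j
        = (if k = l then mid (2^n) i j else 0)"
begin

abbreviation "ap A \<equiv> lin_ap {..<2^n} A"

lemma ap_anti: "k < n \<Longrightarrow> l < n \<Longrightarrow> ap (c k) (ap (c l) v) i = - ap (c l) (ap (c k) v) i"
proof -
  assume "k < n" "l < n"
  then have "ap (\<lambda>i j. mmul (2^n) (c k) (c l) i j + mmul (2^n) (c l) (c k) i j) v i = 0"
    by (simp add: anti lin_ap_def)
  then show ?thesis unfolding lin_ap_add_mat lin_ap_mmul by (simp add: add_eq_0_iff2)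
qed

text \<open>The anticommutator equals \<open>mid\<close>, which truncates; hence the support
  condition on \<open>v\<close>.\<close>

lemma ap_car:
  assumes "k < n" "l < n" "\<And>i. i \<ge> 2^n \<Longrightarrow> v i = 0"
  shows "ap (c l) (ap (madj (c k)) v) i = (if k = l then v i else 0) - ap (madj (c k)) (ap (c l) v) i"
proof -
  have "ap (\<lambda>i j. mmul (2^n) (madj (c k)) (c l) i j + mmul (2^n) (c l) (madj (c k)) i j) v i
      = (if k = l then ap (mid (2^n)) v i else 0)"
    using assms by (simp add: car lin_ap_def)
  then show ?thesis unfolding lin_ap_add_mat lin_ap_mmul using lin_ap_mid[of "2^n" v] assms(3)
    by (simp add: eq_diff_eq add.commute split: if_splits)
qed

text \<open>If a common null vector v of the first m operators is not annihilated by the next one, then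
  its image under the next one is a common null vector of all m + 1.\<close>

lemma vacuum_exists:
  "\<exists>v. inn {..<2^n} v v = 1 \<and> (\<forall>i\<ge>2^n. v i = 0) \<and> (\<forall>k<n. ap (c k) v = (\<lambda>_. 0))"
proof -
  have "\<exists>v. (\<exists>i<2^n. v i \<noteq> 0) \<and> (\<forall>i\<ge>2^n. v i = 0) \<and> (\<forall>k<m. ap (c k) v = (\<lambda>_. 0))"
    if "m \<le> n" for m
    using that
  proof (induction m)
    case 0
    show ?case by (rule exI[of _ "\<lambda>i. if i = 0 then 1 else 0"]) auto
  next
    case (Suc m)
    then obtain v where v: "\<exists>i<2^n. v i \<noteq> 0" "\<forall>i\<ge>2^n. v i = 0" "\<forall>k<m. ap (c k) v = (\<lambda>_. 0)"
      by auto
    have m: "m < n" using Suc by simp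
    show ?case
    proof (cases "ap (c m) v = (\<lambda>_. 0)")
      case True
      then show ?thesis using v by (intro exI[of _ v]) (auto simp: less_Suc_eq)
    next
      case False
      then obtain i where i: "ap (c m) v i \<noteq> 0" by auto
      then have "i < 2^n" using lin_ap_supp[OF supp[OF m]] not_less by blast
      moreover have "ap (c k) (ap (c m) v) = (\<lambda>_. 0)" if "k < Suc m" for k
      proof (cases "k = m")
        case True
        have "ap (c m) (ap (c m) v) i = 0" for i
          using ap_anti[OF m m, of v i] by (metis add.inverse_neutral eq_neg_iff_add_eq_0 mult_2 mult_eq_0_iff zero_neq_numeral)
        then show ?thesis using True by auto
      next
        case False
        then have "k < m" "k < n" using that m by auto
        then show ?thesis using ap_anti[OF \<open>k < n\<close> m, of v] v(3) by auto
      qed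
      ultimately show ?thesis using i lin_ap_supp[OF supp[OF m]]
        by (intro exI[of _ "ap (c m) v"]) auto
    qed
  qed
  then obtain v where v: "\<exists>i<2^n. v i \<noteq> 0" "\<forall>i\<ge>2^n. v i = 0" "\<forall>k<n. ap (c k) v = (\<lambda>_. 0)"
    by blast
  define t where "t = (\<Sum>i<2^n. (cmod (v i))^2)"
  have t: "t > 0" using v(1) inn_self_pos[of "{..<2^n}" _ v] unfolding t_def by auto
  have vv: "inn {..<2^n} v v = of_real t" by (simp add: inn_self t_def)
  obtain a where a: "cnj a * a * of_real t = 1" using complex_normaliser[OF t] by blast
  define w where "w = (\<lambda>i. a * v i)"
  have "inn {..<2^n} w w = cnj a * a * inn {..<2^n} v v"
    by (simp add: inn_def w_def sum_distrib_left mult_ac)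
  then have "inn {..<2^n} w w = 1" using vv a by simp
  moreover have "\<forall>i\<ge>2^n. w i = 0" using v(2) by (simp add: w_def)
  moreover have "\<forall>k<n. ap (c k) w = (\<lambda>_. 0)" using v(3) by (simp add: w_def lin_ap_scale)
  ultimately show ?thesis by blast
qed

end

definition low_bit :: "nat \<Rightarrow> nat" where
  "low_bit s = (LEAST j. bit s j)"

lemma low_bit: "s \<noteq> 0 \<Longrightarrow> bit s (low_bit s)" "j < low_bit s \<Longrightarrow> \<not> bit s j"
proof -
  assume "s \<noteq> 0"
  then obtain j where "bit s j" by (metis bit_0_eq bit_eqI bot_apply bot_bool_def)
  then show "bit s (low_bit s)" unfolding low_bit_def by (rule LeastI)
qed (auto simp: low_bit_def dest: not_less_Least)

lemma unset_bit_lt: "bit (s::nat) k \<Longrightarrow> unset_bit k s < s"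
proof -
  assume s: "bit s k"
  then have "s \<noteq> 0" by (metis bit_0_eq bot_apply bot_bool_def)
  then show ?thesis unfolding unset_bit_nat_eq[OF s] by (intro diff_less) auto
qed

lemma bit_imp_lt: "bit (s::nat) k \<Longrightarrow> s < 2 ^ n \<Longrightarrow> k < n"
  using nat_less_two_power_iff_bit[of s n] by (metis not_less)

lemma jw_sign_low_bit: "jw_sign (low_bit s) s = 1"
proof -
  have "{j. j < low_bit s \<and> bit s j} = {}" using low_bit(2) by blast
  then show ?thesis unfolding jw_sign_def by (simp only: card.empty power_0)
qed

text \<open>The state c_{j1}^* c_{j2}^* ... applied to the vacuum, for the set bits j1 < j2 < ... of
  \<open>s\<close>. Removing the lowest bit first causes no sign, since the string below it is
  empty.\<close>

function jw_vec :: "nat \<Rightarrow> (nat \<Rightarrow> cmat) \<Rightarrow> (nat \<Rightarrow> complex) \<Rightarrow> nat \<Rightarrow> (nat \<Rightarrow> complex)" where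
  "jw_vec N c \<Omega> s = (if s = 0 then \<Omega>
     else lin_ap {..<N} (madj (c (low_bit s))) (jw_vec N c \<Omega> (unset_bit (low_bit s) s)))"
  by auto
termination
  by (relation "Wellfounded.measure (\<lambda>(N, c, \<Omega>, s). s)") (auto intro: unset_bit_lt low_bit)

declare jw_vec.simps [simp del]

context car_family
begin

context
  fixes \<Omega> :: "nat \<Rightarrow> complex"
  assumes vac: "\<And>k. k < n \<Longrightarrow> ap (c k) \<Omega> = (\<lambda>_. 0)"
    and vac1: "inn {..<2^n} \<Omega> \<Omega> = 1"
    and vac_supp: "\<And>i. i \<ge> 2^n \<Longrightarrow> \<Omega> i = 0"
begin

abbreviation "V \<equiv> jw_vec (2^n) c \<Omega>"

lemma V_0: "V 0 = \<Omega>"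
  by (subst jw_vec.simps) simp

lemma V_step: "s \<noteq> 0 \<Longrightarrow> V s = ap (madj (c (low_bit s))) (V (unset_bit (low_bit s) s))"
  by (subst jw_vec.simps) simp

lemma V_supp: "s < 2^n \<Longrightarrow> i \<ge> 2^n \<Longrightarrow> V s i = 0"
proof (cases "s = 0")
  case False
  assume s: "s < 2^n" "i \<ge> 2^n"
  then have "low_bit s < n" using low_bit(1)[OF False] bit_imp_lt by blast
  then show ?thesis unfolding V_step[OF False] by (intro lin_ap_supp supp_mat_madj supp s)
qed (simp add: V_0 vac_supp)

text \<open>Anticommute \<open>c k\<close> past the leftmost creation operator, that of the lowest
  bit j. For k = j the anticommutator removes the particle. For an occupied k > j one sign appears,
  which is the contribution of j to the string of k.\<close>

lemma lower_V:
  "s < 2^n \<Longrightarrow> k < n \<Longrightarrow>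
   ap (c k) (V s) = (\<lambda>i. if bit s k then jw_sign k s * V (unset_bit k s) i else 0)"
proof (induction s arbitrary: k rule: less_induct)
  case (less s)
  show ?case
  proof (cases "s = 0")
    case True
    then show ?thesis using vac less by (simp add: V_0)
  next
    case False
    define j where "j = low_bit s"
    define s' where "s' = unset_bit j s"
    have bj: "bit s j" using low_bit(1)[OF False] by (simp add: j_def)
    have j: "j < n" using bj less bit_imp_lt by blast
    have s': "s' < s" "s' < 2^n" using unset_bit_lt[OF bj] less by (auto simp: s'_def)
    have bs': "bit s' k = (bit s k \<and> k \<noteq> j)" by (auto simp: s'_def bit_unset_bit_iff)
    have Vs: "V s = ap (madj (c j)) (V s')" using V_step[OF False] by (simp add: j_def s'_def)
    have IH: "ap (c k) (V s') = (\<lambda>i. if bit s' k then jw_sign k s' * V (unset_bit k s') i else 0)"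
      by (rule less.IH) (use s' less in auto)
    have step: "ap (c k) (V s) i = (if j = k then V s' i else 0) - ap (madj (c j)) (ap (c k) (V s')) i" for i
      unfolding Vs by (rule ap_car[OF j \<open>k < n\<close>]) (use V_supp s' in auto)
    show ?thesis
    proof (cases "k = j")
      case True
      then have z: "ap (c k) (V s') = (\<lambda>_. 0)" unfolding IH using bs' by simp
      have "jw_sign k s = 1" using True j_def jw_sign_low_bit by simp
      moreover have az: "ap (madj (c j)) (ap (c k) (V s')) = (\<lambda>_. 0)" by (simp only: z lin_ap_zero)
      have "ap (c k) (V s) i = V s' i" for i using step[of i] az True by simp
      then have "ap (c k) (V s) = V s'" by (rule ext)
      ultimately show ?thesis using True bj by (simp add: s'_def)
    next
      case kj: False
      show ?thesis
      proof (cases "bit s k")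
        case False
        then have z: "ap (c k) (V s') = (\<lambda>_. 0)" unfolding IH using bs' by simp
        have az: "ap (madj (c j)) (ap (c k) (V s')) = (\<lambda>_. 0)" by (simp only: z lin_ap_zero)
        have "ap (c k) (V s) i = 0" for i using step[of i] az kj by simp
        then show ?thesis using False by (auto simp: fun_eq_iff)
      next
        case True
        then have "j < k" using low_bit(2)[of k s] kj j_def by fastforce
        then have sg: "jw_sign k s' = - jw_sign k s" using bj by (simp add: s'_def jw_sign_unset_bit)
        have uk: "bit (unset_bit k s) j" using bj kj by (simp add: bit_unset_bit_iff)
        then have u0: "unset_bit k s \<noteq> 0" by (metis bit_0_eq bot_apply bot_bool_def)
        have lb: "low_bit (unset_bit k s) = j"
          unfolding low_bit_def
        proof (rule Least_equality)
          show "bit (unset_bit k s) j" by (rule uk)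
        next
          fix y assume "bit (unset_bit k s) y"
          then have "bit s y" by (simp add: bit_unset_bit_iff)
          then show "j \<le> y" using low_bit(2)[of y s] j_def not_less by blast
        qed
        have "V (unset_bit k s) = ap (madj (c j)) (V (unset_bit k s'))"
          using V_step[OF u0] by (simp add: lb s'_def unset_bit_commute)
        then have "ap (madj (c j)) (ap (c k) (V s')) = (\<lambda>i. - jw_sign k s * V (unset_bit k s) i)"
          unfolding IH using True kj bs' sg lin_ap_scale[of "{..<2^n}" "madj (c j)" "- jw_sign k s"]
          by simp
        then show ?thesis using step kj True by (auto simp: fun_eq_iff)
      qed
    qed
  qed
qed

text \<open>The leftmost creation operator of \<open>V s\<close> becomes an annihilation operator on
  the other side of the inner product, where \<open>lower_V\<close> evaluates it.\<close>

lemma V_orthonormal: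
  "s < 2^n \<Longrightarrow> t < 2^n \<Longrightarrow> inn {..<2^n} (V s) (V t) = (if s = t then 1 else 0)"
proof (induction s arbitrary: t rule: less_induct)
  case (less s)
  show ?case
  proof (cases "s = 0")
    case True
    show ?thesis
    proof (cases "t = 0")
      case False
      then have "low_bit t < n" using low_bit(1)[OF False] bit_imp_lt less by blast
      then have "inn {..<2^n} \<Omega> (V t) = 0"
        unfolding V_step[OF False] inn_madj using vac by (simp add: inn_def)
      then show ?thesis using True False by (simp add: V_0)
    qed (use True vac1 in \<open>simp add: V_0\<close>)
  next
    case False
    define j where "j = low_bit s"
    define s' where "s' = unset_bit j s"
    have bj: "bit s j" using low_bit(1)[OF False] by (simp add: j_def)
    have j: "j < n" using bj less bit_imp_lt by blast
    have s': "s' < s" "s' < 2^n" using unset_bit_lt[OF bj] less by (auto simp: s'_def)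
    have Vs: "V s = ap (madj (c j)) (V s')" using V_step[OF False] by (simp add: j_def s'_def)
    have "inn {..<2^n} (V s) (V t) = inn {..<2^n} (V s') (ap (c j) (V t))"
      unfolding Vs using inn_madj[of "2^n" "V s'" "madj (c j)" "V t"] by simp
    also have "\<dots> = (if bit t j then jw_sign j t * inn {..<2^n} (V s') (V (unset_bit j t)) else 0)"
      unfolding lower_V[OF less.prems(2) j] by (simp add: inn_def sum_distrib_left mult_ac)
    also have "\<dots> = (if bit t j then jw_sign j t * (if s' = unset_bit j t then 1 else 0) else 0)"
      using less.IH[OF s', of "unset_bit j t"] unset_bit_less[OF less.prems(2), of j] by simp
    also have "\<dots> = (if s = t then 1 else 0)"
    proof (cases "bit t j \<and> s' = unset_bit j t")
      case True
      then have "s = t" using bj unfolding s'_def by (metis set_bit_unset_bit)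
      then show ?thesis using True j_def jw_sign_low_bit by simp
    next
      case False
      then show ?thesis using bj s'_def by auto
    qed
    finally show ?thesis .
  qed
qed

end

text \<open>The columns of the unitary are the states \<open>jw_vec\<close>; the intertwining
  relation is then \<open>lower_V\<close> read column by column.\<close>

lemma jordan_wigner_unitary:
  "\<exists>U. supp_mat (2^n) U \<and> unitary_mat (2^n) U \<and> (\<forall>k<n. mmul (2^n) (c k) U = mmul (2^n) U (low n k))"
proof -
  obtain \<Omega> where \<Omega>: "inn {..<2^n} \<Omega> \<Omega> = 1" "\<forall>i\<ge>2^n. \<Omega> i = 0" "\<forall>k<n. ap (c k) \<Omega> = (\<lambda>_. 0)"
    using vacuum_exists by blast
  define U where "U i s = (if s < 2^n then jw_vec (2^n) c \<Omega> s i else 0)" for i s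
  have "supp_mat (2^n) U"
    unfolding supp_mat_def U_def using V_supp \<Omega> by auto
  moreover have "unitary_mat (2^n) U"
    unfolding unitary_mat_def
  proof (intro allI impI)
    fix s t :: nat assume st: "s < 2^n" "t < 2^n"
    have "mmul (2^n) (madj U) U s t = inn {..<2^n} (jw_vec (2^n) c \<Omega> s) (jw_vec (2^n) c \<Omega> t)"
      using st by (simp add: mmul_def madj_def inn_def U_def)
    also have "\<dots> = (if s = t then 1 else 0)" by (rule V_orthonormal) (use \<Omega> st in auto)
    finally show "mmul (2^n) (madj U) U s t = mid (2^n) s t" using st by (simp add: mid_def)
  qed
  moreover have "mmul (2^n) (c k) U = mmul (2^n) U (low n k)" if "k < n" for k
  proof (intro ext)
    fix i s
    show "mmul (2^n) (c k) U i s = mmul (2^n) U (low n k) i s"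
    proof (cases "s < 2^n")
      case True
      then have e: "mmul (2^n) (c k) U i s = ap (c k) (jw_vec (2^n) c \<Omega> s) i"
        by (simp add: mmul_def lin_ap_def U_def)
      have "ap (c k) (jw_vec (2^n) c \<Omega> s) = (\<lambda>i. if bit s k then jw_sign k s * jw_vec (2^n) c \<Omega> (unset_bit k s) i else 0)"
        by (rule lower_V) (use \<Omega> True that in auto)
      then show ?thesis unfolding e mmul_low_right using True that
        by (auto simp: U_def unset_bit_less)
    next
      case False
      then show ?thesis unfolding mmul_low_right by (simp add: mmul_def U_def)
    qed
  qed
  ultimately show ?thesis by blast
qed

end

lemma unitary_mat_right:
  assumes "unitary_mat N U" "i < N" "j < N"
  shows "(\<Sum>k<N. U i k * cnj (U j k)) = (if i = j then 1 else 0)"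
  by (rule orthonormal_family_complete[of "{..<N}" "{..<N}" "\<lambda>k i. U i k"])
     (use assms in \<open>auto simp: unitary_mat_def mmul_def madj_def mid_def\<close>)

lemma unitary_mmul_madj:
  assumes "unitary_mat N U" "supp_mat N U"
  shows "mmul N U (madj U) = mid N" "mmul N (madj U) U = mid N"
proof -
  show "mmul N U (madj U) = mid N"
  proof (intro ext)
    fix i j
    show "mmul N U (madj U) i j = mid N i j"
    proof (cases "i < N \<and> j < N")
      case True
      then show ?thesis using unitary_mat_right[OF assms(1), of i j] by (simp add: mmul_def madj_def mid_def)
    next
      case False
      then show ?thesis using supp_mat_mmul[OF assms(2) supp_mat_madj[OF assms(2)]]
        by (auto simp: supp_mat_def mid_def)
    qed
  qed
  show "mmul N (madj U) U = mid N"
  proof (intro ext)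
    fix i j
    show "mmul N (madj U) U i j = mid N i j"
    proof (cases "i < N \<and> j < N")
      case True
      then show ?thesis using assms(1) by (simp add: unitary_mat_def)
    next
      case False
      then show ?thesis using supp_mat_mmul[OF supp_mat_madj[OF assms(2)] assms(2)]
        by (auto simp: supp_mat_def mid_def)
    qed
  qed
qed

text \<open>Take the adjoint of A U = U B and multiply by U from both sides.\<close>

lemma intertwine_madj:
  assumes U: "unitary_mat N U" "supp_mat N U" and AB: "supp_mat N A" "supp_mat N B"
    and eq: "mmul N A U = mmul N U B"
  shows "mmul N (madj A) U = mmul N U (madj B)"
proof -
  have "mmul N (madj A) U = mmul N (mmul N U (madj U)) (mmul N (madj A) U)"
    using U AB by (simp add: unitary_mmul_madj mmul_mid_left supp_mat_mmul supp_mat_madj)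
  also have "\<dots> = mmul N U (mmul N (madj (mmul N A U)) U)"
    by (simp add: madj_mmul mmul_assoc)
  also have "\<dots> = mmul N U (mmul N (madj B) (mmul N (madj U) U))"
    unfolding eq by (simp add: madj_mmul mmul_assoc)
  also have "\<dots> = mmul N U (madj B)"
    using U AB by (simp add: unitary_mmul_madj mmul_mid_right supp_mat_madj)
  finally show ?thesis .
qed

definition block_index :: "nat \<Rightarrow> (bool \<times> int) set" where
  "block_index n = UNIV \<times> {1..int n}"

lemma sum_bool_times:
  "(\<Sum>p\<in>UNIV \<times> A. h p) = (\<Sum>k\<in>A. h (True, k)) + (\<Sum>k\<in>A. h (False, k))"
proof -
  have "(\<Sum>p\<in>UNIV \<times> A. h p) = (\<Sum>a\<in>UNIV. \<Sum>k\<in>A. h (a, k))"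
    by (simp add: sum.cartesian_product)
  then show ?thesis by (simp add: UNIV_bool add.commute)
qed

lemma inn_block_index:
  "inn (block_index n) (case_prod f) (case_prod g) = car_form n (Jop f) g"
  unfolding inn_def block_index_def sum_bool_times sum_block
  by (simp add: car_form_def Jop_def sum.distrib add.commute)

text \<open>Test functions u k orthonormal together with their conjugates define a new set of fermions;
  the Fock space unitary U implements the change of coordinates.\<close>

lemma bogoliubov_unitary:
  fixes u :: "nat \<Rightarrow> testfun"
  assumes on: "\<And>k l. k < n \<Longrightarrow> l < n \<Longrightarrow> car_form n (Jop (u k)) (u l) = (if k = l then 1 else 0)"
    and dual: "\<And>k l. k < n \<Longrightarrow> l < n \<Longrightarrow> car_form n (u k) (u l) = 0"
  defines "co \<equiv> \<lambda>f a x. car_form n (if a then u (nat (x - 1)) else Jop (u (nat (x - 1)))) f"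
  shows "\<exists>U. supp_mat (2^n) U \<and> unitary_mat (2^n) U \<and>
     (\<forall>f. mmul (2^n) (fockB n f) U = mmul (2^n) U (fockB n (co f)))"
proof -
  have JJ: "Jop (Jop f) = f" for f by (simp add: Jop_def fun_eq_iff)
  \<comment> \<open>The operators B(u_k) play the role of annihilation operators. That they
    anticommute among themselves is the isotropy (J u_k, u_l) = 0.\<close>
  interpret car_family n "\<lambda>k. fockB n (u k)"
    by unfold_locales (simp_all add: supp_mat_fockB fockB_anticommute dual madj_fockB on)
  obtain U where U: "supp_mat (2^n) U" "unitary_mat (2^n) U"
    and low: "\<And>k. k < n \<Longrightarrow> mmul (2^n) (fockB n (u k)) U = mmul (2^n) U (low n k)"
    using jordan_wigner_unitary by blast
  have raise: "mmul (2^n) (fockB n (Jop (u k))) U = mmul (2^n) U (raise n k)" if "k < n" for k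
    using intertwine_madj[OF U(2,1) supp_mat_fockB supp_mat_low low[OF that]]
    by (simp add: madj_fockB madj_low)
  define g :: "bool \<times> nat \<Rightarrow> testfun" where "g p = (if fst p then Jop (u (snd p)) else u (snd p))" for p
  have compl: "(\<Sum>p\<in>UNIV \<times> {..<n}. case_prod (g p) i * cnj (case_prod (g p) j)) = (if i = j then 1 else 0)"
    if "i \<in> block_index n" "j \<in> block_index n" for i j
  proof (rule orthonormal_family_complete[OF _ _ _ _ that])
    show "card ((UNIV::bool set) \<times> {..<n}) = card (block_index n)"
      by (simp add: block_index_def card_cartesian_product)
    have dual': "car_form n (Jop (u k)) (Jop (u l)) = 0" if "k < n" "l < n" for k l
    proof -
      have "car_form n (Jop (u k)) (Jop (u l)) = cnj (car_form n (u k) (u l))"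
        by (simp add: car_form_def Jop_def add.commute)
      then show ?thesis using dual that by simp
    qed
    have on': "car_form n (u k) (Jop (u l)) = (if k = l then 1 else 0)" if "k < n" "l < n" for k l
    proof -
      have "car_form n (u k) (Jop (u l)) = car_form n (Jop (u l)) (u k)"
        by (simp add: car_form_def mult.commute add.commute)
      then show ?thesis using on that by auto
    qed
    show "(\<Sum>i\<in>block_index n. cnj (case_prod (g p) i) * case_prod (g q) i) = (if p = q then 1 else 0)"
      if "p \<in> UNIV \<times> {..<n}" "q \<in> UNIV \<times> {..<n}" for p q
      unfolding inn_def[symmetric] inn_block_index using that
      by (cases p; cases q) (auto simp: g_def JJ on dual dual' on')
  qed (auto simp: block_index_def)
  \<comment> \<open>Expansion of f in the orthonormal basis J u_k, u_k. The coefficient of J u_k is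
    (J u_k, f), and B(J u_k) is the new creation operator, so this coefficient becomes the +
    component of \<open>co f\<close>.\<close>
  have expand: "f a x = (\<Sum>k<n. car_form n (u k) f * Jop (u k) a x + car_form n (Jop (u k)) f * u k a x)"
    if "x \<in> {1..int n}" for f a x
  proof -
    have ax: "(a, x) \<in> block_index n" using that by (simp add: block_index_def)
    have "f a x = (\<Sum>j\<in>block_index n. (if (a, x) = j then 1 else 0) * case_prod f j)"
      using ax by (simp add: block_index_def if_distrib[of "\<lambda>y. y * _"] cong: if_cong)
    also have "\<dots> = (\<Sum>j\<in>block_index n. \<Sum>p\<in>UNIV \<times> {..<n}.
        case_prod (g p) (a, x) * cnj (case_prod (g p) j) * case_prod f j)"
      using compl[OF ax] by (intro sum.cong refl) (simp add: sum_distrib_right[symmetric])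
    also have "\<dots> = (\<Sum>p\<in>UNIV \<times> {..<n}. g p a x * car_form n (Jop (g p)) f)"
      unfolding inn_block_index[symmetric] inn_def
      by (subst sum.swap) (simp add: sum_distrib_left mult.assoc)
    also have "\<dots> = (\<Sum>k<n. car_form n (u k) f * Jop (u k) a x + car_form n (Jop (u k)) f * u k a x)"
      unfolding sum_bool_times by (simp add: g_def JJ sum.distrib mult.commute)
    finally show ?thesis .
  qed
  have "mmul (2^n) (fockB n f) U = mmul (2^n) U (fockB n (co f))" for f
  proof -
    have "fockB n f = (\<lambda>i j. \<Sum>k<n. car_form n (u k) f * fockB n (Jop (u k)) i j
        + car_form n (Jop (u k)) f * fockB n (u k) i j)"
    proof (intro ext)
      fix i j
      have "fockB n f i j = (\<Sum>x\<in>{1..int n}. \<Sum>k<n.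
           (car_form n (u k) f * Jop (u k) True x + car_form n (Jop (u k)) f * u k True x) * madj (annih n x) i j
         + (car_form n (u k) f * Jop (u k) False x + car_form n (Jop (u k)) f * u k False x) * annih n x i j)"
        unfolding fockB_def
        by (intro sum.cong refl) (simp only: expand[of _ f] sum_distrib_right sum.distrib distrib_right)
      also have "\<dots> = (\<Sum>k<n. \<Sum>x\<in>{1..int n}.
           car_form n (u k) f * (Jop (u k) True x * madj (annih n x) i j + Jop (u k) False x * annih n x i j)
         + car_form n (Jop (u k)) f * (u k True x * madj (annih n x) i j + u k False x * annih n x i j))"
        by (subst sum.swap) (simp add: algebra_simps)
      finally show "fockB n f i j = (\<Sum>k<n. car_form n (u k) f * fockB n (Jop (u k)) i j
        + car_form n (Jop (u k)) f * fockB n (u k) i j)"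
        by (simp add: fockB_def sum.distrib sum_distrib_left distrib_left)
    qed
    then have "mmul (2^n) (fockB n f) U = (\<lambda>i j. \<Sum>k<n.
        car_form n (u k) f * mmul (2^n) U (raise n k) i j
        + car_form n (Jop (u k)) f * mmul (2^n) U (low n k) i j)"
      by (simp add: mmul_sum_left mmul_add_left mmul_scale_left raise low)
    then show ?thesis
      by (simp add: fockB_eq mmul_sum_right mmul_add_right mmul_scale_right co_def)
  qed
  then show ?thesis using U by blast
qed

section \<open>Pfaffian expansion of the sum over pairings\<close>

text \<open>In one-line notation: 0, j + 1, then the remaining numbers in increasing order. It
  brings the partner of 0 next to it.\<close>

fun insert_perm :: "nat \<Rightarrow> nat \<Rightarrow> nat" where
  "insert_perm j 0 = 0"
| "insert_perm j (Suc 0) = Suc j"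
| "insert_perm j (Suc (Suc k)) = (if k < j then Suc k else Suc (Suc k))"

lemma insert_perm_0: "insert_perm 0 = id"
  by (rule ext, rename_tac k, case_tac "(0::nat, k)" rule: insert_perm.cases) auto

text \<open>Raising the partner of 0 by one costs one adjacent transposition. Both the permutation
  property and the sign (-1)^j follow from this by induction.\<close>

lemma insert_perm_Suc: "insert_perm (Suc j) = Transposition.transpose (Suc j) (Suc (Suc j)) \<circ> insert_perm j"
proof (rule ext)
  fix k
  consider "k = 0" | "k = Suc 0" | i where "k = Suc (Suc i)" by (metis not0_implies_Suc)
  then show "insert_perm (Suc j) k = (Transposition.transpose (Suc j) (Suc (Suc j)) \<circ> insert_perm j) k"
    by cases (auto simp: Transposition.transpose_def)
qed

lemma insert_perm_permutes: "j < M \<Longrightarrow> insert_perm j permutes {..<Suc M}"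
proof (induction j)
  case (Suc j)
  then show ?case unfolding insert_perm_Suc
    by (intro permutes_compose permutes_swap_id) auto
qed (simp add: insert_perm_0 permutes_id)

lemma sign_insert_perm: "sign (insert_perm j) = (-1) ^ j"
proof (induction j)
  case (Suc j)
  have "permutation (insert_perm j)"
    using insert_perm_permutes[of j "Suc j"] permutation_permutes by blast
  then show ?case unfolding insert_perm_Suc using Suc
    by (subst sign_compose) (auto simp: permutation_swap_id sign_swap_id)
qed (simp add: insert_perm_0)

lemma insert_perm_less_iff:
  "insert_perm j (Suc (Suc k)) < insert_perm j (Suc (Suc l)) \<longleftrightarrow> k < l"
  by auto

text \<open>The permutation \<open>q\<close> moved to the positions from 2 on, with 0 and 1 fixed.
  As a relabelling it keeps the sign of \<open>q\<close>.\<close>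

definition shift_perm :: "nat \<Rightarrow> (nat \<Rightarrow> nat) \<Rightarrow> nat \<Rightarrow> nat" where
  "shift_perm M q = map_permutation {..<M} (\<lambda>k. k + 2) q"

lemma shift_image: "(\<lambda>k. k + 2) ` {..<M} = {2..<M + 2::nat}"
proof -
  have "(\<lambda>k. k + 2) ` {0..<M} = {0 + 2..<M + 2}" by (rule image_add_atLeastLessThan')
  then show ?thesis by (simp only: atLeast0LessThan add_0)
qed

lemma shift_perm_permutes: "q permutes {..<M} \<Longrightarrow> shift_perm M q permutes {2..<M + 2}"
  unfolding shift_perm_def
  by (rule map_permutation_permutes) (simp_all only: bij_betw_def shift_image, simp add: inj_on_def)

lemma shift_perm_simps:
  assumes "q permutes {..<M}"
  shows "shift_perm M q 0 = 0" "shift_perm M q (Suc 0) = Suc 0"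
    "shift_perm M q (Suc (Suc k)) = Suc (Suc (q k))"
proof -
  have o: "shift_perm M q x = x" if "x \<notin> {2..<M + 2}" for x
    using shift_perm_permutes[OF assms] that by (rule permutes_not_in)
  show "shift_perm M q 0 = 0" "shift_perm M q (Suc 0) = Suc 0" by (auto intro: o)
  show "shift_perm M q (Suc (Suc k)) = Suc (Suc (q k))"
  proof (cases "k < M")
    case True
    have inj: "inj_on (\<lambda>k. k + 2 :: nat) {..<M}" by (auto simp: inj_on_def)
    have "inv_into {..<M} (\<lambda>k. k + 2) (k + 2) = k"
      using inv_into_f_f[OF inj, of k] True by simp
    moreover have "k + 2 \<in> (\<lambda>k. k + 2) ` {..<M}" using True by auto
    ultimately have "shift_perm M q (k + 2) = q k + 2"
      unfolding shift_perm_def map_permutation_def restrict_id_def by simp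
    then show ?thesis by simp
  next
    case False
    then have "q k = k" using assms by (auto intro: permutes_not_in)
    then show ?thesis using False by (simp add: o)
  qed
qed

lemma sign_shift_perm: "q permutes {..<M} \<Longrightarrow> sign (shift_perm M q) = sign q"
  unfolding shift_perm_def by (rule sign_map_permutation) (auto simp: inj_on_def)

text \<open>The value 0 is taken somewhere. A second member of a pair is preceded by a smaller
  value, and the first members increase, so only position 0 remains.\<close>

lemma pairings_0: "p \<in> pairings (Suc m) \<Longrightarrow> p 0 = 0"
proof -
  assume "p \<in> pairings (Suc m)"
  then have p: "p permutes {..<2 * Suc m}" and lt: "\<And>i. i < Suc m \<Longrightarrow> p (2*i) < p (2*i+1)"
    and mono: "\<And>i. i + 1 < Suc m \<Longrightarrow> p (2*i) < p (2*i+2)" by (auto simp: pairings_def)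
  have ge: "p 0 \<le> p (2 * i)" if "i < Suc m" for i
    using that
  proof (induction i)
    case (Suc i)
    then show ?case using mono[of i] by fastforce
  qed simp
  obtain x where x: "x < 2 * Suc m" "p x = 0"
    using permutes_image[OF p] by (metis (no_types, lifting) imageE lessThan_iff zero_less_Suc
        mult_pos_pos zero_less_numeral)
  show ?thesis
  proof (cases "even x")
    case True
    then obtain i where "x = 2 * i" by blast
    then show ?thesis using ge[of i] x by simp
  next
    case False
    then obtain i where "x = 2 * i + 1" by (elim oddE)
    then show ?thesis using lt[of i] x by simp
  qed
qed

text \<open>The bijection behind the row expansion: a pairing of 2 m + 2 points amounts to the
  partner j + 1 of 0 together with a pairing \<open>q\<close> of the remaining points, relabelled in
  order. \<open>pairing_del\<close> is its inverse.\<close>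

definition pairing_ins :: "nat \<Rightarrow> nat \<times> (nat \<Rightarrow> nat) \<Rightarrow> nat \<Rightarrow> nat" where
  "pairing_ins m = (\<lambda>(j, q). insert_perm j \<circ> shift_perm (2 * m) q)"

definition pairing_del :: "(nat \<Rightarrow> nat) \<Rightarrow> nat \<times> (nat \<Rightarrow> nat)" where
  "pairing_del p = (p 1 - 1, \<lambda>k. inv (insert_perm (p 1 - 1)) (p (k + 2)) - 2)"

lemma pairing_ins_simps:
  assumes "q permutes {..<2 * m}"
  shows "pairing_ins m (j, q) 0 = 0" "pairing_ins m (j, q) (Suc 0) = Suc j"
    "pairing_ins m (j, q) (Suc (Suc k)) = insert_perm j (Suc (Suc (q k)))"
  by (simp_all add: pairing_ins_def shift_perm_simps[OF assms])

lemma pairing_ins_in: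
  assumes j: "j < 2 * m + 1" and q: "q \<in> pairings m"
  shows "pairing_ins m (j, q) \<in> pairings (Suc m)"
proof -
  have qp: "q permutes {..<2 * m}" and lt: "\<And>i. i < m \<Longrightarrow> q (2*i) < q (2*i+1)"
    and mono: "\<And>i. i + 1 < m \<Longrightarrow> q (2*i) < q (2*i+2)" using q by (auto simp: pairings_def)
  have "shift_perm (2 * m) q permutes {..<Suc (2 * m + 1)}"
    by (rule permutes_subset[OF shift_perm_permutes[OF qp]]) auto
  then have "pairing_ins m (j, q) permutes {..<2 * Suc m}"
    unfolding pairing_ins_def using permutes_compose insert_perm_permutes[OF j] by fastforce
  moreover have "pairing_ins m (j, q) (2*i) < pairing_ins m (j, q) (2*i+1)" if "i < Suc m" for i
  proof (cases i)
    case 0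
    then show ?thesis by (simp add: pairing_ins_simps[OF qp])
  next
    case (Suc l)
    then have "q (2*l) < q (2*l+1)" using that lt by auto
    then show ?thesis using Suc by (simp add: pairing_ins_simps[OF qp] del: insert_perm.simps)
        (simp only: insert_perm_less_iff)
  qed
  moreover have "pairing_ins m (j, q) (2*i) < pairing_ins m (j, q) (2*i+2)" if "i + 1 < Suc m" for i
  proof (cases i)
    case 0
    then show ?thesis by (simp add: pairing_ins_simps[OF qp])
  next
    case (Suc l)
    then have "q (2*l) < q (2*l+2)" using that mono by auto
    then show ?thesis using Suc by (simp add: pairing_ins_simps[OF qp] del: insert_perm.simps)
        (simp only: insert_perm_less_iff)
  qed
  ultimately show ?thesis by (auto simp: pairings_def)
qed

lemma pairing_del_ins:
  assumes q: "q permutes {..<2 * m}" and j: "j < 2 * m + 1"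
  shows "pairing_del (pairing_ins m (j, q)) = (j, q)"
proof -
  have "inv (insert_perm j) (insert_perm j x) = x" for x
    using insert_perm_permutes[OF j] by (simp add: permutes_inverses(2))
  then show ?thesis using pairing_ins_simps[OF q, of j]
    by (simp add: pairing_del_def del: insert_perm.simps)
qed

lemma pairing_ins_del:
  assumes p: "p \<in> pairings (Suc m)"
  shows "fst (pairing_del p) < 2 * m + 1" "snd (pairing_del p) \<in> pairings m"
    "pairing_ins m (pairing_del p) = p"
proof -
  have pp: "p permutes {..<2 * Suc m}" and lt: "\<And>i. i < Suc m \<Longrightarrow> p (2*i) < p (2*i+1)"
    and mono: "\<And>i. i + 1 < Suc m \<Longrightarrow> p (2*i) < p (2*i+2)" using p by (auto simp: pairings_def)
  have p0: "p 0 = 0" using pairings_0[OF p] .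
  define j where "j = p 1 - 1"
  have p1: "p 1 = Suc j" using lt[of 0] p0 by (simp add: j_def)
  have "p 1 < 2 * Suc m" using permutes_in_image[OF pp, of 1] by simp
  then have j: "j < 2 * m + 1" using p1 by simp
  show "fst (pairing_del p) < 2 * m + 1" using j by (simp add: pairing_del_def j_def)
  define c where "c = insert_perm j"
  have cp: "c permutes {..<2 * Suc m}" using insert_perm_permutes[OF j] by (simp add: c_def)
  define r where "r = inv c \<circ> p"
  have rp: "r permutes {..<2 * Suc m}" unfolding r_def by (rule permutes_compose[OF pp permutes_inv[OF cp]])
  have cr: "c (r x) = p x" for x using cp by (simp add: r_def permutes_inverses)
  have r0: "r 0 = 0" unfolding r_def o_def p0 using permutes_inverses(2)[OF cp, of 0] by (simp add: c_def)
  have r1: "r 1 = 1" unfolding r_def o_def p1 using permutes_inverses(2)[OF cp, of 1] by (simp add: c_def)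
  have "r permutes {2..<2 * m + 2}"
  proof (rule permutes_superset[OF rp])
    fix x assume "x \<in> {..<2 * Suc m} - {2..<2 * m + 2}"
    then have "x = 0 \<or> x = 1" by auto
    then show "r x = x" using r0 r1 by auto
  qed
  then have r2: "r (k + 2) \<ge> 2" for k
    by (cases "k + 2 < 2 * m + 2") (auto dest: permutes_in_image[of r _ "k + 2"] permutes_not_in[of r _ "k + 2"])
  \<comment> \<open>Since \<open>r\<close> permutes the numbers from 2 on, \<open>r (k + 2)\<close>
    is at least 2 and the truncated subtraction loses nothing.\<close>
  define q where "q k = r (k + 2) - 2" for k
  have rq: "r (k + 2) = q k + 2" for k using r2[of k] by (simp add: q_def)
  have del: "pairing_del p = (j, q)" by (simp add: pairing_del_def j_def q_def r_def c_def fun_eq_iff)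
  have qp: "q permutes {..<2 * m}"
  proof (rule bij_imp_permutes)
    have inj: "inj_on q {..<2 * m}"
    proof (rule inj_onI)
      fix x y assume "q x = q y"
      then have "r (x + 2) = r (y + 2)" by (simp only: rq)
      then show "x = y" using permutes_inj[OF rp] by (metis add_right_cancel injD)
    qed
    have "q x < 2 * m" if "x < 2 * m" for x
    proof -
      have "r (x + 2) < 2 * Suc m" using permutes_in_image[OF rp, of "x + 2"] that by simp
      then show ?thesis unfolding rq by simp
    qed
    then have "q ` {..<2 * m} \<subseteq> {..<2 * m}" by auto
    then show "bij_betw q {..<2 * m} {..<2 * m}"
      using inj by (simp add: bij_betw_def endo_inj_surj)
    fix x assume "x \<notin> {..<2 * m}"
    then have "r (x + 2) = x + 2" using rp by (auto intro: permutes_not_in)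
    then show "q x = x" by (simp add: q_def)
  qed
  have cq: "insert_perm j (Suc (Suc (q k))) = p (k + 2)" for k
    using cr[of "k + 2"] unfolding rq c_def by (simp del: insert_perm.simps)
  show "snd (pairing_del p) \<in> pairings m"
    unfolding del snd_conv pairings_def
  proof (intro CollectI conjI allI impI qp)
    fix i assume "i < m"
    then have "p (2 * Suc i) < p (2 * Suc i + 1)" using lt[of "Suc i"] by simp
    moreover have "2 * Suc i = 2 * i + 2" "2 * Suc i + 1 = (2 * i + 1) + 2" by simp_all
    ultimately show "q (2 * i) < q (2 * i + 1)"
      by (metis cq insert_perm_less_iff)
  next
    fix i assume "i + 1 < m"
    then have "p (2 * Suc i) < p (2 * Suc i + 2)" using mono[of "Suc i"] by simp
    moreover have "2 * Suc i = 2 * i + 2" "2 * Suc i + 2 = (2 * i + 2) + 2" by simp_all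
    ultimately show "q (2 * i) < q (2 * i + 2)"
      by (metis cq insert_perm_less_iff)
  qed
  show "pairing_ins m (pairing_del p) = p"
  proof (rule ext)
    fix k
    consider "k = 0" | "k = Suc 0" | i where "k = Suc (Suc i)" by (metis not0_implies_Suc)
    then show "pairing_ins m (pairing_del p) k = p k"
      unfolding del using p0 p1 cq
      by cases (simp_all add: pairing_ins_simps[OF qp] del: insert_perm.simps)
  qed
qed

text \<open>With the form \<open>w\<close> as a parameter, one recursion serves both the two-point
  function of the steady state and that of the diagonal state.\<close>

definition pfaffian :: "('a \<Rightarrow> 'a \<Rightarrow> complex) \<Rightarrow> 'a list \<Rightarrow> complex" where
  "pfaffian w fs = (if odd (length fs) then 0 else
     \<Sum>p\<in>pairings (length fs div 2). of_int (sign p) *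
       (\<Prod>i<length fs div 2. w (fs ! p (2*i)) (fs ! p (2*i+1))))"

lemma pfaffian_Nil: "pfaffian w [] = 1"
proof -
  have "pairings 0 = {id}" by (auto simp: pairings_def)
  then show ?thesis by (simp add: pfaffian_def)
qed

definition drop_nth :: "nat \<Rightarrow> 'a list \<Rightarrow> 'a list" where
  "drop_nth j xs = take j xs @ drop (Suc j) xs"

lemma length_drop_nth: "j < length xs \<Longrightarrow> length (drop_nth j xs) = length xs - 1"
  by (simp add: drop_nth_def)

lemma nth_drop_nth:
  "j < length xs \<Longrightarrow> k < length xs - 1 \<Longrightarrow> drop_nth j xs ! k = (x # xs) ! insert_perm j (Suc (Suc k))"
  by (auto simp: drop_nth_def nth_append min_def)

text \<open>Expansion along the first row: the pairings are grouped by the partner of the first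
  element, and (-1)^j is the sign of the permutation that moves this partner forward.\<close>

lemma pfaffian_Cons:
  assumes "odd (length fs)"
  shows "pfaffian w (f # fs) = (\<Sum>j<length fs. (-1) ^ j * w f (fs ! j) * pfaffian w (drop_nth j fs))"
proof -
  obtain m where m: "length fs = 2 * m + 1" using assms by (elim oddE)
  let ?F = "f # fs"
  let ?h = "\<lambda>p. of_int (sign p) * (\<Prod>i<Suc m. w (?F ! p (2*i)) (?F ! p (2*i+1)))"
  have "pfaffian w (f # fs) = (\<Sum>p\<in>pairings (Suc m). ?h p)"
    using m by (simp add: pfaffian_def del: prod.lessThan_Suc)
  also have "\<dots> = (\<Sum>x\<in>{..<2 * m + 1} \<times> pairings m. ?h (pairing_ins m x))"
  proof (rule sum.reindex_bij_witness[where i="pairing_ins m" and j=pairing_del])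
    fix p assume p: "p \<in> pairings (Suc m)"
    then show "pairing_del p \<in> {..<2 * m + 1} \<times> pairings m"
      using pairing_ins_del[OF p] by (cases "pairing_del p") auto
  qed (auto simp: pairing_ins_del pairing_del_ins pairing_ins_in pairings_def[of m] intro: pairing_ins_in)
  also have "\<dots> = (\<Sum>j<2 * m + 1. \<Sum>q\<in>pairings m. ?h (pairing_ins m (j, q)))"
    by (simp add: sum.cartesian_product)
  also have "\<dots> = (\<Sum>j<2 * m + 1. (-1) ^ j * w f (fs ! j) * pfaffian w (drop_nth j fs))"
  proof (rule sum.cong[OF refl])
    fix j assume "j \<in> {..<2 * m + 1}"
    then have j: "j < 2 * m + 1" by simp
    have len: "length (drop_nth j fs) = 2 * m" using j m by (simp add: length_drop_nth)
    have "?h (pairing_ins m (j, q)) = (-1) ^ j * w f (fs ! j) * (of_int (sign q) *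
        (\<Prod>i<m. w (drop_nth j fs ! q (2*i)) (drop_nth j fs ! q (2*i+1))))"
      if q: "q \<in> pairings m" for q
    proof -
      have qp: "q permutes {..<2 * m}" using q by (simp add: pairings_def)
      have "permutation (insert_perm j)" "permutation (shift_perm (2*m) q)"
        using insert_perm_permutes[OF j] shift_perm_permutes[OF qp]
        by (auto simp: permutation_permutes)
      then have "sign (pairing_ins m (j, q)) = (-1) ^ j * sign q"
        by (simp add: pairing_ins_def sign_compose sign_insert_perm sign_shift_perm[OF qp])
      moreover have "(\<Prod>i<Suc m. w (?F ! pairing_ins m (j, q) (2*i)) (?F ! pairing_ins m (j, q) (2*i+1)))
          = w f (fs ! j) * (\<Prod>i<m. w (drop_nth j fs ! q (2*i)) (drop_nth j fs ! q (2*i+1)))"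
      proof -
        have nth: "?F ! insert_perm j (Suc (Suc (q k))) = drop_nth j fs ! q k" if "k < 2 * m" for k
        proof -
          have "q k < 2 * m" using permutes_in_image[OF qp, of k] that by simp
          then show ?thesis using nth_drop_nth[of j fs "q k" f] j m by simp
        qed
        show ?thesis
          unfolding prod.lessThan_Suc_shift using pairing_ins_simps[OF qp, of j]
          by (simp add: nth del: insert_perm.simps)
      qed
      ultimately show ?thesis by simp
    qed
    then show "(\<Sum>q\<in>pairings m. ?h (pairing_ins m (j, q))) = (-1) ^ j * w f (fs ! j) * pfaffian w (drop_nth j fs)"
      using len by (simp add: pfaffian_def sum_distrib_left)
  qed
  finally show ?thesis using m by simp
qed

section \<open>Wick theorem for product states\<close>

text \<open>The probability of the occupation pattern \<open>s\<close> when the sites are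
  independent and site k is occupied with probability \<open>\<nu> k\<close>.\<close>

definition occ_weight :: "nat \<Rightarrow> (nat \<Rightarrow> real) \<Rightarrow> nat \<Rightarrow> real" where
  "occ_weight n \<nu> s = (\<Prod>k<n. if bit s k then \<nu> k else 1 - \<nu> k)"

lemma set_bit_top: "(s::nat) < 2 ^ n \<Longrightarrow> set_bit n s = s + 2 ^ n"
  using nat_less_two_power_iff_bit by (simp add: set_bit_eq)

lemma sum_two_power_Suc: "(\<Sum>s<2 ^ Suc n. h s) = (\<Sum>s<2 ^ n. h s + h (set_bit n (s::nat)))"
proof -
  have "(\<Sum>s<2 ^ Suc n. h s) = (\<Sum>s<2 ^ n. h s) + (\<Sum>s=2^n..<2^n + 2 ^ n. h s)"
    by (simp add: mult_2 atLeast0LessThan[symmetric] sum.atLeastLessThan_concat)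
  also have "(\<Sum>s=2^n..<2^n + 2 ^ n. h s) = (\<Sum>s<2 ^ n. h (s + 2 ^ n))"
    using sum.shift_bounds_nat_ivl[of h 0 "2^n" "2^n"] by (simp add: atLeast0LessThan)
  also have "\<dots> = (\<Sum>s<2 ^ n. h (set_bit n s))"
    by (intro sum.cong refl) (simp add: set_bit_top)
  finally show ?thesis by (simp add: sum.distrib)
qed

lemma occ_weight_Suc:
  "s < 2 ^ n \<Longrightarrow> occ_weight (Suc n) \<nu> s = occ_weight n \<nu> s * (1 - \<nu> n)"
  "s < 2 ^ n \<Longrightarrow> occ_weight (Suc n) \<nu> (set_bit n s) = occ_weight n \<nu> s * \<nu> n"
proof -
  assume s: "s < 2 ^ n"
  then have "\<not> bit s n" using nat_less_two_power_iff_bit by blast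
  then show "occ_weight (Suc n) \<nu> s = occ_weight n \<nu> s * (1 - \<nu> n)" by (simp add: occ_weight_def)
  have "(\<Prod>k<n. if bit (set_bit n s) k then \<nu> k else 1 - \<nu> k) = occ_weight n \<nu> s"
    unfolding occ_weight_def by (intro prod.cong refl) (auto simp: bit_set_bit_iff)
  moreover have "bit (set_bit n s) n" by (simp add: bit_set_bit_iff)
  ultimately show "occ_weight (Suc n) \<nu> (set_bit n s) = occ_weight n \<nu> s * \<nu> n"
    by (simp add: occ_weight_def)
qed

lemma occ_weight_sum: "(\<Sum>s<2 ^ n. occ_weight n \<nu> s) = 1"
proof (induction n)
  case 0
  show ?case by (simp add: occ_weight_def)
next
  case (Suc n)
  have "(\<Sum>s<2 ^ Suc n. occ_weight (Suc n) \<nu> s)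
      = (\<Sum>s<2 ^ n. occ_weight n \<nu> s * (1 - \<nu> n) + occ_weight n \<nu> s * \<nu> n)"
    unfolding sum_two_power_Suc by (intro sum.cong refl) (simp add: occ_weight_Suc)
  also have "\<dots> = (\<Sum>s<2 ^ n. occ_weight n \<nu> s)" by (simp add: algebra_simps)
  finally show ?case using Suc by simp
qed

lemma occ_weight_pos:
  "(\<And>k. k < n \<Longrightarrow> 0 < \<nu> k \<and> \<nu> k < 1) \<Longrightarrow> occ_weight n \<nu> s > 0"
  unfolding occ_weight_def by (intro prod_pos) auto

text \<open>Entropy is additive over independent sites: the logarithm of a weight splits off the
  last site, and the weights of the other sites sum to 1.\<close>

lemma occ_weight_entropy:
  assumes "\<And>k. k < n \<Longrightarrow> 0 < \<nu> k \<and> \<nu> k < 1"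
  shows "(\<Sum>s<2 ^ n. - occ_weight n \<nu> s * ln (occ_weight n \<nu> s)) = (\<Sum>k<n. hent (2 * \<nu> k - 1))"
  using assms
proof (induction n)
  case 0
  show ?case by (simp add: occ_weight_def)
next
  case (Suc n)
  let ?x = "\<nu> n"
  have x: "0 < ?x" "?x < 1" using Suc.prems[of n] by auto
  have "(\<Sum>s<2 ^ Suc n. - occ_weight (Suc n) \<nu> s * ln (occ_weight (Suc n) \<nu> s))
     = (\<Sum>s<2 ^ n. - occ_weight n \<nu> s * ln (occ_weight n \<nu> s)
        + occ_weight n \<nu> s * hent (2 * ?x - 1))"
    unfolding sum_two_power_Suc
  proof (intro sum.cong refl)
    fix s :: nat assume "s \<in> {..<2 ^ n}"
    then have s: "s < 2 ^ n" by simp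
    have w: "occ_weight n \<nu> s > 0" by (rule occ_weight_pos) (use Suc.prems in auto)
    have h: "hent (2 * ?x - 1) = - ?x * ln ?x - (1 - ?x) * ln (1 - ?x)"
    proof -
      have e: "(1 + (2 * ?x - 1)) / 2 = ?x" "(1 - (2 * ?x - 1)) / 2 = 1 - ?x" by (auto simp: field_simps)
      show ?thesis unfolding hent_def e ..
    qed
    show "- occ_weight (Suc n) \<nu> s * ln (occ_weight (Suc n) \<nu> s)
        + - occ_weight (Suc n) \<nu> (set_bit n s) * ln (occ_weight (Suc n) \<nu> (set_bit n s))
       = - occ_weight n \<nu> s * ln (occ_weight n \<nu> s) + occ_weight n \<nu> s * hent (2 * ?x - 1)"
    proof -
      have "ln (occ_weight n \<nu> s * (1 - ?x)) = ln (occ_weight n \<nu> s) + ln (1 - ?x)"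
        "ln (occ_weight n \<nu> s * ?x) = ln (occ_weight n \<nu> s) + ln ?x"
        using x w by (simp_all add: ln_mult)
      then show ?thesis unfolding occ_weight_Suc[OF s] h by (simp only:) (simp add: algebra_simps)
    qed
  qed
  also have "\<dots> = (\<Sum>s<2 ^ n. - occ_weight n \<nu> s * ln (occ_weight n \<nu> s)) + hent (2 * ?x - 1)"
    by (simp only: sum.distrib sum_distrib_right[symmetric] occ_weight_sum mult_1)
  finally show ?case using Suc by simp
qed

definition diag_state :: "nat \<Rightarrow> (nat \<Rightarrow> real) \<Rightarrow> cmat" where
  "diag_state n \<nu> i j = (if i = j \<and> i < 2 ^ n then of_real (occ_weight n \<nu> i) else 0)"

lemma mmul_diag_state_left:
  "mmul (2^n) (diag_state n \<nu>) A i j = (if i < 2^n then of_real (occ_weight n \<nu> i) * A i j else 0)"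
proof -
  have "mmul (2^n) (diag_state n \<nu>) A i j
      = (\<Sum>k<2^n. if k = i then of_real (occ_weight n \<nu> i) * A i j else 0)"
    unfolding mmul_def diag_state_def by (intro sum.cong) auto
  then show ?thesis by simp
qed

lemma mmul_diag_state_right:
  "mmul (2^n) A (diag_state n \<nu>) i j = (if j < 2^n then A i j * of_real (occ_weight n \<nu> j) else 0)"
proof -
  have "mmul (2^n) A (diag_state n \<nu>) i j
      = (\<Sum>k<2^n. if k = j then A i j * of_real (occ_weight n \<nu> j) else 0)"
    unfolding mmul_def diag_state_def by (intro sum.cong) auto
  then show ?thesis by simp
qed

lemma occ_weight_unset:
  assumes "k < n" "bit s k"
  shows "occ_weight n \<nu> (unset_bit k s) * \<nu> k = occ_weight n \<nu> s * (1 - \<nu> k)"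
proof -
  have "(\<Prod>l\<in>{..<n} - {k}. if bit (unset_bit k s) l then \<nu> l else 1 - \<nu> l)
      = (\<Prod>l\<in>{..<n} - {k}. if bit s l then \<nu> l else 1 - \<nu> l)"
    by (intro prod.cong) (auto simp: bit_unset_bit_iff)
  then show ?thesis
    unfolding occ_weight_def using assms
    by (subst (1 2) prod.remove[of "{..<n}" k]) (auto simp: bit_unset_bit_iff)
qed

text \<open>A pattern with a particle at k and the same pattern without it have weights in the ratio
  \<open>\<nu> k\<close> to \<open>1 - \<nu> k\<close>. This is the KMS condition of a single
  mode.\<close>

lemma diag_state_low:
  assumes "k < n"
  shows "of_real (\<nu> k) * mmul (2^n) (diag_state n \<nu>) (low n k) i j
     = of_real (1 - \<nu> k) * mmul (2^n) (low n k) (diag_state n \<nu>) i j"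
proof (cases "j < 2^n \<and> bit j k \<and> i = unset_bit k j")
  case True
  then show ?thesis unfolding mmul_diag_state_left mmul_diag_state_right
    using arg_cong[OF occ_weight_unset[OF assms, of j \<nu>], of complex_of_real] assms
    by (simp add: low_def unset_bit_less mult_ac)
next
  case False
  then show ?thesis unfolding mmul_diag_state_left mmul_diag_state_right by (auto simp: low_def)
qed

lemma diag_state_raise:
  assumes "k < n"
  shows "of_real (1 - \<nu> k) * mmul (2^n) (diag_state n \<nu>) (raise n k) i j
     = of_real (\<nu> k) * mmul (2^n) (raise n k) (diag_state n \<nu>) i j"
proof -
  have D: "madj (diag_state n \<nu>) = diag_state n \<nu>" by (auto simp: madj_def diag_state_def fun_eq_iff)
  have "mmul (2^n) (diag_state n \<nu>) (raise n k) i j = cnj (mmul (2^n) (low n k) (diag_state n \<nu>) j i)"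
    by (metis D madj_low madj_def madj_mmul)
  moreover have "mmul (2^n) (raise n k) (diag_state n \<nu>) i j = cnj (mmul (2^n) (diag_state n \<nu>) (low n k) j i)"
    by (metis D madj_low madj_def madj_mmul)
  ultimately show ?thesis
    using arg_cong[OF diag_state_low[OF assms, of \<nu> j i], of cnj] by simp
qed

definition diag_ev :: "nat \<Rightarrow> (nat \<Rightarrow> real) \<Rightarrow> cmat \<Rightarrow> complex" where
  "diag_ev n \<nu> A = mtrace (2^n) (mmul (2^n) (diag_state n \<nu>) A)"

lemma diag_ev_eq: "diag_ev n \<nu> A = (\<Sum>s<2^n. of_real (occ_weight n \<nu> s) * A s s)"
  by (simp add: diag_ev_def mtrace_def mmul_diag_state_left)

lemma diag_ev_add: "diag_ev n \<nu> (\<lambda>i j. A i j + B i j) = diag_ev n \<nu> A + diag_ev n \<nu> B"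
  by (simp add: diag_ev_eq distrib_left sum.distrib)

lemma diag_ev_scale: "diag_ev n \<nu> (\<lambda>i j. c * A i j) = c * diag_ev n \<nu> A"
  by (simp add: diag_ev_eq sum_distrib_left mult.left_commute)

lemma diag_ev_sum: "diag_ev n \<nu> (\<lambda>i j. \<Sum>x\<in>X. A x i j) = (\<Sum>x\<in>X. diag_ev n \<nu> (A x))"
  unfolding diag_ev_eq sum_distrib_left by (rule sum.swap)

lemma diag_ev_mid: "diag_ev n \<nu> (mid (2^n)) = 1"
proof -
  have "diag_ev n \<nu> (mid (2^n)) = (\<Sum>s<2^n. of_real (occ_weight n \<nu> s))"
    unfolding diag_ev_eq by (intro sum.cong) (auto simp: mid_def)
  also have "\<dots> = of_real 1" by (simp only: of_real_sum[symmetric] occ_weight_sum)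
  finally show ?thesis by simp
qed

abbreviation fock_mono :: "nat \<Rightarrow> testfun list \<Rightarrow> cmat" where
  "fock_mono n fs \<equiv> mprod (2^n) (map (fockB n) fs)"

lemma mprod_Nil: "mprod N [] = mid N"
  by (simp add: mprod_def)

lemma mprod_Cons: "mprod N (A # As) = mmul N A (mprod N As)"
  by (simp add: mprod_def)

lemma supp_mat_fock_mono: "supp_mat (2^n) (fock_mono n fs)"
  by (induction fs) (auto simp: mprod_Nil mprod_Cons supp_mat_mid intro!: supp_mat_mmul supp_mat_fockB)

text \<open>Repeated use of the anticommutation relation: every factor that B(f) passes changes the
  sign and leaves behind a scalar contraction.\<close>

lemma fockB_move_right:
  "mmul (2^n) (fockB n f) (fock_mono n fs) i j =
     (\<Sum>k<length fs. (-1) ^ k * car_form n f (fs ! k) * fock_mono n (drop_nth k fs) i j)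
     + (-1) ^ length fs * mmul (2^n) (fock_mono n fs) (fockB n f) i j"
proof (induction fs arbitrary: i j)
  case Nil
  show ?case by (simp add: mprod_Nil mmul_mid_left mmul_mid_right supp_mat_fockB)
next
  case (Cons g fs)
  let ?B = "fockB n" and ?m = "mmul (2^n)" and ?X = "fock_mono n fs"
  have drop: "fock_mono n (drop_nth (Suc k) (g # fs)) = ?m (?B g) (fock_mono n (drop_nth k fs))" for k
    by (simp add: drop_nth_def mprod_Cons)
  have "?m (?B f) (fock_mono n (g # fs)) i j = ?m (?m (?B f) (?B g)) ?X i j"
    by (simp add: mprod_Cons mmul_assoc)
  also have "?m (?B f) (?B g) = (\<lambda>i j. car_form n f g * mid (2^n) i j + (-1) * ?m (?B g) (?B f) i j)"
    using fockB_anticommute[of n f g] by (simp add: fun_eq_iff eq_diff_eq)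
  also have "?m \<dots> ?X i j = car_form n f g * ?X i j - ?m (?B g) (?m (?B f) ?X) i j"
    unfolding mmul_add_left mmul_scale_left
    by (simp add: mmul_mid_left supp_mat_fock_mono mmul_assoc)
  also have "?m (?B f) ?X = (\<lambda>i j. (\<Sum>k<length fs. ((-1) ^ k * car_form n f (fs ! k)) * fock_mono n (drop_nth k fs) i j)
     + (-1) ^ length fs * ?m ?X (?B f) i j)"
    by (intro ext) (rule Cons.IH)
  also have "?m (?B g) \<dots> i j = (\<Sum>k<length fs. (-1) ^ k * car_form n f (fs ! k) * ?m (?B g) (fock_mono n (drop_nth k fs)) i j)
     + (-1) ^ length fs * ?m (fock_mono n (g # fs)) (?B f) i j"
    unfolding mmul_add_right mmul_sum_right mmul_scale_right by (simp add: mprod_Cons mmul_assoc)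
  finally show ?case
    by (simp add: sum.lessThan_Suc_shift drop sum_negf del: sum.lessThan_Suc) (simp add: drop_nth_def)
qed

text \<open>The two-point function of B(f) B(g) in the diagonal state: the number operator of site k
  has expectation \<open>\<nu> k\<close>, and the reversed product has
  \<open>1 - \<nu> k\<close>.\<close>

definition diag_pair :: "nat \<Rightarrow> (nat \<Rightarrow> real) \<Rightarrow> testfun \<Rightarrow> testfun \<Rightarrow> complex" where
  "diag_pair n \<nu> f g = (\<Sum>k<n. of_real (\<nu> k) * f True (int k + 1) * g False (int k + 1)
      + of_real (1 - \<nu> k) * f False (int k + 1) * g True (int k + 1))"

text \<open>The KMS-type relation between R D and D R turns cyclicity of the trace into the Wick recursion;
  it is stated without division so that no positivity of the weights is needed.\<close>

lemma diag_ev_wick_generator: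
  assumes kms: "\<And>i j. a * mmul (2^n) (diag_state n \<nu>) (fockB n f) i j
      = (1 - a) * mmul (2^n) (fockB n f) (diag_state n \<nu>) i j"
    and odd: "odd (length fs)"
  shows "diag_ev n \<nu> (mmul (2^n) (fockB n f) (fock_mono n fs))
     = (\<Sum>k<length fs. (-1) ^ k * ((1 - a) * car_form n f (fs ! k)) * diag_ev n \<nu> (fock_mono n (drop_nth k fs)))"
proof -
  let ?D = "diag_state n \<nu>" and ?R = "fockB n f" and ?X = "fock_mono n fs" and ?m = "mmul (2^n)"
  have eq: "?m ?R ?X = (\<lambda>i j. (\<Sum>k<length fs. ((-1) ^ k * car_form n f (fs ! k)) * fock_mono n (drop_nth k fs) i j)
     + (-1) * ?m ?X ?R i j)"
    using fockB_move_right[of n f fs] odd by (simp add: fun_eq_iff)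
  have 1: "diag_ev n \<nu> (?m ?R ?X) + diag_ev n \<nu> (?m ?X ?R)
     = (\<Sum>k<length fs. (-1) ^ k * car_form n f (fs ! k) * diag_ev n \<nu> (fock_mono n (drop_nth k fs)))"
    unfolding eq diag_ev_add diag_ev_sum diag_ev_scale by simp
  have "(1 - a) * diag_ev n \<nu> (?m ?X ?R) = (1 - a) * mtrace (2^n) (?m (?m ?R ?D) ?X)"
    unfolding diag_ev_def mmul_assoc[symmetric] by (subst mtrace_mmul_commute) (simp add: mmul_assoc)
  also have "\<dots> = mtrace (2^n) (?m (\<lambda>i j. (1 - a) * ?m ?R ?D i j) ?X)"
    unfolding mmul_scale_left by (simp add: mtrace_def sum_distrib_left)
  also have "(\<lambda>i j. (1 - a) * ?m ?R ?D i j) = (\<lambda>i j. a * ?m ?D ?R i j)" using kms by (simp add: fun_eq_iff)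
  also have "mtrace (2^n) (?m \<dots> ?X) = a * diag_ev n \<nu> (?m ?R ?X)"
    unfolding mmul_scale_left diag_ev_def by (simp add: mtrace_def sum_distrib_left mmul_assoc)
  \<comment> \<open>With x and y the expectations of R X and X R, cyclicity has given (1 - a) y = a
    x, hence x = (1 - a)(x + y) for every a; x + y is the sum of the contractions.\<close>
  finally have "diag_ev n \<nu> (?m ?R ?X) = (1 - a) * (diag_ev n \<nu> (?m ?R ?X) + diag_ev n \<nu> (?m ?X ?R))"
    by (simp add: algebra_simps)
  then show ?thesis unfolding 1 by (simp add: sum_distrib_left mult_ac)
qed

definition mode_fun :: "bool \<Rightarrow> nat \<Rightarrow> testfun" where
  "mode_fun a k b x = (if b = a \<and> x = int k + 1 then 1 else 0)"

lemma fockB_mode_fun: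
  assumes "k < n"
  shows "fockB n (mode_fun True k) = raise n k" "fockB n (mode_fun False k) = low n k"
proof -
  have "fockB n (mode_fun True k) i j = (\<Sum>l<n. if l = k then raise n k i j else 0)" for i j
    unfolding fockB_eq by (intro sum.cong) (auto simp: mode_fun_def)
  then show "fockB n (mode_fun True k) = raise n k" using assms by (simp add: fun_eq_iff)
  have "fockB n (mode_fun False k) i j = (\<Sum>l<n. if l = k then low n k i j else 0)" for i j
    unfolding fockB_eq by (intro sum.cong) (auto simp: mode_fun_def)
  then show "fockB n (mode_fun False k) = low n k" using assms by (simp add: fun_eq_iff)
qed

lemma car_form_mode_fun:
  assumes "k < n"
  shows "car_form n (mode_fun a k) g = g (\<not> a) (int k + 1)"
proof -
  have "car_form n (mode_fun a k) g = (\<Sum>l<n. if l = k then g (\<not> a) (int k + 1) else 0)"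
    unfolding car_form_def by (intro sum.cong) (auto simp: mode_fun_def)
  then show ?thesis using assms by simp
qed

text \<open>The commutation with the diagonal state has a scalar factor for each single mode, while
  different modes have different factors. So the recursion is obtained mode by mode and extended to
  B(f) by linearity.\<close>

lemma diag_ev_wick:
  assumes "odd (length fs)"
  shows "diag_ev n \<nu> (fock_mono n (f # fs))
     = (\<Sum>j<length fs. (-1) ^ j * diag_pair n \<nu> f (fs ! j) * diag_ev n \<nu> (fock_mono n (drop_nth j fs)))"
proof -
  let ?X = "fock_mono n fs" and ?m = "mmul (2^n)" and ?e = "diag_ev n \<nu>"
  let ?d = "\<lambda>j. ?e (fock_mono n (drop_nth j fs))"
  \<comment> \<open>Creation operators satisfy the relation with a = \<open>1 - \<nu> k\<close>,
    annihilation operators with a = \<open>\<nu> k\<close>; the prefactor 1 - a is the expectation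
    of the corresponding product.\<close>
  have r: "?e (?m (raise n k) ?X) = (\<Sum>j<length fs. (-1) ^ j * (of_real (\<nu> k) * (fs ! j) False (int k + 1)) * ?d j)"
    if "k < n" for k
    using diag_ev_wick_generator[of "of_real (1 - \<nu> k)" n \<nu> "mode_fun True k" fs] assms diag_state_raise[OF that, of \<nu>]
    by (simp add: fockB_mode_fun[OF that] car_form_mode_fun[OF that])
  have l: "?e (?m (low n k) ?X) = (\<Sum>j<length fs. (-1) ^ j * (of_real (1 - \<nu> k) * (fs ! j) True (int k + 1)) * ?d j)"
    if "k < n" for k
    using diag_ev_wick_generator[of "of_real (\<nu> k)" n \<nu> "mode_fun False k" fs] assms diag_state_low[OF that, of \<nu>]
    by (simp add: fockB_mode_fun[OF that] car_form_mode_fun[OF that])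
  have "?e (fock_mono n (f # fs)) = (\<Sum>k<n. f True (int k + 1) * ?e (?m (raise n k) ?X)
      + f False (int k + 1) * ?e (?m (low n k) ?X))"
    unfolding list.map mprod_Cons
    unfolding fockB_eq[of n f] mmul_sum_left mmul_add_left mmul_scale_left diag_ev_sum diag_ev_add diag_ev_scale ..
  also have "\<dots> = (\<Sum>k<n. \<Sum>j<length fs. (-1) ^ j * (of_real (\<nu> k) * f True (int k + 1) * (fs ! j) False (int k + 1)
      + of_real (1 - \<nu> k) * f False (int k + 1) * (fs ! j) True (int k + 1)) * ?d j)"
    by (intro sum.cong refl)
       (simp add: r l sum_distrib_left sum.distrib[symmetric] algebra_simps del: of_real_diff)
  also have "\<dots> = (\<Sum>j<length fs. (-1) ^ j * diag_pair n \<nu> f (fs ! j) * ?d j)"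
    unfolding diag_pair_def by (subst sum.swap) (simp add: sum_distrib_left sum_distrib_right)
  finally show ?thesis .
qed

text \<open>Each B(f) changes the particle number by one, so it reverses the total parity
  \<open>jw_sign n\<close>.\<close>

lemma fock_mono_parity:
  "fock_mono n fs t s \<noteq> 0 \<Longrightarrow> jw_sign n t = (-1) ^ length fs * jw_sign n s"
proof (induction fs arbitrary: t)
  case Nil
  then show ?case by (auto simp: mprod_Nil mid_def split: if_splits)
next
  case (Cons f fs)
  then obtain u where u: "fockB n f t u * fock_mono n fs u s \<noteq> 0"
    unfolding list.map mprod_Cons mmul_def by (meson sum.not_neutral_contains_not_neutral)
  then have "fockB n f t u \<noteq> 0" by auto
  then obtain k where k: "k < n" "raise n k t u \<noteq> 0 \<or> low n k t u \<noteq> 0"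
    unfolding fockB_eq by (metis (no_types, lifting) add.right_neutral lessThan_iff mult_zero_right
        sum.neutral)
  then have "jw_sign n t = - jw_sign n u"
    by (auto simp: raise_def low_def jw_sign_set_bit jw_sign_unset_bit split: if_splits)
  then show ?case using Cons.IH[of u] u by simp
qed

lemma diag_ev_odd: "odd (length fs) \<Longrightarrow> diag_ev n \<nu> (fock_mono n fs) = 0"
proof -
  assume odd: "odd (length fs)"
  have "fock_mono n fs s s = 0" for s
  proof (rule ccontr)
    assume "fock_mono n fs s s \<noteq> 0"
    then have "jw_sign n s = - jw_sign n s" using fock_mono_parity[of n fs s s] odd by simp
    then have "jw_sign n s = 0" by simp
    then show False by (simp add: jw_sign_def)
  qed
  then show ?thesis by (simp add: diag_ev_eq)
qed

theorem diag_ev_pfaffian: "diag_ev n \<nu> (fock_mono n fs) = pfaffian (diag_pair n \<nu>) fs"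
proof (induction "length fs" arbitrary: fs rule: less_induct)
  case less
  show ?case
  proof (cases "odd (length fs)")
    case True
    then show ?thesis by (simp add: diag_ev_odd pfaffian_def)
  next
    case even: False
    show ?thesis
    proof (cases fs)
      case Nil
      then show ?thesis by (simp add: pfaffian_Nil mprod_Nil diag_ev_mid)
    next
      case (Cons f gs)
      then have odd: "odd (length gs)" using even by simp
      have "diag_ev n \<nu> (fock_mono n (drop_nth j gs)) = pfaffian (diag_pair n \<nu>) (drop_nth j gs)"
        if "j < length gs" for j
        by (rule less) (use Cons that in \<open>simp add: length_drop_nth\<close>)
      then show ?thesis unfolding Cons diag_ev_wick[OF odd] pfaffian_Cons[OF odd] by simp
    qed
  qed
qed

section \<open>The reduced density matrix and its entropy\<close>

lemma spectral_sesquilinear: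
  assumes fin: "finite K" "finite I" and card: "card K = card I"
    and on: "\<And>k l. k \<in> K \<Longrightarrow> l \<in> K \<Longrightarrow> inn I (g k) (g l) = (if k = l then 1 else 0)"
    and ev: "\<And>k i. k \<in> K \<Longrightarrow> i \<in> I \<Longrightarrow> lin_ap I S (g k) i = e k * g k i"
  shows "inn I v (lin_ap I S w) = (\<Sum>k\<in>K. e k * inn I v (g k) * inn I (g k) w)"
proof -
  have compl: "(\<Sum>k\<in>K. g k i * cnj (g k j)) = (if i = j then 1 else 0)" if "i \<in> I" "j \<in> I" for i j
    by (rule orthonormal_family_complete[OF fin card _ that]) (use on in \<open>simp add: inn_def\<close>)
  have w: "w j = (\<Sum>k\<in>K. inn I (g k) w * g k j)" if "j \<in> I" for j
  proof -
    have "w j = (\<Sum>i\<in>I. (\<Sum>k\<in>K. g k j * cnj (g k i)) * w i)"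
      using compl[OF that] that fin by (simp add: if_distrib[of "\<lambda>y. y * _"] cong: if_cong)
    also have "\<dots> = (\<Sum>k\<in>K. \<Sum>i\<in>I. g k j * cnj (g k i) * w i)"
      unfolding sum_distrib_right by (rule sum.swap)
    finally show ?thesis by (simp add: inn_def sum_distrib_left sum_distrib_right mult_ac)
  qed
  have Sw: "lin_ap I S w i = (\<Sum>k\<in>K. inn I (g k) w * (e k * g k i))" if "i \<in> I" for i
  proof -
    have "lin_ap I S w i = (\<Sum>j\<in>I. \<Sum>k\<in>K. inn I (g k) w * (S i j * g k j))"
      unfolding lin_ap_def
    proof (rule sum.cong[OF refl])
      fix j assume "j \<in> I"
      show "S i j * w j = (\<Sum>k\<in>K. inn I (g k) w * (S i j * g k j))"
        by (subst w[OF \<open>j \<in> I\<close>]) (simp add: sum_distrib_left mult_ac)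
    qed
    also have "\<dots> = (\<Sum>k\<in>K. inn I (g k) w * lin_ap I S (g k) i)"
      unfolding lin_ap_def sum_distrib_left by (rule sum.swap)
    also have "\<dots> = (\<Sum>k\<in>K. inn I (g k) w * (e k * g k i))" using ev that by simp
    finally show ?thesis .
  qed
  have "inn I v (lin_ap I S w) = (\<Sum>i\<in>I. \<Sum>k\<in>K. e k * (cnj (v i) * g k i) * inn I (g k) w)"
    unfolding inn_def[of I v] by (intro sum.cong refl) (simp add: Sw sum_distrib_left mult_ac)
  also have "\<dots> = (\<Sum>k\<in>K. \<Sum>i\<in>I. e k * (cnj (v i) * g k i) * inn I (g k) w)" by (rule sum.swap)
  finally show ?thesis by (simp add: inn_def[of I v] sum_distrib_left sum_distrib_right)
qed

definition site_dual :: "bool \<times> int \<Rightarrow> bool \<times> int" where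
  "site_dual p = (\<not> fst p, snd p)"

lemma dual_conj_site: "dual_conj site_dual (case_prod f) = case_prod (Jop f)"
  by (auto simp: dual_conj_def site_dual_def Jop_def fun_eq_iff)

lemma site_dual_block:
  "i \<in> block_index n \<Longrightarrow> site_dual i \<in> block_index n" "site_dual (site_dual i) = i"
  by (auto simp: site_dual_def block_index_def)

lemma sum_block_index: "(\<Sum>i\<in>block_index n. h i) = (\<Sum>a\<in>UNIV. \<Sum>x\<in>{1..int n}. h (a, x))"
  by (simp add: block_index_def sum.cartesian_product)

lemma card_block_index: "finite (block_index n)" "card (block_index n) = 2 * n"
  by (simp_all add: block_index_def card_cartesian_product)

text \<open>An eigenbasis u_k, J u_k of the compression of S to the block, in the language of test
  functions. The entropy formula is derived from any such basis; its existence rests on the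
  symmetries of the symbol and is shown later.\<close>

locale block_spectrum =
  fixes \<beta> \<delta> \<gamma> lam :: real and n :: nat and u :: "nat \<Rightarrow> testfun" and \<nu> :: "nat \<Rightarrow> real"
  assumes ev: "k < n \<Longrightarrow> i \<in> block_index n \<Longrightarrow>
      lin_ap (block_index n) (\<lambda>(a, x) (b, y). Sker \<beta> \<delta> \<gamma> lam a b x y) (case_prod (u k)) i
        = of_real (\<nu> k) * case_prod (u k) i"
    and ev_dual: "k < n \<Longrightarrow> i \<in> block_index n \<Longrightarrow>
      lin_ap (block_index n) (\<lambda>(a, x) (b, y). Sker \<beta> \<delta> \<gamma> lam a b x y) (case_prod (Jop (u k))) i
        = of_real (1 - \<nu> k) * case_prod (Jop (u k)) i"
    and on: "k < n \<Longrightarrow> l < n \<Longrightarrow> car_form n (Jop (u k)) (u l) = (if k = l then 1 else 0)"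
    and dual: "k < n \<Longrightarrow> l < n \<Longrightarrow> car_form n (u k) (u l) = 0"
begin

abbreviation "Sm \<equiv> \<lambda>(a, x) (b, y). Sker \<beta> \<delta> \<gamma> lam a b x y"

definition basis :: "bool \<times> nat \<Rightarrow> bool \<times> int \<Rightarrow> complex" where
  "basis p = case_prod (if fst p then Jop (u (snd p)) else u (snd p))"

definition basis_ev :: "bool \<times> nat \<Rightarrow> real" where
  "basis_ev p = (if fst p then 1 - \<nu> (snd p) else \<nu> (snd p))"

lemma Jop_Jop [simp]: "Jop (Jop f) = f"
  by (simp add: Jop_def fun_eq_iff)

lemma car_form_Jop: "car_form n (Jop f) (Jop g) = cnj (car_form n f g)"
  by (simp add: car_form_def Jop_def add.commute)

lemma car_form_commute: "car_form n f g = car_form n g f"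
  by (simp add: car_form_def mult.commute add.commute)

lemma basis_orthonormal:
  assumes "p \<in> UNIV \<times> {..<n}" "q \<in> UNIV \<times> {..<n}"
  shows "inn (block_index n) (basis p) (basis q) = (if p = q then 1 else 0)"
proof -
  obtain a k b l where pq: "p = (a, k)" "q = (b, l)" by (cases p; cases q)
  then have kl: "k < n" "l < n" using assms by auto
  have "car_form n (u k) (Jop (u l)) = (if k = l then 1 else 0)"
    using on[OF kl(2,1)] car_form_commute[of "u k" "Jop (u l)"] by auto
  then show ?thesis using pq kl
    by (cases a; cases b)
       (simp_all add: basis_def inn_block_index on dual car_form_Jop)
qed

lemma basis_eigen:
  assumes "p \<in> UNIV \<times> {..<n}" and i: "i \<in> block_index n"
  shows "lin_ap (block_index n) Sm (basis p) i = of_real (basis_ev p) * basis p i"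
proof -
  obtain a k where p: "p = (a, k)" by (cases p)
  then have k: "k < n" using assms by auto
  show ?thesis
    by (cases a) (simp_all only: p basis_def basis_ev_def fst_conv snd_conv if_True if_False
        ev[OF k i] ev_dual[OF k i])
qed

lemma card_basis: "card ((UNIV::bool set) \<times> {..<n}) = card (block_index n)"
  by (simp add: card_block_index card_cartesian_product)

text \<open>The map on test functions that \<open>bogoliubov_unitary\<close> implements: the +
  component is (J u_k, f), the - component is (u_k, f).\<close>

definition coord :: "testfun \<Rightarrow> testfun" where
  "coord = (\<lambda>f a x. car_form n (if a then u (nat (x - 1)) else Jop (u (nat (x - 1)))) f)"

lemma two_point_inn:
  "two_point \<beta> \<delta> \<gamma> lam n f g
     = inn (block_index n) (case_prod f) (lin_ap (block_index n) Sm (case_prod g))"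
proof -
  have "inn (block_index n) (case_prod f) (lin_ap (block_index n) Sm (case_prod g))
      = (\<Sum>a\<in>UNIV. \<Sum>x\<in>{1..int n}. \<Sum>b\<in>UNIV. \<Sum>y\<in>{1..int n}.
          cnj (f a x) * Sker \<beta> \<delta> \<gamma> lam a b x y * g b y)"
    unfolding inn_def lin_ap_def sum_block_index sum_distrib_left by (simp add: mult.assoc)
  also have "\<dots> = (\<Sum>x\<in>{1..int n}. \<Sum>a\<in>UNIV. \<Sum>y\<in>{1..int n}. \<Sum>b\<in>UNIV.
          cnj (f a x) * Sker \<beta> \<delta> \<gamma> lam a b x y * g b y)"
    by (subst sum.swap) (intro sum.cong refl sum.swap)
  also have "\<dots> = two_point \<beta> \<delta> \<gamma> lam n f g"
    unfolding two_point_def by (intro sum.cong refl sum.swap)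
  finally show ?thesis by simp
qed

text \<open>Spectral resolution of (J f, S g). The eigenvector u_k with eigenvalue
  \<open>\<nu> k\<close> pairs the + coordinate of f with the - coordinate of g, and J u_k does the
  opposite with \<open>1 - \<nu> k\<close>, exactly as in the diagonal state.\<close>

lemma pair_fn_eq: "pair_fn \<beta> \<delta> \<gamma> lam n f g = diag_pair n \<nu> (coord f) (coord g)"
proof -
  let ?I = "block_index n"
  have "pair_fn \<beta> \<delta> \<gamma> lam n f g = (\<Sum>p\<in>UNIV \<times> {..<n}. of_real (basis_ev p)
      * inn ?I (case_prod (Jop f)) (basis p) * inn ?I (basis p) (case_prod g))"
    unfolding pair_fn_def two_point_inn
    by (rule spectral_sesquilinear[OF _ card_block_index(1) card_basis basis_orthonormal basis_eigen])
       simp_all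
  also have "\<dots> = (\<Sum>k<n. of_real (1 - \<nu> k) * car_form n f (Jop (u k)) * car_form n (u k) g
      + of_real (\<nu> k) * car_form n f (u k) * car_form n (Jop (u k)) g)"
    unfolding sum_bool_times
    by (simp add: basis_def basis_ev_def inn_block_index sum.distrib)
  finally show ?thesis
    by (simp add: diag_pair_def coord_def car_form_commute[of f] add.commute mult.commute mult.left_commute)
qed

end

lemma pfaffian_map: "pfaffian w (map h fs) = pfaffian (\<lambda>f g. w (h f) (h g)) fs"
proof (cases "odd (length fs)")
  case False
  then have "even (length fs)" by simp
  then obtain m where m: "length fs = 2 * m" by (elim evenE)
  have "map h fs ! p i = h (fs ! p i)" if "p \<in> pairings m" "i < 2 * m" for p i
    using that permutes_in_image[of p "{..<2*m}" i] m by (simp add: pairings_def)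
  then show ?thesis using m unfolding pfaffian_def
    by (simp del: nth_map)
qed (simp add: pfaffian_def)

lemma omega_mono_pfaffian: "omega_mono \<beta> \<delta> \<gamma> lam n fs = pfaffian (pair_fn \<beta> \<delta> \<gamma> lam n) fs"
  by (simp add: omega_mono_def pfaffian_def Let_def)

lemma mprod_append:
  assumes "supp_mat N (mprod N Bs)"
  shows "mprod N (As @ Bs) = mmul N (mprod N As) (mprod N Bs)"
  by (induction As) (simp_all add: mprod_Nil mprod_Cons mmul_mid_left assms mmul_assoc)

lemma fock_mono_append: "fock_mono n (fs @ gs) = mmul (2^n) (fock_mono n fs) (fock_mono n gs)"
  using mprod_append[OF supp_mat_fock_mono] by simp

lemma fock_mono_snoc: "fock_mono n (fs @ [f]) = mmul (2^n) (fock_mono n fs) (fockB n f)"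
  unfolding fock_mono_append by (simp add: mprod_Cons mprod_Nil mmul_mid_right supp_mat_fockB)

section \<open>Matrix units as monomials in the field operators\<close>

lemma supported_mode_fun: "k < n \<Longrightarrow> supported_in n (mode_fun a k)"
  by (auto simp: supported_in_def mode_fun_def)

text \<open>Creation operators for the occupied sites of \<open>s\<close>, applied to the vacuum,
  produce the basis state \<open>s\<close> up to a sign.\<close>

lemma fock_mono_column:
  "s < 2^n \<Longrightarrow> \<exists>fs \<epsilon>. (\<forall>f\<in>set fs. supported_in n f) \<and> \<epsilon> \<noteq> 0 \<and>
     (\<forall>t. fock_mono n fs t 0 = (if t = s then \<epsilon> else 0))"
proof (induction s rule: less_induct)
  case (less s)
  show ?case
  proof (cases "s = 0")
    case True
    then show ?thesis by (intro exI[of _ "[]"] exI[of _ 1]) (auto simp: mprod_Nil mid_def)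
  next
    case False
    define j where "j = low_bit s"
    have bj: "bit s j" using low_bit(1)[OF False] by (simp add: j_def)
    have j: "j < n" using bj less bit_imp_lt by blast
    obtain fs \<epsilon> where fs: "\<forall>f\<in>set fs. supported_in n f" "\<epsilon> \<noteq> 0"
        "\<forall>t. fock_mono n fs t 0 = (if t = unset_bit j s then \<epsilon> else 0)"
      using less.IH[OF unset_bit_lt[OF bj]] unset_bit_less less.prems by blast
    have "fock_mono n (mode_fun True j # fs) t 0 = (if t = s then jw_sign j (unset_bit j s) * \<epsilon> else 0)" for t
    proof -
      have "fock_mono n (mode_fun True j # fs) t 0 = (\<Sum>v<2^n. if v = unset_bit j s then raise n j t v * \<epsilon> else 0)"
        unfolding list.map mprod_Cons fockB_mode_fun[OF j] mmul_def using fs(3) by (intro sum.cong) auto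
      also have "\<dots> = raise n j t (unset_bit j s) * \<epsilon>" using less.prems by (simp add: unset_bit_less)
      finally show ?thesis using j less.prems bj
        by (simp add: raise_def unset_bit_less bit_unset_bit_iff set_bit_unset_bit)
    qed
    moreover have "jw_sign j (unset_bit j s) * \<epsilon> \<noteq> 0" using fs(2) by (simp add: jw_sign_def)
    ultimately show ?thesis using fs(1) supported_mode_fun[OF j]
      by (intro exI[of _ "mode_fun True j # fs"] exI[of _ "jw_sign j (unset_bit j s) * \<epsilon>"]) auto
  qed
qed

lemma fock_mono_row:
  "t < 2^n \<Longrightarrow> \<exists>fs \<epsilon>. (\<forall>f\<in>set fs. supported_in n f) \<and> \<epsilon> \<noteq> 0 \<and>
     (\<forall>s. fock_mono n fs 0 s = (if s = t then \<epsilon> else 0))"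
proof (induction t rule: less_induct)
  case (less t)
  show ?case
  proof (cases "t = 0")
    case True
    then show ?thesis by (intro exI[of _ "[]"] exI[of _ 1]) (auto simp: mprod_Nil mid_def)
  next
    case False
    define j where "j = low_bit t"
    have bj: "bit t j" using low_bit(1)[OF False] by (simp add: j_def)
    have j: "j < n" using bj less bit_imp_lt by blast
    obtain fs \<epsilon> where fs: "\<forall>f\<in>set fs. supported_in n f" "\<epsilon> \<noteq> 0"
        "\<forall>s. fock_mono n fs 0 s = (if s = unset_bit j t then \<epsilon> else 0)"
      using less.IH[OF unset_bit_lt[OF bj]] unset_bit_less less.prems by blast
    have "fock_mono n (fs @ [mode_fun False j]) 0 s = (if s = t then \<epsilon> * jw_sign j t else 0)" for s
    proof (cases "s < 2^n \<and> bit s j \<and> unset_bit j s = unset_bit j t")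
      case True
      then have "s = t" using bj by (metis set_bit_unset_bit)
      then show ?thesis unfolding fock_mono_snoc fockB_mode_fun[OF j] mmul_low_right
        using fs(3) True j by simp
    next
      case False
      then show ?thesis unfolding fock_mono_snoc fockB_mode_fun[OF j] mmul_low_right
        using fs(3) bj less.prems by auto
    qed
    moreover have "\<epsilon> * jw_sign j t \<noteq> 0" using fs(2) by (simp add: jw_sign_def)
    ultimately show ?thesis using fs(1) supported_mode_fun[OF j]
      by (intro exI[of _ "fs @ [mode_fun False j]"] exI[of _ "\<epsilon> * jw_sign j t"]) auto
  qed
qed

text \<open>The product of b_k b_k^* over all sites projects onto the vacuum; each factor excludes a
  particle at one further site.\<close>

lemma fock_mono_vacuum_projection:
  "\<exists>fs. (\<forall>f\<in>set fs. supported_in n f) \<and>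
     (\<forall>t s. fock_mono n fs t s = (if t = 0 \<and> s = 0 then 1 else 0))"
proof -
  have "\<exists>fs. (\<forall>f\<in>set fs. supported_in n f) \<and>
     (\<forall>t s. fock_mono n fs t s = (if t = s \<and> s < 2^n \<and> (\<forall>k<m. \<not> bit s k) then 1 else 0))"
    if "m \<le> n" for m
    using that
  proof (induction m)
    case 0
    show ?case by (intro exI[of _ "[]"]) (auto simp: mprod_Nil mid_def)
  next
    case (Suc m)
    then obtain fs where fs: "\<forall>f\<in>set fs. supported_in n f"
      "\<And>t s. fock_mono n fs t s = (if t = s \<and> s < 2^n \<and> (\<forall>k<m. \<not> bit s k) then 1 else 0)" by auto
    have m: "m < n" using Suc.prems by simp
    let ?gs = "(fs @ [mode_fun False m]) @ [mode_fun True m]"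
    have "fock_mono n ?gs t s = (if t = s \<and> s < 2^n \<and> (\<forall>k<Suc m. \<not> bit s k) then 1 else 0)" for t s
    proof (cases "s < 2^n \<and> \<not> bit s m")
      case True
      then have "fock_mono n ?gs t s = fock_mono n fs t s"
        unfolding fock_mono_snoc fockB_mode_fun[OF m] mmul_raise_right mmul_low_right using m
        by (simp add: set_bit_less bit_set_bit_iff unset_bit_set_bit jw_sign_set_bit)
      then show ?thesis unfolding fs(2) using True by (auto simp: less_Suc_eq)
    next
      case False
      then show ?thesis
        unfolding fock_mono_snoc fockB_mode_fun[OF m] mmul_raise_right by auto
    qed
    then show ?case using fs(1) supported_mode_fun[OF m] by (intro exI[of _ ?gs]) auto
  qed
  from this[of n] obtain fs where fs: "\<forall>f\<in>set fs. supported_in n f"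
    "\<And>t s. fock_mono n fs t s = (if t = s \<and> s < 2^n \<and> (\<forall>k<n. \<not> bit s k) then 1 else 0)" by auto
  have "s < 2^n \<and> (\<forall>k<n. \<not> bit s k) \<longleftrightarrow> s = 0" for s :: nat
    using low_bit(1)[of s] bit_imp_lt[of s _ n] by (cases "s = 0") auto
  then show ?thesis using fs by (intro exI[of _ fs]) auto
qed

text \<open>A monomial creating \<open>s\<close>, the vacuum projection, and a monomial annihilating
  \<open>t\<close>, multiplied in this order, leave a multiple of a single matrix unit.\<close>

lemma fock_mono_matrix_unit:
  assumes "s < 2^n" "t < 2^n"
  shows "\<exists>fs \<epsilon>. (\<forall>f\<in>set fs. supported_in n f) \<and> \<epsilon> \<noteq> 0 \<and>
     (\<forall>i j. fock_mono n fs i j = (if i = s \<and> j = t then \<epsilon> else 0))"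
proof -
  obtain cs \<epsilon> where c: "\<forall>f\<in>set cs. supported_in n f" "\<epsilon> \<noteq> 0"
    "\<And>i. fock_mono n cs i 0 = (if i = s then \<epsilon> else 0)" using fock_mono_column[OF assms(1)] by blast
  obtain rs \<eta> where r: "\<forall>f\<in>set rs. supported_in n f" "\<eta> \<noteq> 0"
    "\<And>j. fock_mono n rs 0 j = (if j = t then \<eta> else 0)" using fock_mono_row[OF assms(2)] by blast
  obtain ps where p: "\<forall>f\<in>set ps. supported_in n f"
     "\<And>i j. fock_mono n ps i j = (if i = 0 \<and> j = 0 then 1 else 0)"
    using fock_mono_vacuum_projection[of n] by blast
  have pr: "mmul (2^n) (fock_mono n ps) (fock_mono n rs) k j = (if k = 0 then fock_mono n rs 0 j else 0)" for k j
  proof -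
    have "mmul (2^n) (fock_mono n ps) (fock_mono n rs) k j
       = (\<Sum>l<(2::nat)^n. if l = 0 then (if k = 0 then fock_mono n rs 0 j else 0) else 0)"
      unfolding mmul_def p(2) by (intro sum.cong) auto
    then show ?thesis by simp
  qed
  have "fock_mono n (cs @ (ps @ rs)) i j = fock_mono n cs i 0 * fock_mono n rs 0 j" for i j
  proof -
    have "fock_mono n (cs @ (ps @ rs)) i j
       = (\<Sum>l<(2::nat)^n. if l = 0 then fock_mono n cs i 0 * fock_mono n rs 0 j else 0)"
      unfolding fock_mono_append[of n cs] fock_mono_append[of n ps]
      unfolding mmul_def[of _ "fock_mono n cs"] pr by (intro sum.cong) auto
    then show ?thesis by simp
  qed
  then show ?thesis using c r p
    by (intro exI[of _ "cs @ ps @ rs"] exI[of _ "\<epsilon> * \<eta>"]) auto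
qed

text \<open>Testing against matrix units reads off each entry in the block, and outside the block
  both matrices vanish by definition. This is the uniqueness behind the definite description
  \<open>rho\<close>.\<close>

lemma density_determined_by_moments:
  assumes "density_mat (2^n) \<rho>" "density_mat (2^n) \<rho>'"
    and eq: "\<And>fs. \<forall>f\<in>set fs. supported_in n f \<Longrightarrow>
       mtrace (2^n) (mmul (2^n) \<rho> (fock_mono n fs)) = mtrace (2^n) (mmul (2^n) \<rho>' (fock_mono n fs))"
  shows "\<rho> = \<rho>'"
proof (intro ext)
  fix t s
  show "\<rho> t s = \<rho>' t s"
  proof (cases "s < 2^n \<and> t < 2^n")
    case True
    then obtain fs \<epsilon> where fs: "\<forall>f\<in>set fs. supported_in n f" "\<epsilon> \<noteq> 0"
      "\<And>i j. fock_mono n fs i j = (if i = s \<and> j = t then \<epsilon> else 0)"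
      using fock_mono_matrix_unit[of s n t] by blast
    have "mtrace (2^n) (mmul (2^n) A (fock_mono n fs)) = A t s * \<epsilon>" for A
    proof -
      have "mmul (2^n) A (fock_mono n fs) i i = (if i = t then A t s * \<epsilon> else 0)" for i
      proof -
        have "mmul (2^n) A (fock_mono n fs) i i
            = (\<Sum>k<(2::nat)^n. if k = s then (if i = t then A t s * \<epsilon> else 0) else 0)"
          unfolding mmul_def fs(3) by (intro sum.cong) auto
        then show ?thesis using True by simp
      qed
      then have "mtrace (2^n) (mmul (2^n) A (fock_mono n fs))
          = (\<Sum>i<(2::nat)^n. if i = t then A t s * \<epsilon> else 0)" by (simp add: mtrace_def)
      then show ?thesis using True by simp
    qed
    then show ?thesis using eq[OF fs(1)] fs(2) by simp
  next
    case False
    have "A t s = 0" if "density_mat (2^n) A" for A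
    proof -
      have "\<forall>i j. i \<ge> 2^n \<or> j \<ge> 2^n \<longrightarrow> A i j = 0"
        using that unfolding density_mat_def by (rule conjunct1)
      then show ?thesis using False by (meson not_le)
    qed
    from this[OF assms(1)] this[OF assms(2)] show ?thesis by simp
  qed
qed

lemma sum_rotate:
  "(\<Sum>l\<in>A. \<Sum>i\<in>B. \<Sum>j\<in>C. f l i j) = (\<Sum>i\<in>B. \<Sum>j\<in>C. \<Sum>l\<in>A. f l i j)"
  by (rule trans[OF sum.swap]) (intro sum.cong refl sum.swap)

text \<open>W = U* V intertwines the two diagonal matrices, so it only connects equal eigenvalues; since
  the squared moduli of its entries are doubly stochastic, the two entropies agree.\<close>

lemma vn_entropy_eq:
  assumes U: "unitary_mat N U"
    and \<rho>: "\<And>i j. i < N \<Longrightarrow> j < N \<Longrightarrow> \<rho> i j = (\<Sum>k<N. U i k * of_real (d k) * cnj (U j k))"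
  shows "vn_entropy N \<rho> = (\<Sum>k<N. - d k * ln (d k))"
  unfolding vn_entropy_def
proof (rule some_equality)
  show "\<exists>U (d'::nat \<Rightarrow> real). unitary_mat N U \<and>
       (\<forall>i<N. \<forall>j<N. \<rho> i j = (\<Sum>k<N. U i k * of_real (d' k) * cnj (U j k))) \<and>
       (\<Sum>k<N. - d k * ln (d k)) = (\<Sum>k<N. - d' k * ln (d' k))"
    using assms by blast
next
  fix s assume "\<exists>U (d'::nat \<Rightarrow> real). unitary_mat N U \<and>
       (\<forall>i<N. \<forall>j<N. \<rho> i j = (\<Sum>k<N. U i k * of_real (d' k) * cnj (U j k))) \<and>
       s = (\<Sum>k<N. - d' k * ln (d' k))"
  then obtain V and d' :: "nat \<Rightarrow> real" where V: "unitary_mat N V"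
    and \<rho>': "\<And>i j. i < N \<Longrightarrow> j < N \<Longrightarrow> \<rho> i j = (\<Sum>k<N. V i k * of_real (d' k) * cnj (V j k))"
    and s: "s = (\<Sum>k<N. - d' k * ln (d' k))" by blast
  have col: "(\<Sum>i<N. cnj (A i k) * A i l) = (if k = l then 1 else 0)"
    if "unitary_mat N A" "k < N" "l < N" for A k l
    using that by (auto simp: unitary_mat_def mmul_def madj_def mid_def)
  define W where "W k l = (\<Sum>i<N. cnj (U i k) * V i l)" for k l
  have left: "(\<Sum>j<N. \<rho> i j * V j l) = V i l * of_real (d' l)" if "i < N" "l < N" for i l
  proof -
    have "(\<Sum>j<N. \<rho> i j * V j l) = (\<Sum>j<N. \<Sum>k<N. V i k * of_real (d' k) * (cnj (V j k) * V j l))"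
      using that by (simp add: \<rho>' sum_distrib_right sum_distrib_left mult_ac)
    also have "\<dots> = (\<Sum>k<N. V i k * of_real (d' k) * (\<Sum>j<N. cnj (V j k) * V j l))"
      by (subst sum.swap) (simp add: sum_distrib_left)
    also have "\<dots> = (\<Sum>k<N. if k = l then V i l * of_real (d' l) else 0)"
      using that by (intro sum.cong) (auto simp: col[OF V])
    finally show ?thesis using that by simp
  qed
  have right: "(\<Sum>i<N. cnj (U i k) * \<rho> i j) = of_real (d k) * cnj (U j k)" if "k < N" "j < N" for k j
  proof -
    have "(\<Sum>i<N. cnj (U i k) * \<rho> i j) = (\<Sum>i<N. \<Sum>l<N. (cnj (U i k) * U i l) * of_real (d l) * cnj (U j l))"
      using that by (simp add: \<rho> sum_distrib_left sum_distrib_right mult_ac)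
    also have "\<dots> = (\<Sum>l<N. (\<Sum>i<N. cnj (U i k) * U i l) * of_real (d l) * cnj (U j l))"
      by (subst sum.swap) (simp add: sum_distrib_right)
    also have "\<dots> = (\<Sum>l<N. if l = k then of_real (d k) * cnj (U j k) else 0)"
      using that by (intro sum.cong) (auto simp: col[OF U])
    finally show ?thesis using that by simp
  qed
  have inter: "of_real (d k) * W k l = W k l * of_real (d' l)" if "k < N" "l < N" for k l
  proof -
    have "W k l * of_real (d' l) = (\<Sum>i<N. cnj (U i k) * (V i l * of_real (d' l)))"
      by (simp add: W_def sum_distrib_right mult.assoc)
    also have "\<dots> = (\<Sum>i<N. cnj (U i k) * (\<Sum>j<N. \<rho> i j * V j l))"
      using that by (simp add: left)
    also have "\<dots> = (\<Sum>j<N. (\<Sum>i<N. cnj (U i k) * \<rho> i j) * V j l)"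
      unfolding sum_distrib_left sum_distrib_right by (subst sum.swap) (simp add: mult_ac)
    also have "\<dots> = (\<Sum>j<N. (of_real (d k) * cnj (U j k)) * V j l)" using that by (simp add: right)
    also have "\<dots> = of_real (d k) * W k l" by (simp add: W_def sum_distrib_left mult.assoc)
    finally show ?thesis by (rule sym)
  qed
  have norm: "(cmod z)^2 = Re (cnj z * z)" for z
    by (simp add: complex_norm_square[symmetric] mult.commute[of "cnj z"] del: of_real_power)
  have row1: "(\<Sum>l<N. (cmod (W k l))^2) = 1" if "k < N" for k
  proof -
    have "(\<Sum>l<N. W k l * cnj (W k l)) = (\<Sum>l<N. \<Sum>i<N. \<Sum>j<N. cnj (U i k) * U j k * (V i l * cnj (V j l)))"
      unfolding W_def cnj_sum sum_product by (intro sum.cong refl) (simp add: mult_ac)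
    also have "\<dots> = (\<Sum>i<N. \<Sum>j<N. cnj (U i k) * U j k * (\<Sum>l<N. V i l * cnj (V j l)))"
      unfolding sum_distrib_left by (rule sum_rotate)
    also have "\<dots> = (\<Sum>i<N. \<Sum>j<N. if j = i then cnj (U i k) * U i k else 0)"
      by (intro sum.cong refl) (auto simp: unitary_mat_right[OF V])
    also have "\<dots> = 1" using col[OF U that that] by simp
    finally have "Re (\<Sum>l<N. cnj (W k l) * W k l) = 1" by (simp add: mult.commute)
    then show ?thesis unfolding norm by simp
  qed
  have col1: "(\<Sum>k<N. (cmod (W k l))^2) = 1" if "l < N" for l
  proof -
    have "(\<Sum>k<N. cnj (W k l) * W k l) = (\<Sum>k<N. \<Sum>i<N. \<Sum>j<N. cnj (V i l) * V j l * (U i k * cnj (U j k)))"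
      unfolding W_def cnj_sum sum_product by (intro sum.cong refl) (simp add: mult_ac)
    also have "\<dots> = (\<Sum>i<N. \<Sum>j<N. cnj (V i l) * V j l * (\<Sum>k<N. U i k * cnj (U j k)))"
      unfolding sum_distrib_left by (rule sum_rotate)
    also have "\<dots> = (\<Sum>i<N. \<Sum>j<N. if j = i then cnj (V i l) * V i l else 0)"
      by (intro sum.cong refl) (auto simp: unitary_mat_right[OF U])
    also have "\<dots> = 1" using col[OF V that that] by simp
    finally have "Re (\<Sum>k<N. cnj (W k l) * W k l) = 1" by simp
    then show ?thesis unfolding norm by simp
  qed
  let ?f = "\<lambda>x::real. - x * ln x"
  have eq: "(cmod (W k l))^2 * ?f (d k) = (cmod (W k l))^2 * ?f (d' l)" if "k < N" "l < N" for k l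
  proof (cases "W k l = 0")
    case False
    then have "of_real (d k) = (of_real (d' l) :: complex)" using inter[OF that] by simp
    then show ?thesis by simp
  qed simp
  have "(\<Sum>k<N. ?f (d k)) = (\<Sum>k<N. (\<Sum>l<N. (cmod (W k l))^2) * ?f (d k))" by (simp add: row1)
  also have "\<dots> = (\<Sum>k<N. \<Sum>l<N. (cmod (W k l))^2 * ?f (d' l))"
    unfolding sum_distrib_right by (intro sum.cong refl eq) auto
  also have "\<dots> = (\<Sum>l<N. (\<Sum>k<N. (cmod (W k l))^2) * ?f (d' l))"
    unfolding sum_distrib_right by (rule sum.swap)
  also have "\<dots> = (\<Sum>l<N. ?f (d' l))" by (simp add: col1)
  finally show "s = (\<Sum>k<N. - d k * ln (d k))" using s by simp
qed

lemma fock_mono_intertwine: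
  assumes U: "supp_mat (2^n) U" and eq: "\<And>f. mmul (2^n) (fockB n f) U = mmul (2^n) U (fockB n (h f))"
  shows "mmul (2^n) (fock_mono n fs) U = mmul (2^n) U (fock_mono n (map h fs))"
proof (induction fs)
  case Nil
  then show ?case using U by (simp add: mprod_Nil mmul_mid_left mmul_mid_right)
next
  case (Cons f fs)
  have "mmul (2^n) (fock_mono n (f # fs)) U = mmul (2^n) (fockB n f) (mmul (2^n) (fock_mono n fs) U)"
    by (simp add: mprod_Cons mmul_assoc)
  also have "\<dots> = mmul (2^n) (mmul (2^n) (fockB n f) U) (fock_mono n (map h fs))"
    by (simp only: Cons.IH mmul_assoc)
  also have "\<dots> = mmul (2^n) U (fock_mono n (map h (f # fs)))"
    by (simp add: eq mprod_Cons mmul_assoc)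
  finally show ?case .
qed

context block_spectrum
begin

theorem block_entropy_sum:
  assumes \<nu>: "\<And>k. k < n \<Longrightarrow> 0 < \<nu> k \<and> \<nu> k < 1"
  shows "block_entropy \<beta> \<delta> \<gamma> lam n = (\<Sum>k<n. hent (2 * \<nu> k - 1))"
proof -
  let ?N = "2 ^ n :: nat" and ?D = "diag_state n \<nu>" and ?w = "occ_weight n \<nu>"
  obtain U where U: "supp_mat ?N U" "unitary_mat ?N U"
    and int: "\<And>f. mmul ?N (fockB n f) U = mmul ?N U (fockB n (coord f))"
    using bogoliubov_unitary[of n u, OF on dual] unfolding coord_def by blast
  \<comment> \<open>The candidate for the density matrix is the product state carried back by U. Its
    spectral decomposition is explicit, with the weights \<open>?w\<close> as eigenvalues.\<close>
  define R where "R = mmul ?N U (mmul ?N ?D (madj U))"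
  have R: "R i j = (\<Sum>k<?N. U i k * of_real (?w k) * cnj (U j k))" for i j
    unfolding R_def mmul_def[of _ U] mmul_diag_state_left by (intro sum.cong) (auto simp: madj_def)
  have suppR: "supp_mat ?N R" using U(1) by (auto simp: supp_mat_def R)
  have tr: "mtrace ?N (mmul ?N R (fock_mono n fs)) = omega_mono \<beta> \<delta> \<gamma> lam n fs" for fs
  proof -
    have "mtrace ?N (mmul ?N R (fock_mono n fs)) = mtrace ?N (mmul ?N U (mmul ?N ?D (mmul ?N (madj U) (fock_mono n fs))))"
      by (simp add: R_def mmul_assoc)
    also have "\<dots> = mtrace ?N (mmul ?N ?D (mmul ?N (madj U) (mmul ?N (fock_mono n fs) U)))"
      by (subst mtrace_mmul_commute) (simp add: mmul_assoc)
    also have "\<dots> = mtrace ?N (mmul ?N ?D (mmul ?N (mmul ?N (madj U) U) (fock_mono n (map coord fs))))"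
      by (simp only: fock_mono_intertwine[OF U(1) int] mmul_assoc)
    also have "\<dots> = diag_ev n \<nu> (fock_mono n (map coord fs))"
      by (simp only: unitary_mmul_madj[OF U(2,1)] mmul_mid_left[OF supp_mat_fock_mono] diag_ev_def)
    also have "\<dots> = pfaffian (\<lambda>f g. diag_pair n \<nu> (coord f) (coord g)) fs"
      unfolding diag_ev_pfaffian pfaffian_map ..
    also have "\<dots> = omega_mono \<beta> \<delta> \<gamma> lam n fs"
      unfolding omega_mono_pfaffian pair_fn_eq[symmetric] ..
    finally show ?thesis .
  qed
  have dens: "density_mat ?N R"
    unfolding density_mat_def
  proof (intro conjI allI impI)
    show "R i j = 0" if "i \<ge> ?N \<or> j \<ge> ?N" for i j using suppR that by (auto simp: supp_mat_def)
    show "R i j = cnj (R j i)" for i j by (simp add: R mult_ac)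
    show "mtrace ?N R = 1"
      using tr[of "[]"] suppR by (simp add: mprod_Nil mmul_mid_right omega_mono_pfaffian pfaffian_Nil)
    fix v :: "nat \<Rightarrow> complex"
    have "(\<Sum>i<?N. \<Sum>j<?N. cnj (v i) * R i j * v j)
        = (\<Sum>i<?N. \<Sum>j<?N. \<Sum>k<?N. of_real (?w k) * (cnj (v i) * U i k) * (cnj (U j k) * v j))"
      unfolding R sum_distrib_left sum_distrib_right by (intro sum.cong refl) (simp add: mult_ac)
    also have "\<dots> = (\<Sum>k<?N. \<Sum>i<?N. \<Sum>j<?N. of_real (?w k) * (cnj (v i) * U i k) * (cnj (U j k) * v j))"
      by (rule sum_rotate[symmetric])
    also have "\<dots> = (\<Sum>k<?N. of_real (?w k) * ((\<Sum>i<?N. cnj (v i) * U i k) * cnj (\<Sum>j<?N. cnj (v j) * U j k)))"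
      by (simp add: sum_product sum_distrib_left mult_ac)
    also have "\<dots> = of_real (\<Sum>k<?N. ?w k * (cmod (\<Sum>i<?N. cnj (v i) * U i k))^2)"
      unfolding complex_norm_square[symmetric] by (simp only: of_real_sum of_real_mult)
    finally show "0 \<le> Re (\<Sum>i<?N. \<Sum>j<?N. cnj (v i) * R i j * v j)"
      using occ_weight_pos[OF \<nu>] by (simp only: Re_complex_of_real) (intro sum_nonneg mult_nonneg_nonneg, auto intro: less_imp_le)
  qed
  have "rho \<beta> \<delta> \<gamma> lam n = R"
    unfolding rho_def
  proof (rule the_equality)
    show "density_mat ?N R \<and> (\<forall>fs. (\<forall>f\<in>set fs. supported_in n f) \<longrightarrow>
         mtrace ?N (mmul ?N R (fock_mono n fs)) = omega_mono \<beta> \<delta> \<gamma> lam n fs)"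
      using dens tr by blast
    show "\<rho> = R" if "density_mat ?N \<rho> \<and> (\<forall>fs. (\<forall>f\<in>set fs. supported_in n f) \<longrightarrow>
         mtrace ?N (mmul ?N \<rho> (fock_mono n fs)) = omega_mono \<beta> \<delta> \<gamma> lam n fs)" for \<rho>
      by (rule density_determined_by_moments) (use that dens tr in auto)
  qed
  then have "block_entropy \<beta> \<delta> \<gamma> lam n = vn_entropy ?N R" by (simp add: block_entropy_def)
  also have "\<dots> = (\<Sum>k<?N. - ?w k * ln (?w k))" by (rule vn_entropy_eq[OF U(2)]) (rule R)
  also have "\<dots> = (\<Sum>k<n. hent (2 * \<nu> k - 1))" by (rule occ_weight_entropy[OF \<nu>])
  finally show ?thesis .
qed

end

section \<open>Averages over the circle and Parseval\<close>

text \<open>A class of integrands closed under the algebraic operations used below, so that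
  integrability conditions are settled by \<open>bdd_borel_intros\<close> alone.\<close>

definition bdd_borel :: "(real \<Rightarrow> 'a::euclidean_space) \<Rightarrow> bool" where
  "bdd_borel f \<longleftrightarrow> f \<in> borel_measurable borel \<and> (\<exists>B. \<forall>x. norm (f x) \<le> B)"

definition avg :: "(real \<Rightarrow> 'a::euclidean_space) \<Rightarrow> 'a" where
  "avg f = integral {0..2*pi} f /\<^sub>R (2 * pi)"

lemma bdd_borelI: "f \<in> borel_measurable borel \<Longrightarrow> (\<And>x. norm (f x) \<le> B) \<Longrightarrow> bdd_borel f"
  by (auto simp: bdd_borel_def)

lemma bdd_borel_integrable: "bdd_borel f \<Longrightarrow> f integrable_on {0..2*pi}"
proof -
  assume f: "bdd_borel f"
  then obtain B where B: "\<And>x. norm (f x) \<le> B" by (auto simp: bdd_borel_def)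
  show ?thesis
  proof (rule measurable_bounded_by_integrable_imp_integrable[where g="\<lambda>_. B"])
    have "f \<in> borel_measurable lebesgue"
      using f by (auto simp: bdd_borel_def intro: measurable_completion)
    then show "f \<in> borel_measurable (lebesgue_on {0..2*pi})"
      by (rule measurable_restrict_space1)
  qed (use B in \<open>auto intro: integrable_const_ivl\<close>)
qed

named_theorems bdd_borel_intros

lemma bdd_borel_const [bdd_borel_intros, simp]: "bdd_borel (\<lambda>_. c)"
  by (auto simp: bdd_borel_def)

lemma bdd_borel_add [bdd_borel_intros]:
  assumes "bdd_borel f" "bdd_borel g" shows "bdd_borel (\<lambda>x. f x + g x)"
proof -
  obtain B C where "\<And>x. norm (f x) \<le> B" "\<And>x. norm (g x) \<le> C" using assms by (auto simp: bdd_borel_def)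
  then show ?thesis using assms
    by (intro bdd_borelI[of _ "B + C"]) (auto simp: bdd_borel_def intro: norm_triangle_mono)
qed

lemma bdd_borel_mult [bdd_borel_intros]:
  fixes f g :: "real \<Rightarrow> 'a::{euclidean_space, real_normed_algebra}"
  assumes "bdd_borel f" "bdd_borel g" shows "bdd_borel (\<lambda>x. f x * g x)"
proof -
  obtain B C where BC: "\<And>x. norm (f x) \<le> B" "\<And>x. norm (g x) \<le> C" using assms by (auto simp: bdd_borel_def)
  have "norm (f x * g x) \<le> B * C" for x
    using norm_mult_ineq[of "f x" "g x"] mult_mono[OF BC(1)[of x] BC(2)[of x]] norm_ge_zero
    by (smt (verit) BC(1))
  then show ?thesis using assms
    by (intro bdd_borelI[of _ "B * C"]) (auto simp: bdd_borel_def intro: borel_measurable_times)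
qed

lemma bdd_borel_minus [bdd_borel_intros]: "bdd_borel f \<Longrightarrow> bdd_borel (\<lambda>x. - f x)"
  by (auto simp: bdd_borel_def)

lemma bdd_borel_diff [bdd_borel_intros]: "bdd_borel f \<Longrightarrow> bdd_borel g \<Longrightarrow> bdd_borel (\<lambda>x. f x - g x)"
  using bdd_borel_add[OF _ bdd_borel_minus, of f g] by simp

lemma bdd_borel_sum [bdd_borel_intros]:
  "(\<And>i. i \<in> I \<Longrightarrow> bdd_borel (f i)) \<Longrightarrow> bdd_borel (\<lambda>x. \<Sum>i\<in>I. f i x)"
  by (induction I rule: infinite_finite_induct) (auto intro: bdd_borel_add)

lemma bdd_borel_power [bdd_borel_intros]:
  fixes f :: "real \<Rightarrow> 'a::{euclidean_space, real_normed_algebra_1}"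
  shows "bdd_borel f \<Longrightarrow> bdd_borel (\<lambda>x. f x ^ n)"
  by (induction n) (auto intro: bdd_borel_mult)

lemma bdd_borel_of_real [bdd_borel_intros]: "bdd_borel f \<Longrightarrow> bdd_borel (\<lambda>x. complex_of_real (f x))"
  by (auto simp: bdd_borel_def)

lemma bdd_borel_cnj [bdd_borel_intros]: "bdd_borel f \<Longrightarrow> bdd_borel (\<lambda>x. cnj (f x))"
  by (auto simp: bdd_borel_def intro!: borel_measurable_continuous_on[OF continuous_on_cnj[OF continuous_on_id]])

lemma bdd_borel_Re [bdd_borel_intros]: "bdd_borel f \<Longrightarrow> bdd_borel (\<lambda>x. Re (f x))"
proof -
  assume f: "bdd_borel f"
  then obtain B where "\<And>x. cmod (f x) \<le> B" by (auto simp: bdd_borel_def)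
  then have "norm (Re (f x)) \<le> B" for x using abs_Re_le_cmod[of "f x"] by (smt (verit) real_norm_def)
  then show ?thesis using f by (intro bdd_borelI) (auto simp: bdd_borel_def)
qed

lemma bdd_borel_Im [bdd_borel_intros]: "bdd_borel f \<Longrightarrow> bdd_borel (\<lambda>x. Im (f x))"
proof -
  assume f: "bdd_borel f"
  then obtain B where "\<And>x. cmod (f x) \<le> B" by (auto simp: bdd_borel_def)
  then have "norm (Im (f x)) \<le> B" for x using abs_Im_le_cmod[of "f x"] by (smt (verit) real_norm_def)
  then show ?thesis using f by (intro bdd_borelI) (auto simp: bdd_borel_def)
qed

lemma bdd_borel_norm [bdd_borel_intros]: "bdd_borel f \<Longrightarrow> bdd_borel (\<lambda>x. norm (f x))"
  by (auto simp: bdd_borel_def)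

lemma bdd_borel_If [bdd_borel_intros]: "bdd_borel f \<Longrightarrow> bdd_borel g \<Longrightarrow> bdd_borel (\<lambda>x. if P then f x else g x)"
  by (cases P) simp_all

lemma avg_add: "bdd_borel f \<Longrightarrow> bdd_borel g \<Longrightarrow> avg (\<lambda>x. f x + g x) = avg f + avg g"
  by (simp add: avg_def integral_add bdd_borel_integrable scaleR_add_right)

lemma avg_const: "avg (\<lambda>_. c) = c"
  by (simp add: avg_def)

lemma avg_mult_left:
  fixes f :: "real \<Rightarrow> 'a::{euclidean_space, real_normed_algebra}"
  assumes "bdd_borel f" shows "avg (\<lambda>x. c * f x) = c * avg f"
proof -
  have "integral {0..2*pi} ((\<lambda>y. c * y) \<circ> f) = c * integral {0..2*pi} f"
    by (rule integral_linear[OF bdd_borel_integrable[OF assms] bounded_linear_mult_right])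
  then show ?thesis by (simp add: avg_def o_def)
qed

lemma avg_minus: "avg (\<lambda>x. - f x) = - avg f"
  by (simp add: avg_def)

lemma avg_diff: "bdd_borel f \<Longrightarrow> bdd_borel g \<Longrightarrow> avg (\<lambda>x. f x - g x) = avg f - avg g"
  by (simp add: avg_def integral_diff bdd_borel_integrable scaleR_diff_right)

lemma avg_sum: "finite I \<Longrightarrow> (\<And>i. i \<in> I \<Longrightarrow> bdd_borel (f i)) \<Longrightarrow> avg (\<lambda>x. \<Sum>i\<in>I. f i x) = (\<Sum>i\<in>I. avg (f i))"
  by (simp add: avg_def integral_sum bdd_borel_integrable scaleR_sum_right)

lemma avg_mono:
  fixes f g :: "real \<Rightarrow> real"
  shows "bdd_borel f \<Longrightarrow> bdd_borel g \<Longrightarrow> (\<And>x. f x \<le> g x) \<Longrightarrow> avg f \<le> avg g"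
  unfolding avg_def by (auto intro!: divide_right_mono integral_le bdd_borel_integrable simp: divide_inverse_commute[symmetric])

lemma avg_cnj: "avg (\<lambda>x. cnj (f x)) = cnj (avg f)"
  by (simp add: avg_def integral_cnj scaleR_conv_of_real)

lemma avg_of_real: "bdd_borel f \<Longrightarrow> avg (\<lambda>x. complex_of_real (f x)) = of_real (avg f)"
  using integral_linear[OF bdd_borel_integrable bounded_linear_of_real[where 'a=complex], of f]
  by (simp add: avg_def o_def scaleR_conv_of_real)

lemma avg_Re: "bdd_borel f \<Longrightarrow> avg (\<lambda>x. Re (f x)) = Re (avg f)"
  using integral_linear[OF bdd_borel_integrable bounded_linear_Re, of f]
  by (simp add: avg_def o_def)

lemma avg_reflect: "avg (\<lambda>x. f (2 * pi - x)) = avg f"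
proof -
  have *: "((\<lambda>x. f (2 * pi - x)) has_integral y) {0..2*pi}" if "(f has_integral y) {0..2*pi}" for y and f :: "real \<Rightarrow> 'a"
  proof -
    have "((\<lambda>x. f ((-1) *\<^sub>R x + 2 * pi)) has_integral (1 / \<bar>- 1 :: real\<bar> ^ DIM(real)) *\<^sub>R y)
       ((\<lambda>x. (1 / (-1)) *\<^sub>R x + - ((1 / (-1)) *\<^sub>R (2 * pi))) ` cbox 0 (2 * pi))"
      by (rule has_integral_affinity) (use that in auto)
    moreover have "(\<lambda>x::real. (1 / (-1)) *\<^sub>R x + - ((1 / (-1)) *\<^sub>R (2 * pi))) ` cbox 0 (2 * pi) = {0..2*pi}"
      by (auto simp: image_iff intro!: bexI[of _ "2 * pi - _"])
    ultimately show ?thesis by (simp add: algebra_simps)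
  qed
  have "integral {0..2*pi} (\<lambda>x. f (2 * pi - x)) = integral {0..2*pi} f"
  proof (cases "f integrable_on {0..2*pi}")
    case True
    then show ?thesis using * integrable_integral by blast
  next
    \<comment> \<open>The reflection of a non-integrable function is not integrable either, and then
      both integrals have the default value 0.\<close>
    case False
    moreover have "\<not> (\<lambda>x. f (2 * pi - x)) integrable_on {0..2*pi}"
    proof
      assume "(\<lambda>x. f (2 * pi - x)) integrable_on {0..2*pi}"
      then obtain y where "((\<lambda>x. f (2 * pi - x)) has_integral y) {0..2*pi}" by blast
      then have "(f has_integral y) {0..2*pi}" using *[of "\<lambda>x. f (2 * pi - x)"] by simp
      then show False using False by blast
    qed
    ultimately show ?thesis by (simp add: not_integrable_integral)
  qed
  then show ?thesis by (simp add: avg_def)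
qed

section \<open>Fourier modes and trigonometric polynomials\<close>

definition fmode :: "int \<Rightarrow> real \<Rightarrow> complex" where
  "fmode k \<xi> = exp (\<i> * of_int k * of_real \<xi>)"

lemma fmode_add: "fmode (k + l) \<xi> = fmode k \<xi> * fmode l \<xi>"
  by (simp add: fmode_def exp_add[symmetric] algebra_simps)

lemma fmode_0 [simp]: "fmode 0 \<xi> = 1"
  by (simp add: fmode_def)

lemma cnj_fmode: "cnj (fmode k \<xi>) = fmode (- k) \<xi>"
  by (simp add: fmode_def exp_cnj)

lemma bdd_borel_fmode [bdd_borel_intros]: "bdd_borel (fmode k)"
  by (rule bdd_borelI[of _ 1])
     (auto simp: fmode_def[abs_def] intro!: borel_measurable_continuous_onI continuous_intros)

lemma fmode_reflect: "fmode k (2 * pi - \<xi>) = fmode (- k) \<xi>"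
proof -
  have "exp (2 * of_int k * of_real pi * \<i>) = (1::complex)"
    using exp_integer_2pi[of "of_int k"] by (simp add: mult_ac)
  then show ?thesis
    by (simp add: fmode_def right_diff_distrib exp_diff exp_minus inverse_eq_divide mult_ac)
qed

lemma avg_fmode: "avg (fmode k) = (if k = 0 then 1 else 0)"
proof (cases "k = 0")
  case True
  then show ?thesis using avg_const[of "1::complex"] by (simp add: fmode_def[abs_def])
next
  case False
  have "(fmode k has_integral (fmode k (2 * pi) / (\<i> * of_int k) - fmode k 0 / (\<i> * of_int k))) {0..2*pi}"
  proof (rule fundamental_theorem_of_calculus)
    fix x :: real
    have "((\<lambda>\<xi>. exp (\<i> * of_int k * of_real \<xi>)) has_vector_derivative
        (\<i> * of_int k) * exp (\<i> * of_int k * of_real x)) (at x within {0..2*pi})"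
      by (auto intro!: derivative_eq_intros has_vector_derivative_real_field)
    from has_vector_derivative_mult_right[OF this, of "1 / (\<i> * of_int k)"]
    show "((\<lambda>\<xi>. fmode k \<xi> / (\<i> * of_int k)) has_vector_derivative fmode k x) (at x within {0..2*pi})"
      using False by (simp add: fmode_def)
  qed auto
  moreover have "fmode k (2 * pi) = fmode k 0" using fmode_reflect[of k 0] by (simp add: fmode_def)
  ultimately have "integral {0..2*pi} (fmode k) = 0" by (auto simp: integral_unique)
  then show ?thesis using False by (simp add: avg_def)
qed

definition trig_poly :: "(real \<Rightarrow> complex) \<Rightarrow> bool" where
  "trig_poly P \<longleftrightarrow> (\<exists>m c. \<forall>\<xi>. P \<xi> = (\<Sum>l\<in>{- int m..int m}. c l * fmode l \<xi>))"

lemma trig_poly_fmode: "trig_poly (fmode k)"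
  unfolding trig_poly_def
proof (intro exI allI)
  fix \<xi>
  show "fmode k \<xi> = (\<Sum>l\<in>{- int (nat \<bar>k\<bar>)..int (nat \<bar>k\<bar>)}. (if l = k then 1 else 0) * fmode l \<xi>)"
    by (simp add: if_distrib[of "\<lambda>x. x * _"] cong: if_cong) linarith
qed

lemma trig_poly_scale: "trig_poly P \<Longrightarrow> trig_poly (\<lambda>\<xi>. a * P \<xi>)"
proof -
  assume "trig_poly P"
  then obtain m c where "\<forall>\<xi>. P \<xi> = (\<Sum>l\<in>{- int m..int m}. c l * fmode l \<xi>)" by (auto simp: trig_poly_def)
  then show ?thesis unfolding trig_poly_def
    by (intro exI[of _ m] exI[of _ "\<lambda>l. a * c l"]) (simp add: sum_distrib_left mult.assoc)
qed

lemma trig_poly_add: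
  assumes "trig_poly P" "trig_poly Q"
  shows "trig_poly (\<lambda>\<xi>. P \<xi> + Q \<xi>)"
proof -
  obtain m c where P: "\<And>\<xi>. P \<xi> = (\<Sum>l\<in>{- int m..int m}. c l * fmode l \<xi>)"
    using assms(1) unfolding trig_poly_def by blast
  obtain m' c' where Q: "\<And>\<xi>. Q \<xi> = (\<Sum>l\<in>{- int m'..int m'}. c' l * fmode l \<xi>)"
    using assms(2) unfolding trig_poly_def by blast
  define M where "M = max m m'"
  have "P \<xi> = (\<Sum>l\<in>{- int M..int M}. (if \<bar>l\<bar> \<le> int m then c l else 0) * fmode l \<xi>)" for \<xi>
    unfolding P by (rule sum.mono_neutral_cong_left) (auto simp: M_def)
  moreover have "Q \<xi> = (\<Sum>l\<in>{- int M..int M}. (if \<bar>l\<bar> \<le> int m' then c' l else 0) * fmode l \<xi>)" for \<xi>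
    unfolding Q by (rule sum.mono_neutral_cong_left) (auto simp: M_def)
  ultimately show ?thesis unfolding trig_poly_def
    by (intro exI[of _ M] exI[of _ "\<lambda>l. (if \<bar>l\<bar> \<le> int m then c l else 0) + (if \<bar>l\<bar> \<le> int m' then c' l else 0)"])
       (simp add: distrib_right sum.distrib)
qed

lemma trig_poly_zero: "trig_poly (\<lambda>_. 0)"
  using trig_poly_scale[OF trig_poly_fmode, of 0] by simp

lemma trig_poly_sum: "(\<And>i. i \<in> I \<Longrightarrow> trig_poly (f i)) \<Longrightarrow> trig_poly (\<lambda>\<xi>. \<Sum>i\<in>I. f i \<xi>)"
  by (induction I rule: infinite_finite_induct) (auto intro: trig_poly_add trig_poly_zero)

lemma trig_poly_mult:
  assumes "trig_poly P" "trig_poly Q"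
  shows "trig_poly (\<lambda>\<xi>. P \<xi> * Q \<xi>)"
proof -
  obtain m c where P: "\<And>\<xi>. P \<xi> = (\<Sum>l\<in>{- int m..int m}. c l * fmode l \<xi>)"
    using assms(1) unfolding trig_poly_def by blast
  obtain m' c' where Q: "\<And>\<xi>. Q \<xi> = (\<Sum>l\<in>{- int m'..int m'}. c' l * fmode l \<xi>)"
    using assms(2) unfolding trig_poly_def by blast
  have "(\<lambda>\<xi>. P \<xi> * Q \<xi>) = (\<lambda>\<xi>. \<Sum>l\<in>{- int m..int m}. \<Sum>l'\<in>{- int m'..int m'}. (c l * c' l') * fmode (l + l') \<xi>)"
    unfolding P Q sum_product fmode_add by (simp add: mult_ac)
  then show ?thesis by (simp only:) (intro trig_poly_sum trig_poly_scale trig_poly_fmode)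
qed

text \<open>On the unit circle a real-linear functional is a combination of cos and sin, and
  polynomial functions arise from these by sums and products. Thus Stone-Weierstrass on the circle
  yields trigonometric polynomials.\<close>

lemma trig_poly_real_polynomial:
  "real_polynomial_function p \<Longrightarrow> trig_poly (\<lambda>\<xi>. of_real (p (cis \<xi>)))"
proof (induction p rule: real_polynomial_function.induct)
  case (linear f)
  have f: "f (cis \<xi>) = cos \<xi> * f 1 + sin \<xi> * f \<i>" for \<xi>
  proof -
    have "cis \<xi> = cos \<xi> *\<^sub>R 1 + sin \<xi> *\<^sub>R \<i>" by (simp add: complex_eq_iff)
    then show ?thesis using linear by (simp add: linear_simps)
  qed
  have c: "complex_of_real (cos \<xi>) = 1/2 * fmode 1 \<xi> + 1/2 * fmode (-1) \<xi>" for \<xi>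
    by (simp add: fmode_def cos_of_real[symmetric] cos_exp_eq field_simps)
  have s: "complex_of_real (sin \<xi>) = (- \<i>/2) * fmode 1 \<xi> + (\<i>/2) * fmode (-1) \<xi>" for \<xi>
    by (simp add: fmode_def sin_of_real[symmetric] sin_exp_eq) (simp add: field_simps)
  have "(\<lambda>\<xi>. complex_of_real (f (cis \<xi>))) = (\<lambda>\<xi>. of_real (f 1) * (1/2 * fmode 1 \<xi> + 1/2 * fmode (-1) \<xi>)
      + of_real (f \<i>) * ((- \<i>/2) * fmode 1 \<xi> + (\<i>/2) * fmode (-1) \<xi>))"
    unfolding f of_real_add of_real_mult c s by (simp add: mult.commute)
  then show ?case by (simp only:) (intro trig_poly_add trig_poly_scale trig_poly_fmode)
next
  case (const c)
  show ?case using trig_poly_scale[OF trig_poly_fmode[of 0], of "of_real c"] by simp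
next
  case (add f g)
  then show ?case using trig_poly_add by simp
next
  case (mult f g)
  then show ?case using trig_poly_mult by simp
qed

text \<open>The usual coefficient with index -k; the sign follows the kernel exp(i (y - x) xi) of
  S.\<close>

definition fourier :: "(real \<Rightarrow> real) \<Rightarrow> int \<Rightarrow> complex" where
  "fourier a k = avg (\<lambda>\<xi>. fmode k \<xi> * of_real (a \<xi>))"

lemma fourier_cnj: "bdd_borel a \<Longrightarrow> avg (\<lambda>\<xi>. of_real (a \<xi>) * cnj (fmode k \<xi>)) = fourier a (- k)"
  by (simp add: fourier_def cnj_fmode mult.commute)

text \<open>Expanding the square by orthogonality, the mean square error is avg(a^2) plus the
  squared distances of the \<open>c l\<close> from the Fourier coefficients minus the squared
  coefficients. The distances are dropped.\<close>

lemma best_approximation: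
  assumes a: "bdd_borel a" and P: "\<And>\<xi>. P \<xi> = (\<Sum>l\<in>{- int m..int m}. c l * fmode l \<xi>)"
  shows "avg (\<lambda>\<xi>. (a \<xi>)^2) - avg (\<lambda>\<xi>. (cmod (of_real (a \<xi>) - P \<xi>))^2)
     \<le> (\<Sum>l\<in>{- int m..int m}. (cmod (fourier a l))^2)"
proof -
  let ?L = "{- int m..int m}"
  have bP: "bdd_borel P" unfolding P[abs_def] by (intro bdd_borel_intros)
  have 1: "(cmod (of_real (a \<xi>) - P \<xi>))^2 = (a \<xi>)^2 - 2 * Re (of_real (a \<xi>) * cnj (P \<xi>)) + Re (P \<xi> * cnj (P \<xi>))" for \<xi>
    unfolding cmod_power2 by (simp add: power2_eq_square algebra_simps)
  have "avg (\<lambda>\<xi>. of_real (a \<xi>) * cnj (P \<xi>)) = avg (\<lambda>\<xi>. \<Sum>l\<in>?L. cnj (c l) * (of_real (a \<xi>) * cnj (fmode l \<xi>)))"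
    unfolding P by (simp add: sum_distrib_left mult_ac)
  also have "\<dots> = (\<Sum>l\<in>?L. cnj (c l) * fourier a (- l))"
    using a by (subst avg_sum) (auto intro!: bdd_borel_intros sum.cong simp: avg_mult_left bdd_borel_intros fourier_cnj)
  finally have 2: "avg (\<lambda>\<xi>. of_real (a \<xi>) * cnj (P \<xi>)) = (\<Sum>l\<in>?L. cnj (c l) * fourier a (- l))" .
  have "avg (\<lambda>\<xi>. P \<xi> * cnj (P \<xi>)) = avg (\<lambda>\<xi>. \<Sum>l\<in>?L. \<Sum>k\<in>?L. (c l * cnj (c k)) * fmode (l - k) \<xi>)"
    unfolding P cnj_sum sum_product by (simp add: cnj_fmode fmode_add[symmetric] mult_ac)
  also have "\<dots> = (\<Sum>l\<in>?L. \<Sum>k\<in>?L. (c l * cnj (c k)) * avg (fmode (l - k)))"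
    by (simp add: avg_sum bdd_borel_intros avg_mult_left)
  also have "\<dots> = (\<Sum>l\<in>?L. \<Sum>k\<in>?L. if k = l then c l * cnj (c l) else 0)"
    unfolding avg_fmode by (intro sum.cong refl) auto
  also have "\<dots> = (\<Sum>l\<in>?L. c l * cnj (c l))" by simp
  finally have 3: "avg (\<lambda>\<xi>. P \<xi> * cnj (P \<xi>)) = (\<Sum>l\<in>?L. c l * cnj (c l))" .
  have "avg (\<lambda>\<xi>. (cmod (of_real (a \<xi>) - P \<xi>))^2)
     = avg (\<lambda>\<xi>. (a \<xi>)^2) - 2 * Re (avg (\<lambda>\<xi>. of_real (a \<xi>) * cnj (P \<xi>))) + Re (avg (\<lambda>\<xi>. P \<xi> * cnj (P \<xi>)))"
    unfolding 1 using a bP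
    by (simp add: avg_add avg_diff avg_mult_left bdd_borel_intros avg_Re[symmetric])
  also have "\<dots> = avg (\<lambda>\<xi>. (a \<xi>)^2) + (\<Sum>l\<in>?L. (cmod (c l - fourier a (- l)))^2 - (cmod (fourier a (- l)))^2)"
  proof -
    have "(cmod (z - w))^2 - (cmod w)^2 = Re (z * cnj z) - 2 * Re (cnj z * w)" for z w
      unfolding cmod_power2 by (simp add: power2_eq_square algebra_simps)
    then show ?thesis unfolding 2 3 by (simp add: Re_sum sum_subtractf sum_distrib_left)
  qed
  finally have 4: "avg (\<lambda>\<xi>. (cmod (of_real (a \<xi>) - P \<xi>))^2) = avg (\<lambda>\<xi>. (a \<xi>)^2)
      + (\<Sum>l\<in>?L. (cmod (c l - fourier a (- l)))^2 - (cmod (fourier a (- l)))^2)" .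
  have "(\<Sum>l\<in>?L. - ((cmod (fourier a (- l)))^2))
      \<le> (\<Sum>l\<in>?L. (cmod (c l - fourier a (- l)))^2 - (cmod (fourier a (- l)))^2)"
    by (intro sum_mono) auto
  then have "avg (\<lambda>\<xi>. (a \<xi>)^2) - avg (\<lambda>\<xi>. (cmod (of_real (a \<xi>) - P \<xi>))^2) \<le> (\<Sum>l\<in>?L. (cmod (fourier a (- l)))^2)"
    unfolding 4 by (simp add: sum_negf)
  \<comment> \<open>The index range is symmetric, so the sign convention of \<open>fourier\<close>
    disappears.\<close>
  also have "(\<Sum>l\<in>?L. (cmod (fourier a (- l)))^2) = (\<Sum>l\<in>?L. (cmod (fourier a l))^2)"
    by (rule sum.reindex_bij_witness[of _ uminus uminus]) auto
  finally show ?thesis .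
qed

text \<open>Parseval's identity for limits of uniformly bounded continuous functions of
  exp(i xi); the inequality below is the only part of it that is not Bessel's inequality.\<close>

lemma parseval_lower:
  fixes F :: "nat \<Rightarrow> complex \<Rightarrow> real"
  assumes cont: "\<And>j. continuous_on (sphere 0 1) (F j)"
    and bound: "\<And>j \<xi>. \<bar>F j (cis \<xi>)\<bar> \<le> B" and lim: "\<And>\<xi>. (\<lambda>j. F j (cis \<xi>)) \<longlonglongrightarrow> a \<xi>"
    and a: "bdd_borel a" and \<epsilon>: "\<epsilon> > 0"
  shows "\<exists>m. avg (\<lambda>\<xi>. (a \<xi>)^2) - \<epsilon> \<le> (\<Sum>l\<in>{- int m..int m}. (cmod (fourier a l))^2)"
proof -
  have bF: "bdd_borel (\<lambda>\<xi>. F j (cis \<xi>))" for j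
  proof (rule bdd_borelI[of _ B])
    have "continuous_on UNIV (\<lambda>\<xi>. F j (cis \<xi>))"
      by (rule continuous_on_compose2[OF cont]) (auto intro!: continuous_intros)
    then show "(\<lambda>\<xi>. F j (cis \<xi>)) \<in> borel_measurable borel" by (rule borel_measurable_continuous_onI)
  qed (use bound in auto)
  have abound: "\<bar>a \<xi>\<bar> \<le> B" for \<xi>
    by (rule tendsto_upperbound[OF tendsto_rabs[OF lim[of \<xi>]]]) (auto intro: always_eventually bound)
  \<comment> \<open>Dominated convergence turns the pointwise limit into convergence in mean
    square.\<close>
  have "(\<lambda>j. integral {0..2*pi} (\<lambda>\<xi>. (a \<xi> - F j (cis \<xi>))^2)) \<longlonglongrightarrow> integral {0..2*pi} (\<lambda>\<xi>. 0::real)"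
  proof (rule dominated_convergence(2)[where h="\<lambda>_. (2 * B)^2"])
    show "(\<lambda>\<xi>. (a \<xi> - F j (cis \<xi>))^2) integrable_on {0..2*pi}" for j
      by (intro bdd_borel_integrable bdd_borel_intros a bF)
    show "norm ((a \<xi> - F j (cis \<xi>))^2) \<le> (2 * B)^2" for j \<xi>
    proof -
      have "\<bar>a \<xi> - F j (cis \<xi>)\<bar> \<le> \<bar>2 * B\<bar>" using abound[of \<xi>] bound[of j \<xi>] by linarith
      then show ?thesis by (simp only: real_norm_def abs_le_square_iff abs_power2)
    qed
    show "(\<lambda>j. (a \<xi> - F j (cis \<xi>))^2) \<longlonglongrightarrow> 0" for \<xi>
    proof -
      have "(\<lambda>j. (a \<xi> - F j (cis \<xi>))^2) \<longlonglongrightarrow> (a \<xi> - a \<xi>)^2"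
        by (intro tendsto_intros lim)
      then show ?thesis by simp
    qed
  qed (auto intro: integrable_const_ivl)
  then have "(\<lambda>j. avg (\<lambda>\<xi>. (a \<xi> - F j (cis \<xi>))^2)) \<longlonglongrightarrow> 0"
    unfolding avg_def by (auto intro!: tendsto_eq_intros)
  \<comment> \<open>By (x + y)^2 <= 2 x^2 + 2 y^2, a mean square error \<epsilon>/4 here and a
    uniform error sqrt(\<epsilon>/4) in the polynomial approximation cost \<epsilon>
    together.\<close>
  then have "eventually (\<lambda>j. avg (\<lambda>\<xi>. (a \<xi> - F j (cis \<xi>))^2) < \<epsilon> / 4) sequentially"
    using \<epsilon> by (intro order_tendstoD(2)) auto
  then obtain j where j: "avg (\<lambda>\<xi>. (a \<xi> - F j (cis \<xi>))^2) < \<epsilon> / 4"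
    by (auto simp: eventually_sequentially)
  have "sqrt (\<epsilon> / 4) > 0" using \<epsilon> by simp
  then obtain p where p: "real_polynomial_function p" "\<And>z. z \<in> sphere 0 1 \<Longrightarrow> \<bar>F j z - p z\<bar> < sqrt (\<epsilon> / 4)"
    using Stone_Weierstrass_real_polynomial_function[OF compact_sphere cont] by blast
  define P where "P \<xi> = complex_of_real (p (cis \<xi>))" for \<xi>
  have "trig_poly P" unfolding P_def by (rule trig_poly_real_polynomial[OF p(1)])
  then obtain m c where P: "\<And>\<xi>. P \<xi> = (\<Sum>l\<in>{- int m..int m}. c l * fmode l \<xi>)"
    unfolding trig_poly_def by blast
  have bP: "bdd_borel P" unfolding P[abs_def] by (intro bdd_borel_intros)
  have pt: "(cmod (of_real (a \<xi>) - P \<xi>))^2 \<le> 2 * (a \<xi> - F j (cis \<xi>))^2 + \<epsilon> / 2" for \<xi>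
  proof -
    let ?x = "a \<xi> - F j (cis \<xi>)" and ?y = "F j (cis \<xi>) - p (cis \<xi>)"
    have "\<bar>?y\<bar> < sqrt (\<epsilon> / 4)" by (rule p(2)) simp
    then have "?y^2 \<le> (sqrt (\<epsilon> / 4))^2" by (intro power2_le_iff_abs_le[THEN iffD2]) (use \<epsilon> in auto)
    then have y: "?y^2 \<le> \<epsilon> / 4" using \<epsilon> by simp
    have "(cmod (of_real (a \<xi>) - P \<xi>))^2 = (?x + ?y)^2"
      unfolding P_def of_real_diff[symmetric] norm_of_real by simp
    also have "\<dots> \<le> 2 * ?x^2 + 2 * ?y^2"
      using zero_le_power2[of "?x - ?y"] by (simp add: power2_eq_square algebra_simps)
    also have "\<dots> \<le> 2 * ?x^2 + \<epsilon> / 2" using y by simp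
    finally show ?thesis .
  qed
  have "avg (\<lambda>\<xi>. (cmod (of_real (a \<xi>) - P \<xi>))^2) \<le> avg (\<lambda>\<xi>. 2 * (a \<xi> - F j (cis \<xi>))^2 + \<epsilon> / 2)"
    by (intro avg_mono bdd_borel_intros a bF bP pt)
  also have "\<dots> = 2 * avg (\<lambda>\<xi>. (a \<xi> - F j (cis \<xi>))^2) + \<epsilon> / 2"
    using a bF[of j] by (simp add: avg_add avg_mult_left avg_const bdd_borel_intros)
  also have "\<dots> \<le> \<epsilon>" using j by simp
  finally have "avg (\<lambda>\<xi>. (cmod (of_real (a \<xi>) - P \<xi>))^2) \<le> \<epsilon>" .
  then show ?thesis using best_approximation[OF a P] by (intro exI[of _ m]) linarith
qed

section \<open>The symbol\<close>

text \<open>As a function of y, \<open>ce\<close> is the tangent of h at x, and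
  \<open>ce - hent y\<close> is a relative entropy of two-point distributions. The bound ln p <= p -
  1 gives its non-negativity; applied to the inverse ratios it gives the chi-square bound (y - x)^2
  / (1 - x^2).\<close>

lemma hent_le_cross_entropy:
  fixes x y :: real
  assumes "\<bar>x\<bar> < 1" "\<bar>y\<bar> < 1"
  defines "ce \<equiv> - ((1 + y) / 2) * ln ((1 + x) / 2) - ((1 - y) / 2) * ln ((1 - x) / 2)"
  shows "hent y \<le> ce" "ce - (y - x)^2 / (1 - x^2) \<le> hent y"
proof -
  have pos: "1 + x > 0" "1 - x > 0" "1 + y > 0" "1 - y > 0" using assms by auto
  define p where "p = (1 + x) / (1 + y)"
  define q where "q = (1 - x) / (1 - y)"
  have pq: "p > 0" "q > 0" using pos by (auto simp: p_def q_def)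
  have ev_plus: "ln ((1 + x) / 2) - ln ((1 + y) / 2) = ln p" using pos by (simp add: p_def ln_div)
  have lq: "ln ((1 - x) / 2) - ln ((1 - y) / 2) = ln q" using pos by (simp add: q_def ln_div)
  have diff: "ce - hent y = - ((1 + y) / 2) * ln p - ((1 - y) / 2) * ln q"
    unfolding ce_def hent_def ev_plus[symmetric] lq[symmetric] by (simp add: algebra_simps)
  have "(1 + y) / 2 * ln p \<le> (1 + y) / 2 * (p - 1)"
    using pos pq by (intro mult_left_mono ln_le_minus_one) auto
  also have "\<dots> = (x - y) / 2" using pos by (simp add: p_def field_simps)
  finally have 1: "(1 + y) / 2 * ln p \<le> (x - y) / 2" .
  have "(1 - y) / 2 * ln q \<le> (1 - y) / 2 * (q - 1)"
    using pos pq by (intro mult_left_mono ln_le_minus_one) auto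
  also have "\<dots> = (y - x) / 2" using pos by (simp add: q_def field_simps)
  finally have 2: "(1 - y) / 2 * ln q \<le> (y - x) / 2" .
  show "hent y \<le> ce" using diff 1 2 by simp
  have "- ln p \<le> 1 / p - 1" using ln_le_minus_one[of "1 / p"] pq by (simp add: ln_div)
  then have "(1 + y) / 2 * - ln p \<le> (1 + y) / 2 * (1 / p - 1)" using pos by (intro mult_left_mono) auto
  also have "\<dots> = (1 + y) * (y - x) / (2 * (1 + x))" using pos by (simp add: p_def field_simps)
  finally have 3: "(1 + y) / 2 * - ln p \<le> (1 + y) * (y - x) / (2 * (1 + x))" .
  have "- ln q \<le> 1 / q - 1" using ln_le_minus_one[of "1 / q"] pq by (simp add: ln_div)
  then have "(1 - y) / 2 * - ln q \<le> (1 - y) / 2 * (1 / q - 1)" using pos by (intro mult_left_mono) auto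
  also have "\<dots> = (1 - y) * (x - y) / (2 * (1 - x))" using pos by (simp add: q_def field_simps)
  finally have 4: "(1 - y) / 2 * - ln q \<le> (1 - y) * (x - y) / (2 * (1 - x))" .
  have "(1 + y) * (y - x) / (2 * (1 + x)) + (1 - y) * (x - y) / (2 * (1 - x)) = (y - x)^2 / (1 - x^2)"
  proof -
    have "1 - x^2 = (1 + x) * (1 - x)" by (simp add: power2_eq_square algebra_simps)
    then show ?thesis using pos by (simp add: divide_simps power2_eq_square) (simp add: algebra_simps)
  qed
  then show "ce - (y - x)^2 / (1 - x^2) \<le> hent y" using diff 3 4 by simp
qed

lemma hent_minus: "hent (- x) = hent x"
  by (simp add: hent_def)

text \<open>With p = (1 + x)/2 and q = 1 - p, the bound ln p <= p - 1 gives h >= p q + q p = (1 -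
  x^2)/2.\<close>

lemma hent_ge: "\<bar>x\<bar> < 1 \<Longrightarrow> (1 - x^2) / 2 \<le> hent x"
proof -
  assume "\<bar>x\<bar> < 1"
  then have pos: "(1 + x) / 2 > 0" "(1 - x) / 2 > 0" by auto
  have "(1 + x) / 2 * ln ((1 + x) / 2) \<le> (1 + x) / 2 * ((1 + x) / 2 - 1)"
    using pos by (intro mult_left_mono ln_le_minus_one) auto
  moreover have "(1 - x) / 2 * ln ((1 - x) / 2) \<le> (1 - x) / 2 * ((1 - x) / 2 - 1)"
    using pos by (intro mult_left_mono ln_le_minus_one) auto
  ultimately show ?thesis unfolding hent_def by (simp add: power2_eq_square field_simps)
qed

lemma hent_le: "\<bar>x\<bar> < 1 \<Longrightarrow> hent x \<le> ln 2"
  using hent_le_cross_entropy(1)[of 0 x] by (simp add: ln_div field_simps)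

lemma hent_measurable [measurable]: "hent \<in> borel_measurable borel"
  unfolding hent_def[abs_def] by measurable

lemma bdd_borel_hent:
  assumes "bdd_borel f" "\<And>x. \<bar>f x\<bar> < 1"
  shows "bdd_borel (\<lambda>x. hent (f x))"
proof (rule bdd_borelI[of _ "ln 2"])
  have [measurable]: "f \<in> borel_measurable borel" using assms(1) by (simp add: bdd_borel_def)
  show "(\<lambda>x. hent (f x)) \<in> borel_measurable borel" by measurable
  fix x
  have "(f x)^2 \<le> 1" using assms(2)[of x] by (simp add: abs_square_le_1)
  then show "norm (hent (f x)) \<le> ln 2" using hent_le[OF assms(2)[of x]] hent_ge[OF assms(2)[of x]] by simp
qed

locale xy_params =
  fixes \<beta> \<delta> \<gamma> lam :: real
  assumes \<delta>: "0 \<le> \<delta>" "\<delta> < \<beta>" and \<gamma>: "-1 < \<gamma>" "\<gamma> < 1"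
begin

abbreviation "\<mu> \<equiv> mu \<gamma> lam"
abbreviation "\<kappa> \<equiv> kappa \<gamma> lam"

text \<open>In these terms t = - \<open>phi_sgn\<close> sigma_0 + \<open>phi_bd\<close>
  (\<open>dir2\<close> sigma_2 + \<open>dir3\<close> sigma_3), where (\<open>dir2\<close>,
  \<open>dir3\<close>) is a unit vector, except that division by zero makes it 0 where
  \<open>mu\<close> vanishes.\<close>

definition phi_bd :: "real \<Rightarrow> real" where "phi_bd \<xi> = phi \<gamma> lam \<beta> \<delta> \<xi>"
definition phi_db :: "real \<Rightarrow> real" where "phi_db \<xi> = phi \<gamma> lam \<delta> \<beta> \<xi>"
definition phi_sgn :: "real \<Rightarrow> real" where "phi_sgn \<xi> = phi_db \<xi> * sgn (\<kappa> \<xi>)"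
definition dir2 :: "real \<Rightarrow> real" where "dir2 \<xi> = \<gamma> * sin \<xi> / \<mu> \<xi>"
definition dir3 :: "real \<Rightarrow> real" where "dir3 \<xi> = - (cos \<xi> - lam) / \<mu> \<xi>"

lemma mu_nonneg: "\<mu> \<xi> \<ge> 0"
  by (simp add: mu_def)

lemma mu_bound: "\<mu> \<xi> \<le> 2 + \<bar>lam\<bar>"
proof -
  have "\<gamma>^2 * (sin \<xi>)^2 \<le> 1 * 1"
    using \<gamma> by (intro mult_mono) (auto simp: abs_square_le_1 abs_le_iff)
  moreover have "\<bar>cos \<xi> - lam\<bar> \<le> 1 + \<bar>lam\<bar>"
    using cos_le_one[of \<xi>] cos_ge_minus_one[of \<xi>] by linarith
  then have "(cos \<xi> - lam)^2 \<le> (1 + \<bar>lam\<bar>)^2"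
    by (intro power2_le_iff_abs_le[THEN iffD2]) auto
  ultimately have "(cos \<xi> - lam)^2 + \<gamma>^2 * (sin \<xi>)^2 \<le> (2 + \<bar>lam\<bar>)^2"
    by (simp add: power2_eq_square algebra_simps)
  then show ?thesis unfolding mu_def by (intro real_le_lsqrt) auto
qed

text \<open>In terms of half sum and half difference, the denominator factorises and one cosh
  cancels. For \<beta> and \<delta> the results are tanh of half of \<beta>_R \<mu> and of half of
  \<beta>_L \<mu>, the thermal values of the two reservoirs.\<close>

lemma phi_sum: "phi \<gamma> lam a b \<xi> + phi \<gamma> lam b a \<xi> = tanh ((a + b) * \<mu> \<xi> / 2)"
  and phi_diff: "phi \<gamma> lam a b \<xi> - phi \<gamma> lam b a \<xi> = tanh ((a - b) * \<mu> \<xi> / 2)"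
proof -
  let ?s = "(a + b) * \<mu> \<xi> / 2" and ?d = "(a - b) * \<mu> \<xi> / 2"
  have a: "a * \<mu> \<xi> = ?s + ?d" and b: "b * \<mu> \<xi> = ?s - ?d" by (simp_all add: field_simps)
  have c: "cosh (a * \<mu> \<xi>) + cosh (b * \<mu> \<xi>) = 2 * (cosh ?s * cosh ?d)"
    unfolding a b by (simp add: cosh_add cosh_diff)
  have c': "cosh (b * \<mu> \<xi>) + cosh (a * \<mu> \<xi>) = 2 * (cosh ?s * cosh ?d)" using c by simp
  have nz: "cosh ?s \<noteq> 0" "cosh ?d \<noteq> 0" by (auto simp: cosh_real_pos less_imp_neq[symmetric])
  have "sinh (a * \<mu> \<xi>) + sinh (b * \<mu> \<xi>) = 2 * (sinh ?s * cosh ?d)"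
    unfolding a b by (simp add: sinh_add sinh_diff)
  then have "phi \<gamma> lam a b \<xi> + phi \<gamma> lam b a \<xi> = 2 * (sinh ?s * cosh ?d) / (2 * (cosh ?s * cosh ?d))"
    unfolding phi_def c c' by (simp only: add_divide_distrib[symmetric])
  then show "phi \<gamma> lam a b \<xi> + phi \<gamma> lam b a \<xi> = tanh ?s" using nz by (simp add: tanh_def)
  have "sinh (a * \<mu> \<xi>) - sinh (b * \<mu> \<xi>) = 2 * (cosh ?s * sinh ?d)"
    unfolding a b by (simp add: sinh_add sinh_diff)
  then have "phi \<gamma> lam a b \<xi> - phi \<gamma> lam b a \<xi> = 2 * (cosh ?s * sinh ?d) / (2 * (cosh ?s * cosh ?d))"
    unfolding phi_def c c' by (simp only: diff_divide_distrib[symmetric])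
  then show "phi \<gamma> lam a b \<xi> - phi \<gamma> lam b a \<xi> = tanh ?d" using nz by (simp add: tanh_def)
qed

text \<open>Both \<beta> + \<delta> and \<beta> - \<delta> are at most 2 \<beta>, and \<mu> is at
  most 2 + |lam|; tanh is monotone. A common bound below 1 keeps the eigenvalues of t away from the
  points where h has infinite slope.\<close>

definition r_max :: real where "r_max = tanh (\<beta> * (2 + \<bar>lam\<bar>))"

lemma r_max: "0 < r_max" "r_max < 1"
proof -
  have "\<beta> * (2 + \<bar>lam\<bar>) > 0" using \<delta> by (intro mult_pos_pos) auto
  then show "0 < r_max" by (simp add: r_max_def)
  show "r_max < 1" using tanh_real_bounds[of "\<beta> * (2 + \<bar>lam\<bar>)"] by (simp add: r_max_def)
qed

lemma phi_bd_db_bound: "\<bar>phi_bd \<xi> + phi_db \<xi>\<bar> \<le> r_max" "\<bar>phi_bd \<xi> - phi_db \<xi>\<bar> \<le> r_max"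
proof -
  have *: "\<bar>tanh (c * \<mu> \<xi> / 2)\<bar> \<le> r_max" if "0 \<le> c" "c \<le> 2 * \<beta>" for c
  proof -
    have "c * \<mu> \<xi> \<le> (2 * \<beta>) * (2 + \<bar>lam\<bar>)"
      using that mu_bound mu_nonneg by (intro mult_mono) auto
    then have "tanh (c * \<mu> \<xi> / 2) \<le> r_max" unfolding r_max_def by simp
    moreover have "tanh (c * \<mu> \<xi> / 2) \<ge> 0" using that mu_nonneg by simp
    ultimately show ?thesis by simp
  qed
  show "\<bar>phi_bd \<xi> + phi_db \<xi>\<bar> \<le> r_max" unfolding phi_bd_def phi_db_def phi_sum using \<delta> by (intro *) auto
  show "\<bar>phi_bd \<xi> - phi_db \<xi>\<bar> \<le> r_max" unfolding phi_bd_def phi_db_def phi_diff using \<delta> by (intro *) auto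
qed

lemma phi_bd_sgn_bound: "\<bar>phi_bd \<xi> + phi_sgn \<xi>\<bar> \<le> r_max" "\<bar>phi_bd \<xi> - phi_sgn \<xi>\<bar> \<le> r_max"
proof -
  have "\<bar>phi_bd \<xi>\<bar> \<le> r_max" using phi_bd_db_bound[of \<xi>] by linarith
  then show "\<bar>phi_bd \<xi> + phi_sgn \<xi>\<bar> \<le> r_max" "\<bar>phi_bd \<xi> - phi_sgn \<xi>\<bar> \<le> r_max"
    using phi_bd_db_bound[of \<xi>] by (auto simp: phi_sgn_def sgn_if)
qed

lemma dir_norm: "(dir2 \<xi>)^2 + (dir3 \<xi>)^2 = (if \<mu> \<xi> = 0 then 0 else 1)"
proof -
  have "(\<gamma> * sin \<xi>)^2 + (- (cos \<xi> - lam))^2 = (\<mu> \<xi>)^2"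
    by (simp add: mu_def power_mult_distrib power2_commute)
  then show ?thesis by (simp add: dir2_def dir3_def power_divide add_divide_distrib[symmetric])
qed

text \<open>Where \<open>mu\<close> is 0 the direction is not a unit vector, but there
  \<open>phi_bd\<close> contains sinh 0 = 0.\<close>

lemma phi_bd_dir_norm: "(phi_bd \<xi>)^2 * ((dir2 \<xi>)^2 + (dir3 \<xi>)^2) = (phi_bd \<xi>)^2"
  by (simp add: dir_norm phi_bd_def phi_def)

lemma symbol_components: "2 * s0 \<beta> \<delta> \<gamma> lam \<xi> - 1 = - phi_sgn \<xi>"
  "2 * s3 \<beta> \<delta> \<gamma> lam \<xi> = phi_bd \<xi> * dir3 \<xi>" "2 * s2 \<beta> \<delta> \<gamma> lam \<xi> = phi_bd \<xi> * dir2 \<xi>"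
proof -
  show "2 * s0 \<beta> \<delta> \<gamma> lam \<xi> - 1 = - phi_sgn \<xi>" by (simp add: s0_def phi_sgn_def phi_db_def)
  have "2 * (- 1 / 2 * phi_bd \<xi> * (cos \<xi> - lam)) = phi_bd \<xi> * - (cos \<xi> - lam)" by (simp add: field_simps)
  then show "2 * s3 \<beta> \<delta> \<gamma> lam \<xi> = phi_bd \<xi> * dir3 \<xi>"
    unfolding s3_def dir3_def phi_bd_def[symmetric] times_divide_eq_right by (rule arg_cong)
  have "2 * (1 / 2 * phi_bd \<xi> * \<gamma> * sin \<xi>) = phi_bd \<xi> * (\<gamma> * sin \<xi>)" by simp
  then show "2 * s2 \<beta> \<delta> \<gamma> lam \<xi> = phi_bd \<xi> * dir2 \<xi>"
    unfolding s2_def dir2_def phi_bd_def[symmetric] times_divide_eq_right by (rule arg_cong)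
qed

lemma cont_mu: "continuous_on UNIV \<mu>"
  unfolding mu_def[abs_def] by (intro continuous_intros)

lemma cont_phi: "continuous_on UNIV (phi \<gamma> lam a b)"
proof -
  have "cosh (a * \<mu> \<xi>) + cosh (b * \<mu> \<xi>) \<noteq> 0" for \<xi>
    using cosh_real_pos[of "a * \<mu> \<xi>"] cosh_real_pos[of "b * \<mu> \<xi>"] by linarith
  then show ?thesis unfolding phi_def[abs_def]
    by (intro continuous_intros cont_mu) auto
qed

lemma measurable_parts [measurable]:
  "\<mu> \<in> borel_measurable borel" "\<kappa> \<in> borel_measurable borel" "phi \<gamma> lam a b \<in> borel_measurable borel"
  by (auto intro!: borel_measurable_continuous_onI cont_mu cont_phi continuous_intros simp: kappa_def[abs_def])

lemma phi_le_one: "\<bar>phi_bd \<xi>\<bar> \<le> 1" "\<bar>phi_db \<xi>\<bar> \<le> 1" "\<bar>phi_sgn \<xi>\<bar> \<le> 1"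
  using phi_bd_db_bound[of \<xi>] phi_bd_sgn_bound[of \<xi>] r_max by linarith+

lemma dir_le: "\<bar>dir2 \<xi>\<bar> \<le> 1" "\<bar>dir3 \<xi>\<bar> \<le> 1"
proof -
  have "(dir2 \<xi>)^2 + (dir3 \<xi>)^2 \<le> 1" by (simp add: dir_norm)
  then have "(dir2 \<xi>)^2 \<le> 1" "(dir3 \<xi>)^2 \<le> 1"
    using zero_le_power2[of "dir2 \<xi>"] zero_le_power2[of "dir3 \<xi>"] by linarith+
  then show "\<bar>dir2 \<xi>\<bar> \<le> 1" "\<bar>dir3 \<xi>\<bar> \<le> 1" by (simp_all add: abs_square_le_1)
qed

lemma bdd_borel_parts [bdd_borel_intros]:
  "bdd_borel phi_bd" "bdd_borel phi_db" "bdd_borel phi_sgn" "bdd_borel dir2" "bdd_borel dir3"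
proof -
  show "bdd_borel phi_bd" by (rule bdd_borelI[of _ 1]) (use phi_le_one in \<open>auto simp: phi_bd_def[abs_def]\<close>)
  show "bdd_borel phi_db" by (rule bdd_borelI[of _ 1]) (use phi_le_one in \<open>auto simp: phi_db_def[abs_def]\<close>)
  have "phi_sgn \<in> borel_measurable borel" unfolding phi_sgn_def[abs_def] phi_db_def[abs_def] by measurable
  then show "bdd_borel phi_sgn" by (rule bdd_borelI[of _ 1]) (use phi_le_one in auto)
  have "dir2 \<in> borel_measurable borel" unfolding dir2_def[abs_def] by measurable
  then show "bdd_borel dir2" by (rule bdd_borelI[of _ 1]) (use dir_le in auto)
  have "dir3 \<in> borel_measurable borel" unfolding dir3_def[abs_def] by measurable
  then show "bdd_borel dir3" by (rule bdd_borelI[of _ 1]) (use dir_le in auto)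
qed

section \<open>Continuous approximations of the symbol on the unit circle\<close>

definition muz :: "complex \<Rightarrow> real" where
  "muz z = sqrt ((Re z - lam)^2 + \<gamma>^2 * (Im z)^2)"

definition kappaz :: "complex \<Rightarrow> real" where
  "kappaz z = 2 * lam * Im z - (1 - \<gamma>^2) * (2 * Im z * Re z)"

definition phiz :: "real \<Rightarrow> real \<Rightarrow> complex \<Rightarrow> real" where
  "phiz a b z = sinh (a * muz z) / (cosh (a * muz z) + cosh (b * muz z))"

lemma muz_cis: "muz (cis \<xi>) = \<mu> \<xi>"
  by (simp add: muz_def mu_def)

lemma kappaz_cis: "kappaz (cis \<xi>) = \<kappa> \<xi>"
  by (simp add: kappaz_def kappa_def sin_double)

lemma phiz_cis: "phiz a b (cis \<xi>) = phi \<gamma> lam a b \<xi>"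
  by (simp add: phiz_def phi_def muz_cis)

lemma cont_muz: "continuous_on S muz"
  unfolding muz_def[abs_def] by (intro continuous_intros)

lemma cont_kappaz: "continuous_on S kappaz"
  unfolding kappaz_def[abs_def] by (intro continuous_intros)

lemma cont_phiz: "continuous_on S (phiz a b)"
proof -
  have "cosh (a * muz z) + cosh (b * muz z) \<noteq> 0" for z
    using cosh_real_pos[of "a * muz z"] cosh_real_pos[of "b * muz z"] by linarith
  then show ?thesis unfolding phiz_def[abs_def]
    by (intro continuous_intros cont_muz) auto
qed

lemma muz_nonneg: "muz z \<ge> 0"
  by (simp add: muz_def)

definition inv_step :: "nat \<Rightarrow> real" where "inv_step j = inverse (real (Suc j))"

lemma inv_step: "inv_step j > 0" "inv_step \<longlonglongrightarrow> 0"
proof -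
  show "inv_step \<longlonglongrightarrow> 0" unfolding inv_step_def[abs_def] by (rule LIMSEQ_inverse_real_of_nat)
qed (simp add: inv_step_def)

text \<open>For c = 0 every term is 0, in agreement with the default value of y / 0; so the limit
  holds also at zeros of the denominator.\<close>

lemma quotient_limit: "c \<ge> 0 \<Longrightarrow> (c = 0 \<Longrightarrow> y = 0) \<Longrightarrow> (\<lambda>j. y / (c + inv_step j)) \<longlonglongrightarrow> y / c"
proof (cases "c = 0")
  case False
  assume "c \<ge> 0"
  have "(\<lambda>j. y / (c + inv_step j)) \<longlonglongrightarrow> y / (c + 0)"
    by (intro tendsto_intros inv_step) (use False in auto)
  then show ?thesis by simp
qed simp

text \<open>Regularised symbols: the sign of kappa and the division by mu are replaced by continuous
  functions of exp(i xi) that converge pointwise, also at the zeros of kappa and mu.\<close>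

definition sgn_reg :: "nat \<Rightarrow> complex \<Rightarrow> real" where
  "sgn_reg j z = phiz \<delta> \<beta> z * (kappaz z / (\<bar>kappaz z\<bar> + inv_step j))"

definition quot_reg :: "(complex \<Rightarrow> real) \<Rightarrow> nat \<Rightarrow> complex \<Rightarrow> real" where
  "quot_reg h j z = phiz \<beta> \<delta> z * (h z / (muz z + inv_step j))"

lemma sgn_reg: "continuous_on S (sgn_reg j)" "\<bar>sgn_reg j (cis \<xi>)\<bar> \<le> 1" "(\<lambda>j. sgn_reg j (cis \<xi>)) \<longlonglongrightarrow> phi_sgn \<xi>"
proof -
  have "\<bar>kappaz z\<bar> + inv_step j \<noteq> 0" for z using inv_step(1)[of j] by (smt (verit) abs_ge_zero)
  then show "continuous_on S (sgn_reg j)" unfolding sgn_reg_def[abs_def]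
    by (intro continuous_intros cont_phiz cont_kappaz) auto
  have "\<bar>\<kappa> \<xi>\<bar> + inv_step j > 0" using inv_step(1)[of j] by (simp add: add_nonneg_pos)
  then have "\<bar>\<kappa> \<xi> / (\<bar>\<kappa> \<xi>\<bar> + inv_step j)\<bar> \<le> 1" using inv_step(1)[of j] by (simp add: abs_divide)
  then have "\<bar>phi_db \<xi> * (\<kappa> \<xi> / (\<bar>\<kappa> \<xi>\<bar> + inv_step j))\<bar> \<le> 1"
    unfolding abs_mult using phi_le_one(2)[of \<xi>] by (intro mult_le_one) auto
  then show "\<bar>sgn_reg j (cis \<xi>)\<bar> \<le> 1" by (simp add: sgn_reg_def phiz_cis kappaz_cis phi_db_def)
  have "(\<lambda>j. \<kappa> \<xi> / (\<bar>\<kappa> \<xi>\<bar> + inv_step j)) \<longlonglongrightarrow> \<kappa> \<xi> / \<bar>\<kappa> \<xi>\<bar>" by (rule quotient_limit) auto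
  moreover have "\<kappa> \<xi> / \<bar>\<kappa> \<xi>\<bar> = sgn (\<kappa> \<xi>)" by (simp add: sgn_if)
  ultimately show "(\<lambda>j. sgn_reg j (cis \<xi>)) \<longlonglongrightarrow> phi_sgn \<xi>"
    unfolding sgn_reg_def phi_sgn_def phi_db_def phiz_cis kappaz_cis by (intro tendsto_intros) auto
qed

lemma quot_reg:
  assumes h: "continuous_on UNIV h" "\<And>\<xi>. \<bar>h (cis \<xi>)\<bar> \<le> \<mu> \<xi>"
  shows "continuous_on S (quot_reg h j)" "\<bar>quot_reg h j (cis \<xi>)\<bar> \<le> 1"
    "(\<lambda>j. quot_reg h j (cis \<xi>)) \<longlonglongrightarrow> phi_bd \<xi> * (h (cis \<xi>) / \<mu> \<xi>)"
proof -
  have "muz z + inv_step j \<noteq> 0" for z using inv_step(1)[of j] muz_nonneg[of z] by linarith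
  then show "continuous_on S (quot_reg h j)" unfolding quot_reg_def[abs_def]
    by (intro continuous_intros cont_phiz cont_muz continuous_on_subset[OF h(1)]) auto
  have "\<bar>h (cis \<xi>) / (\<mu> \<xi> + inv_step j)\<bar> \<le> 1"
    using inv_step(1)[of j] h(2)[of \<xi>] mu_nonneg[of \<xi>] by (simp add: abs_divide divide_le_eq_1)
  then have "\<bar>phi_bd \<xi> * (h (cis \<xi>) / (\<mu> \<xi> + inv_step j))\<bar> \<le> 1"
    unfolding abs_mult using phi_le_one(1)[of \<xi>] by (intro mult_le_one) auto
  then show "\<bar>quot_reg h j (cis \<xi>)\<bar> \<le> 1" by (simp add: quot_reg_def phiz_cis muz_cis phi_bd_def)
  have "(\<lambda>j. h (cis \<xi>) / (\<mu> \<xi> + inv_step j)) \<longlonglongrightarrow> h (cis \<xi>) / \<mu> \<xi>"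
    by (rule quotient_limit) (use h(2)[of \<xi>] mu_nonneg in auto)
  then show "(\<lambda>j. quot_reg h j (cis \<xi>)) \<longlonglongrightarrow> phi_bd \<xi> * (h (cis \<xi>) / \<mu> \<xi>)"
    unfolding quot_reg_def phi_bd_def phiz_cis muz_cis by (rule tendsto_mult_left)
qed

lemma numerator_le_mu: "\<bar>\<gamma> * sin \<xi>\<bar> \<le> \<mu> \<xi>" "\<bar>cos \<xi> - lam\<bar> \<le> \<mu> \<xi>"
proof -
  have "\<bar>\<gamma> * sin \<xi>\<bar> = sqrt ((\<gamma> * sin \<xi>)^2)" by simp
  also have "\<dots> \<le> \<mu> \<xi>" unfolding mu_def by (intro real_sqrt_le_mono) (simp add: power_mult_distrib)
  finally show "\<bar>\<gamma> * sin \<xi>\<bar> \<le> \<mu> \<xi>" .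
  have "\<bar>cos \<xi> - lam\<bar> = sqrt ((cos \<xi> - lam)^2)" by simp
  also have "\<dots> \<le> \<mu> \<xi>" unfolding mu_def by (intro real_sqrt_le_mono) simp
  finally show "\<bar>cos \<xi> - lam\<bar> \<le> \<mu> \<xi>" .
qed

text \<open>The entries of t, with the factors -i and i removed off the diagonal so that all of them
  are real.\<close>

definition sym_pp :: "real \<Rightarrow> real" where "sym_pp \<xi> = - phi_sgn \<xi> + phi_bd \<xi> * dir3 \<xi>"
definition sym_mm :: "real \<Rightarrow> real" where "sym_mm \<xi> = - phi_sgn \<xi> - phi_bd \<xi> * dir3 \<xi>"
definition sym_pm :: "real \<Rightarrow> real" where "sym_pm \<xi> = phi_bd \<xi> * dir2 \<xi>"

lemma bdd_borel_sym [bdd_borel_intros]: "bdd_borel sym_pp" "bdd_borel sym_mm" "bdd_borel sym_pm"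
  unfolding sym_pp_def[abs_def] sym_mm_def[abs_def] sym_pm_def[abs_def] by (intro bdd_borel_intros)+

lemma parseval_sym:
  assumes "\<epsilon> > 0"
  shows "\<exists>m. avg (\<lambda>\<xi>. (sym_pp \<xi>)^2) - \<epsilon> \<le> (\<Sum>l\<in>{- int m..int m}. (cmod (fourier sym_pp l))^2)"
    "\<exists>m. avg (\<lambda>\<xi>. (sym_mm \<xi>)^2) - \<epsilon> \<le> (\<Sum>l\<in>{- int m..int m}. (cmod (fourier sym_mm l))^2)"
    "\<exists>m. avg (\<lambda>\<xi>. (sym_pm \<xi>)^2) - \<epsilon> \<le> (\<Sum>l\<in>{- int m..int m}. (cmod (fourier sym_pm l))^2)"
proof -
  \<comment> \<open>The numerators of \<open>dir3\<close> and \<open>dir2\<close>, as functions on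
    the circle; both are bounded by \<mu>, as \<open>quot_reg\<close> requires.\<close>
  let ?h3 = "\<lambda>z. lam - Re z" and ?h2 = "\<lambda>z. \<gamma> * Im z"
  have "continuous_on UNIV ?h3" by (intro continuous_intros)
  moreover have "\<bar>?h3 (cis \<xi>)\<bar> \<le> \<mu> \<xi>" for \<xi>
    using numerator_le_mu(2)[of \<xi>] by (metis abs_minus_commute cis.sel(1))
  ultimately have h3: "continuous_on UNIV ?h3" "\<And>\<xi>. \<bar>?h3 (cis \<xi>)\<bar> \<le> \<mu> \<xi>" by blast+
  have h2: "continuous_on UNIV ?h2" "\<And>\<xi>. \<bar>?h2 (cis \<xi>)\<bar> \<le> \<mu> \<xi>"
    using numerator_le_mu(1) by (auto intro!: continuous_intros)
  have R3: "phi_bd \<xi> * (?h3 (cis \<xi>) / \<mu> \<xi>) = phi_bd \<xi> * dir3 \<xi>" for \<xi> by (simp add: dir3_def)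
  have R2: "phi_bd \<xi> * (?h2 (cis \<xi>) / \<mu> \<xi>) = phi_bd \<xi> * dir2 \<xi>" for \<xi> by (simp add: dir2_def)
  show "\<exists>m. avg (\<lambda>\<xi>. (sym_pp \<xi>)^2) - \<epsilon> \<le> (\<Sum>l\<in>{- int m..int m}. (cmod (fourier sym_pp l))^2)"
  proof (rule parseval_lower[where F="\<lambda>j z. - sgn_reg j z + quot_reg ?h3 j z" and B=2])
    show "\<bar>- sgn_reg j (cis \<xi>) + quot_reg ?h3 j (cis \<xi>)\<bar> \<le> 2" for j \<xi>
      using sgn_reg(2)[of j \<xi>] quot_reg(2)[OF h3, of j \<xi>] by linarith
    show "(\<lambda>j. - sgn_reg j (cis \<xi>) + quot_reg ?h3 j (cis \<xi>)) \<longlonglongrightarrow> sym_pp \<xi>" for \<xi>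
      unfolding sym_pp_def R3[symmetric] by (intro tendsto_intros sgn_reg quot_reg h3)
  qed (auto intro!: continuous_intros sgn_reg quot_reg h3 assms bdd_borel_intros)
  show "\<exists>m. avg (\<lambda>\<xi>. (sym_mm \<xi>)^2) - \<epsilon> \<le> (\<Sum>l\<in>{- int m..int m}. (cmod (fourier sym_mm l))^2)"
  proof (rule parseval_lower[where F="\<lambda>j z. - sgn_reg j z - quot_reg ?h3 j z" and B=2])
    show "\<bar>- sgn_reg j (cis \<xi>) - quot_reg ?h3 j (cis \<xi>)\<bar> \<le> 2" for j \<xi>
      using sgn_reg(2)[of j \<xi>] quot_reg(2)[OF h3, of j \<xi>] by linarith
    show "(\<lambda>j. - sgn_reg j (cis \<xi>) - quot_reg ?h3 j (cis \<xi>)) \<longlonglongrightarrow> sym_mm \<xi>" for \<xi>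
      unfolding sym_mm_def R3[symmetric] by (intro tendsto_intros sgn_reg quot_reg h3)
  qed (auto intro!: continuous_intros sgn_reg quot_reg h3 assms bdd_borel_intros)
  show "\<exists>m. avg (\<lambda>\<xi>. (sym_pm \<xi>)^2) - \<epsilon> \<le> (\<Sum>l\<in>{- int m..int m}. (cmod (fourier sym_pm l))^2)"
  proof (rule parseval_lower[where F="\<lambda>j z. quot_reg ?h2 j z" and B=1])
    show "(\<lambda>j. quot_reg ?h2 j (cis \<xi>)) \<longlonglongrightarrow> sym_pm \<xi>" for \<xi>
      unfolding sym_pm_def R2[symmetric] by (intro quot_reg h2)
  qed (auto intro!: quot_reg h2 assms bdd_borel_intros)
qed

text \<open>tr t^2 computed once from the entries and once from the eigenvalues -
  \<open>phi_sgn\<close> \<plusminus> \<open>phi_bd\<close>.\<close>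

lemma sym_squares: "(sym_pp \<xi>)^2 + (sym_mm \<xi>)^2 + 2 * (sym_pm \<xi>)^2 = 2 * (phi_sgn \<xi>)^2 + 2 * (phi_bd \<xi>)^2"
proof -
  have "(sym_pp \<xi>)^2 + (sym_mm \<xi>)^2 + 2 * (sym_pm \<xi>)^2
      = 2 * (phi_sgn \<xi>)^2 + 2 * ((phi_bd \<xi>)^2 * ((dir2 \<xi>)^2 + (dir3 \<xi>)^2))"
    by (simp add: sym_pp_def sym_mm_def sym_pm_def power2_eq_square algebra_simps)
  then show ?thesis unfolding phi_bd_dir_norm .
qed

end

section \<open>Asymptotics of the entropy\<close>

text \<open>\<open>wp\<close> and \<open>wm\<close> are the densities of a probability measure on
  two copies of the circle, on which the values \<open>ev_plus\<close> and \<open>ev_minus\<close>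
  have mean x. Integrating the tangent bound at x gives the upper estimate; integrating the
  quadratic lower bound leaves the variance.\<close>

lemma jensen_hent:
  fixes wp wm ev_plus ev_minus :: "real \<Rightarrow> real" and r x :: real
  assumes bdd: "bdd_borel wp" "bdd_borel wm" "bdd_borel ev_plus" "bdd_borel ev_minus"
    and w: "\<And>\<xi>. wp \<xi> \<ge> 0" "\<And>\<xi>. wm \<xi> \<ge> 0"
    and l: "\<And>\<xi>. \<bar>ev_plus \<xi>\<bar> \<le> r" "\<And>\<xi>. \<bar>ev_minus \<xi>\<bar> \<le> r" and r: "r < 1"
    and mass: "avg (\<lambda>\<xi>. wp \<xi> + wm \<xi>) = 1"
    and mean: "avg (\<lambda>\<xi>. wp \<xi> * ev_plus \<xi> + wm \<xi> * ev_minus \<xi>) = x"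
  shows "\<bar>x\<bar> \<le> r"
    and "avg (\<lambda>\<xi>. wp \<xi> * hent (ev_plus \<xi>) + wm \<xi> * hent (ev_minus \<xi>)) \<le> hent x"
    and "hent x \<le> avg (\<lambda>\<xi>. wp \<xi> * hent (ev_plus \<xi>) + wm \<xi> * hent (ev_minus \<xi>))
        + (avg (\<lambda>\<xi>. wp \<xi> * (ev_plus \<xi>)^2 + wm \<xi> * (ev_minus \<xi>)^2) - x^2) / (1 - r^2)"
proof -
  have r0: "0 \<le> r" using l(1)[of 0] by linarith
  have lt: "\<bar>ev_plus \<xi>\<bar> < 1" "\<bar>ev_minus \<xi>\<bar> < 1" for \<xi> using l[of \<xi>] r by linarith+
  have bh: "bdd_borel (\<lambda>\<xi>. hent (ev_plus \<xi>))" "bdd_borel (\<lambda>\<xi>. hent (ev_minus \<xi>))"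
    using bdd lt by (auto intro: bdd_borel_hent)
  note intros = bdd_borel_intros bdd bh
  have ub: "x \<le> r"
  proof -
    have "x \<le> avg (\<lambda>\<xi>. r * (wp \<xi> + wm \<xi>))" unfolding mean[symmetric]
    proof (intro avg_mono intros)
      fix \<xi>
      have "wp \<xi> * ev_plus \<xi> \<le> wp \<xi> * r" "wm \<xi> * ev_minus \<xi> \<le> wm \<xi> * r"
        using l[of \<xi>] w[of \<xi>] by (auto intro!: mult_left_mono)
      then show "wp \<xi> * ev_plus \<xi> + wm \<xi> * ev_minus \<xi> \<le> r * (wp \<xi> + wm \<xi>)" by (simp add: algebra_simps)
    qed
    also have "\<dots> = r" by (simp add: avg_mult_left intros mass)
    finally show ?thesis .
  qed
  have lb: "- r \<le> x"
  proof -
    have "- r = avg (\<lambda>\<xi>. (- r) * (wp \<xi> + wm \<xi>))" by (subst avg_mult_left) (simp_all add: intros mass)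
    also have "\<dots> \<le> x" unfolding mean[symmetric]
    proof (intro avg_mono intros)
      fix \<xi>
      have "- r \<le> ev_plus \<xi>" "- r \<le> ev_minus \<xi>" using l[of \<xi>] by linarith+
      from mult_left_mono[OF this(1) w(1)[of \<xi>]] mult_left_mono[OF this(2) w(2)[of \<xi>]]
      have "wp \<xi> * (- r) \<le> wp \<xi> * ev_plus \<xi>" "wm \<xi> * (- r) \<le> wm \<xi> * ev_minus \<xi>" .
      then show "(- r) * (wp \<xi> + wm \<xi>) \<le> wp \<xi> * ev_plus \<xi> + wm \<xi> * ev_minus \<xi>" by (simp add: algebra_simps)
    qed
    finally show ?thesis .
  qed
  show xr: "\<bar>x\<bar> \<le> r" using lb ub by (simp add: abs_le_iff)
  then have x1: "\<bar>x\<bar> < 1" using r by linarith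
  \<comment> \<open>The tangent of h at x is A + B y, the cross entropy sorted by powers of
    y.\<close>
  define A where "A = - (ln ((1 + x) / 2) + ln ((1 - x) / 2)) / 2"
  define B where "B = (ln ((1 - x) / 2) - ln ((1 + x) / 2)) / 2"
  have ce: "- ((1 + y) / 2) * ln ((1 + x) / 2) - ((1 - y) / 2) * ln ((1 - x) / 2) = A + B * y" for y
    by (simp add: A_def B_def field_simps)
  have hx: "hent x = A + B * x" unfolding ce[symmetric] hent_def ..
  have "avg (\<lambda>\<xi>. wp \<xi> * hent (ev_plus \<xi>) + wm \<xi> * hent (ev_minus \<xi>))
      \<le> avg (\<lambda>\<xi>. A * (wp \<xi> + wm \<xi>) + B * (wp \<xi> * ev_plus \<xi> + wm \<xi> * ev_minus \<xi>))"
  proof (intro avg_mono intros)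
    fix \<xi>
    have "wp \<xi> * hent (ev_plus \<xi>) \<le> wp \<xi> * (A + B * ev_plus \<xi>)" "wm \<xi> * hent (ev_minus \<xi>) \<le> wm \<xi> * (A + B * ev_minus \<xi>)"
      using hent_le_cross_entropy(1)[OF x1 lt(1)[of \<xi>]] hent_le_cross_entropy(1)[OF x1 lt(2)[of \<xi>]] w[of \<xi>]
      unfolding ce by (auto intro!: mult_left_mono)
    then show "wp \<xi> * hent (ev_plus \<xi>) + wm \<xi> * hent (ev_minus \<xi>)
        \<le> A * (wp \<xi> + wm \<xi>) + B * (wp \<xi> * ev_plus \<xi> + wm \<xi> * ev_minus \<xi>)"
      by (simp add: algebra_simps)
  qed
  also have "\<dots> = hent x" by (simp add: avg_add avg_mult_left intros mass mean hx)
  finally show "avg (\<lambda>\<xi>. wp \<xi> * hent (ev_plus \<xi>) + wm \<xi> * hent (ev_minus \<xi>)) \<le> hent x" .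
  define M where "M = 1 / (1 - r^2)"
  have r_sq: "r^2 < 1" using r r0 by (simp add: abs_square_less_1)
  have M: "M > 0" using r_sq by (simp add: M_def)
  have quad: "A + B * y - M * (y - x)^2 \<le> hent y" if "\<bar>y\<bar> < 1" for y
  proof -
    \<comment> \<open>The mean stays in [-r, r], so the constant belonging to x is replaced by one
      independent of the eigenvector.\<close>
    have "x^2 \<le> r^2" using xr r0 by (simp add: abs_le_square_iff[symmetric])
    then have "(y - x)^2 / (1 - x^2) \<le> (y - x)^2 / (1 - r^2)"
      using r_sq by (intro divide_left_mono) auto
    then show ?thesis using hent_le_cross_entropy(2)[OF x1 that] unfolding ce M_def by simp
  qed
  \<comment> \<open>The lower bound is expanded in powers of \<open>ev_plus\<close> and
    \<open>ev_minus\<close>, so that only total mass, mean and second moment occur.\<close>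
  have "hent x - M * (avg (\<lambda>\<xi>. wp \<xi> * (ev_plus \<xi>)^2 + wm \<xi> * (ev_minus \<xi>)^2) - x^2)
     = (A - M * x^2) * avg (\<lambda>\<xi>. wp \<xi> + wm \<xi>) + (B + 2 * M * x) * avg (\<lambda>\<xi>. wp \<xi> * ev_plus \<xi> + wm \<xi> * ev_minus \<xi>)
       + (- M) * avg (\<lambda>\<xi>. wp \<xi> * (ev_plus \<xi>)^2 + wm \<xi> * (ev_minus \<xi>)^2)"
    unfolding mass mean hx by (simp add: algebra_simps power2_eq_square)
  also have "\<dots> = avg (\<lambda>\<xi>. (A - M * x^2) * (wp \<xi> + wm \<xi>) + (B + 2 * M * x) * (wp \<xi> * ev_plus \<xi> + wm \<xi> * ev_minus \<xi>)
       + (- M) * (wp \<xi> * (ev_plus \<xi>)^2 + wm \<xi> * (ev_minus \<xi>)^2))"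
    by (subst avg_add, (intro intros)+, subst avg_add, (intro intros)+, subst (1 2 3) avg_mult_left, (intro intros)+) simp
  also have "\<dots> \<le> avg (\<lambda>\<xi>. wp \<xi> * hent (ev_plus \<xi>) + wm \<xi> * hent (ev_minus \<xi>))"
  proof (intro avg_mono intros)
    fix \<xi>
    have "wp \<xi> * (A + B * ev_plus \<xi> - M * (ev_plus \<xi> - x)^2) \<le> wp \<xi> * hent (ev_plus \<xi>)"
      "wm \<xi> * (A + B * ev_minus \<xi> - M * (ev_minus \<xi> - x)^2) \<le> wm \<xi> * hent (ev_minus \<xi>)"
      using quad[OF lt(1)[of \<xi>]] quad[OF lt(2)[of \<xi>]] w[of \<xi>] by (auto intro!: mult_left_mono)
    then show "(A - M * x^2) * (wp \<xi> + wm \<xi>) + (B + 2 * M * x) * (wp \<xi> * ev_plus \<xi> + wm \<xi> * ev_minus \<xi>)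
       + (- M) * (wp \<xi> * (ev_plus \<xi>)^2 + wm \<xi> * (ev_minus \<xi>)^2) \<le> wp \<xi> * hent (ev_plus \<xi>) + wm \<xi> * hent (ev_minus \<xi>)"
      by (simp add: algebra_simps power2_eq_square)
  qed
  finally show "hent x \<le> avg (\<lambda>\<xi>. wp \<xi> * hent (ev_plus \<xi>) + wm \<xi> * hent (ev_minus \<xi>))
        + (avg (\<lambda>\<xi>. wp \<xi> * (ev_plus \<xi>)^2 + wm \<xi> * (ev_minus \<xi>)^2) - x^2) / (1 - r^2)"
    by (simp add: M_def)
qed

text \<open>The squared Hilbert-Schmidt norm of the n by n Toeplitz matrix with symbol
  \<open>a\<close>.\<close>

definition toeplitz_hs :: "(real \<Rightarrow> real) \<Rightarrow> nat \<Rightarrow> real" where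
  "toeplitz_hs a n = (\<Sum>x\<in>{1..int n}. \<Sum>y\<in>{1..int n}. (cmod (fourier a (y - x)))^2)"

text \<open>A row at distance at least m from both ends contains all coefficients with |l| <= m, so
  it contributes at least avg(a^2) - \<epsilon>. The 2 m rows near the ends are given up, which
  costs at most 2 m avg(a^2).\<close>

lemma toeplitz_hs_lower:
  assumes pars: "avg (\<lambda>\<xi>. (a \<xi>)^2) - \<epsilon> \<le> (\<Sum>l\<in>{- int m..int m}. (cmod (fourier a l))^2)"
    and a: "bdd_borel a" and \<epsilon>: "\<epsilon> > 0"
  shows "real n * avg (\<lambda>\<xi>. (a \<xi>)^2) - toeplitz_hs a n \<le> \<epsilon> * real n + 2 * real m * avg (\<lambda>\<xi>. (a \<xi>)^2)"
proof -
  define T where "T = avg (\<lambda>\<xi>. (a \<xi>)^2)"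
  have T: "T \<ge> 0" unfolding T_def using avg_mono[of "\<lambda>_. 0" "\<lambda>\<xi>. (a \<xi>)^2"] a
    by (simp add: avg_const bdd_borel_intros)
  let ?c = "\<lambda>l. (cmod (fourier a l))^2"
  show ?thesis
  proof (cases "n < 2 * m")
    case True
    have "toeplitz_hs a n \<ge> 0" unfolding toeplitz_hs_def by (intro sum_nonneg) auto
    moreover have "real n * T \<le> 2 * real m * T" using True T by (intro mult_right_mono) auto
    ultimately show ?thesis using \<epsilon> unfolding T_def[symmetric] by (smt (verit) mult_nonneg_nonneg of_nat_0_le_iff)
  next
    case False
    have "real (n - 2 * m) * (T - \<epsilon>) \<le> (\<Sum>x\<in>{int m + 1..int n - int m}. \<Sum>l\<in>{- int m..int m}. ?c l)"
      using mult_left_mono[OF pars, of "real (n - 2 * m)"] False by (simp add: T_def)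
    also have "\<dots> = (\<Sum>x\<in>{int m + 1..int n - int m}. \<Sum>y\<in>{x - int m..x + int m}. ?c (y - x))"
    proof (rule sum.cong[OF refl])
      fix x
      show "(\<Sum>l\<in>{- int m..int m}. ?c l) = (\<Sum>y\<in>{x - int m..x + int m}. ?c (y - x))"
        by (rule sum.reindex_bij_witness[where i="\<lambda>y. y - x" and j="\<lambda>l. l + x"]) auto
    qed
    also have "\<dots> \<le> (\<Sum>x\<in>{int m + 1..int n - int m}. \<Sum>y\<in>{1..int n}. ?c (y - x))"
      by (intro sum_mono sum_mono2) auto
    also have "\<dots> \<le> toeplitz_hs a n"
      unfolding toeplitz_hs_def by (intro sum_mono2 sum_nonneg) auto
    finally have "real (n - 2 * m) * (T - \<epsilon>) \<le> toeplitz_hs a n" .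
    moreover have "real (n - 2 * m) * (T - \<epsilon>) = real n * T - 2 * real m * T - \<epsilon> * real n + 2 * real m * \<epsilon>"
      using False by (simp add: of_nat_diff algebra_simps)
    moreover have "2 * real m * \<epsilon> \<ge> 0" using \<epsilon> by simp
    ultimately show ?thesis unfolding T_def[symmetric] by linarith
  qed
qed

lemma Sker_avg: "Sker \<beta> \<delta> \<gamma> lam a b x y = avg (\<lambda>\<xi>. fmode (y - x) \<xi> * smat \<beta> \<delta> \<gamma> lam \<xi> a b)"
proof -
  have e: "z / complex_of_real r = z /\<^sub>R r" for z r
    by (metis divide_inverse mult.commute of_real_inverse scaleR_conv_of_real)
  show ?thesis unfolding Sker_def avg_def fmode_def by (rule e)
qed

context xy_params
begin

definition sym_mat :: "bool \<Rightarrow> bool \<Rightarrow> real \<Rightarrow> complex" where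
  "sym_mat a b \<xi> = (if a \<and> b then of_real (sym_pp \<xi>) else if a \<and> \<not> b then - \<i> * of_real (sym_pm \<xi>)
     else if \<not> a \<and> b then \<i> * of_real (sym_pm \<xi>) else of_real (sym_mm \<xi>))"

lemma smat_sym_mat: "smat \<beta> \<delta> \<gamma> lam \<xi> a b = ((if a = b then 1 else 0) + sym_mat a b \<xi>) / 2"
proof -
  have s: "s0 \<beta> \<delta> \<gamma> lam \<xi> = (1 - phi_sgn \<xi>) / 2" "s3 \<beta> \<delta> \<gamma> lam \<xi> = phi_bd \<xi> * dir3 \<xi> / 2"
    "s2 \<beta> \<delta> \<gamma> lam \<xi> = phi_bd \<xi> * dir2 \<xi> / 2"
    unfolding symbol_components(2,3)[of \<xi>, symmetric] using symbol_components(1)[of \<xi>] by simp_all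
  show ?thesis unfolding smat_def sym_mat_def s sym_pp_def sym_mm_def sym_pm_def
    by (cases a; cases b) (simp_all add: field_simps)
qed

lemma bdd_borel_sym_mat [bdd_borel_intros]: "bdd_borel (sym_mat a b)"
  unfolding sym_mat_def[abs_def] by (intro bdd_borel_intros)

lemma Sker_sym_mat: "Sker \<beta> \<delta> \<gamma> lam a b x y
   = ((if a = b \<and> x = y then 1 else 0) + avg (\<lambda>\<xi>. fmode (y - x) \<xi> * sym_mat a b \<xi>)) / 2"
proof -
  have "Sker \<beta> \<delta> \<gamma> lam a b x y
     = avg (\<lambda>\<xi>. (if a = b then 1 else 0) / 2 * fmode (y - x) \<xi> + 1 / 2 * (fmode (y - x) \<xi> * sym_mat a b \<xi>))"
    unfolding Sker_avg smat_sym_mat by (rule arg_cong[where f=avg]) (auto simp: fun_eq_iff field_simps)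
  also have "\<dots> = (if a = b then 1 else 0) / 2 * avg (fmode (y - x)) + 1 / 2 * avg (\<lambda>\<xi>. fmode (y - x) \<xi> * sym_mat a b \<xi>)"
    by (subst avg_add) (simp_all only: bdd_borel_intros avg_mult_left)
  finally show ?thesis unfolding avg_fmode by simp
qed

lemma sym_mat_cnj: "cnj (sym_mat a b \<xi>) = sym_mat b a \<xi>"
  by (simp add: sym_mat_def)

lemma Sker_hermitian: "Sker \<beta> \<delta> \<gamma> lam b a y x = cnj (Sker \<beta> \<delta> \<gamma> lam a b x y)"
proof -
  have "cnj (avg (\<lambda>\<xi>. fmode (y - x) \<xi> * sym_mat a b \<xi>)) = avg (\<lambda>\<xi>. fmode (x - y) \<xi> * sym_mat b a \<xi>)"
    unfolding avg_cnj[symmetric] by (simp add: cnj_fmode sym_mat_cnj)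
  then show ?thesis unfolding Sker_sym_mat by auto
qed

text \<open>Reversing the momentum leaves cos and \<open>mu\<close> unchanged and changes the sign
  of sin and \<open>kappa\<close>. These parities are what self-duality of S requires, because J
  conjugates the Fourier modes and exchanges the components.\<close>

lemma symbol_reflect:
  "phi_bd (2 * pi - \<xi>) = phi_bd \<xi>" "phi_sgn (2 * pi - \<xi>) = - phi_sgn \<xi>" "dir2 (2 * pi - \<xi>) = - dir2 \<xi>" "dir3 (2 * pi - \<xi>) = dir3 \<xi>"
proof -
  have c: "cos (2 * pi - \<xi>) = cos \<xi>" and s: "sin (2 * pi - \<xi>) = - sin \<xi>" by (simp_all add: cos_diff sin_diff)
  have m: "\<mu> (2 * pi - \<xi>) = \<mu> \<xi>" by (simp add: mu_def c s)
  have k: "\<kappa> (2 * pi - \<xi>) = - \<kappa> \<xi>" unfolding kappa_def sin_double c s by simp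
  show "phi_bd (2 * pi - \<xi>) = phi_bd \<xi>" by (simp add: phi_bd_def phi_def m)
  show "phi_sgn (2 * pi - \<xi>) = - phi_sgn \<xi>" by (simp add: phi_sgn_def phi_db_def phi_def m k sgn_minus)
  show "dir2 (2 * pi - \<xi>) = - dir2 \<xi>" by (simp add: dir2_def m s)
  show "dir3 (2 * pi - \<xi>) = dir3 \<xi>" by (simp add: dir3_def m c)
qed

lemma sym_mat_reflect: "sym_mat (\<not> b) (\<not> a) (2 * pi - \<xi>) = - sym_mat a b \<xi>"
  by (cases a; cases b) (simp_all add: sym_mat_def sym_pp_def sym_mm_def sym_pm_def symbol_reflect)

lemma Sker_self_dual:
  "Sker \<beta> \<delta> \<gamma> lam (\<not> b) (\<not> a) y x + Sker \<beta> \<delta> \<gamma> lam a b x y = (if a = b \<and> x = y then 1 else 0)"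
proof -
  have "avg (\<lambda>\<xi>. fmode (x - y) \<xi> * sym_mat (\<not> b) (\<not> a) \<xi>)
      = avg (\<lambda>\<xi>. fmode (x - y) (2 * pi - \<xi>) * sym_mat (\<not> b) (\<not> a) (2 * pi - \<xi>))"
    by (rule avg_reflect[symmetric])
  also have "\<dots> = avg (\<lambda>\<xi>. - (fmode (y - x) \<xi> * sym_mat a b \<xi>))"
    unfolding fmode_reflect sym_mat_reflect by simp
  also have "\<dots> = - avg (\<lambda>\<xi>. fmode (y - x) \<xi> * sym_mat a b \<xi>)" by (rule avg_minus)
  finally have eq: "avg (\<lambda>\<xi>. fmode (x - y) \<xi> * sym_mat (\<not> b) (\<not> a) \<xi>)
      = - avg (\<lambda>\<xi>. fmode (y - x) \<xi> * sym_mat a b \<xi>)" .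
  have "(p - z) / 2 + (p + z) / 2 = p" for p z :: complex by (simp add: field_simps)
  then show ?thesis unfolding Sker_sym_mat eq by (simp add: eq_commute[of b] eq_commute[of y])
qed

lemma block_spectrum_exists: "\<exists>u \<nu>. block_spectrum \<beta> \<delta> \<gamma> lam n u \<nu>"
proof -
  let ?I = "block_index n" and ?S = "\<lambda>(a, x) (b, y). Sker \<beta> \<delta> \<gamma> lam a b x y"
  have herm: "?S j i = cnj (?S i j)" for i j
  proof -
    obtain a x b y where "i = (a, x)" "j = (b, y)" by (cases i; cases j)
    then show ?thesis by (simp only: prod.case) (rule Sker_hermitian)
  qed
  have sd: "?S (site_dual j) (site_dual i) + ?S i j = (if i = j then 1 else 0)" for i j
    using Sker_self_dual by (cases i; cases j) (simp add: site_dual_def)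
  have "\<exists>u (\<nu>::nat \<Rightarrow> real). \<forall>k<n. (\<forall>i\<in>?I. lin_ap ?I ?S (u k) i = of_real (\<nu> k) * u k i)
     \<and> (\<forall>l<n. inn ?I (u k) (u l) = (if k = l then 1 else 0) \<and> inn ?I (dual_conj site_dual (u k)) (u l) = 0)"
    by (rule self_dual_diagonalisation[OF card_block_index site_dual_block herm sd])
  then obtain u and \<nu> :: "nat \<Rightarrow> real" where u: "\<forall>k<n. (\<forall>i\<in>?I. lin_ap ?I ?S (u k) i = of_real (\<nu> k) * u k i)
     \<and> (\<forall>l<n. inn ?I (u k) (u l) = (if k = l then 1 else 0) \<and> inn ?I (dual_conj site_dual (u k)) (u l) = 0)"
    by (elim exE)
  note ev = u[rule_format, THEN conjunct1, rule_format]
  note on = u[rule_format, THEN conjunct2, rule_format, THEN conjunct1]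
  note dual = u[rule_format, THEN conjunct2, rule_format, THEN conjunct2]
  define u' :: "nat \<Rightarrow> testfun" where "u' k = curry (u k)" for k
  have uu: "case_prod (u' k) = u k" for k by (simp add: u'_def)
  have JJ: "Jop (Jop f) = f" for f by (simp add: Jop_def fun_eq_iff)
  have "block_spectrum \<beta> \<delta> \<gamma> lam n u' \<nu>"
  proof
    fix k i assume k: "k < n" and i: "i \<in> ?I"
    show "lin_ap ?I ?S (case_prod (u' k)) i = of_real (\<nu> k) * case_prod (u' k) i"
      unfolding uu by (rule ev[OF k i])
    show "lin_ap ?I ?S (case_prod (Jop (u' k))) i = of_real (1 - \<nu> k) * case_prod (Jop (u' k)) i"
      unfolding dual_conj_site[symmetric] uu
      by (rule dual_conj_eigenvector[OF card_block_index(1) site_dual_block herm sd ev[OF k] i])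
  next
    fix k l assume kl: "k < n" "l < n"
    show "car_form n (Jop (u' k)) (u' l) = (if k = l then 1 else 0)"
      unfolding inn_block_index[symmetric] uu by (rule on[OF kl])
    have "car_form n (u' k) (u' l) = inn ?I (dual_conj site_dual (case_prod (u' k))) (case_prod (u' l))"
      unfolding dual_conj_site inn_block_index JJ ..
    also have "\<dots> = 0" unfolding uu by (rule dual[OF kl])
    finally show "car_form n (u' k) (u' l) = 0" .
  qed
  then show ?thesis by blast
qed

text \<open>The eigenvalues of the symbol t = 2 s - 1 are - phi_sgn + phi_bd and - phi_sgn - phi_bd;
  (dens + mag) / 2 and (dens - mag) / 2 below are the weights of a wave function in the
  corresponding eigenspaces.\<close>

definition ev_plus :: "real \<Rightarrow> real" where "ev_plus \<xi> = - phi_sgn \<xi> + phi_bd \<xi>"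
definition ev_minus :: "real \<Rightarrow> real" where "ev_minus \<xi> = - phi_sgn \<xi> - phi_bd \<xi>"

lemma ev_bounds: "\<bar>ev_plus \<xi>\<bar> \<le> r_max" "\<bar>ev_minus \<xi>\<bar> \<le> r_max"
  using phi_bd_sgn_bound[of \<xi>] unfolding ev_plus_def ev_minus_def by linarith+

lemma bdd_borel_ev [bdd_borel_intros]: "bdd_borel ev_plus" "bdd_borel ev_minus"
  unfolding ev_plus_def[abs_def] ev_minus_def[abs_def] by (intro bdd_borel_intros)+

lemma bdd_borel_hent_ev [bdd_borel_intros]:
  "bdd_borel (\<lambda>\<xi>. hent (ev_plus \<xi>))" "bdd_borel (\<lambda>\<xi>. hent (ev_minus \<xi>))"
  using ev_bounds r_max(2) by (auto intro!: bdd_borel_hent bdd_borel_ev intro: le_less_trans)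

section \<open>Block vectors as trigonometric polynomials with values in C^2\<close>

definition wave :: "nat \<Rightarrow> (bool \<times> int \<Rightarrow> complex) \<Rightarrow> bool \<Rightarrow> real \<Rightarrow> complex" where
  "wave n f a \<xi> = (\<Sum>x\<in>{1..int n}. f (a, x) * fmode x \<xi>)"

lemma bdd_borel_wave [bdd_borel_intros]: "bdd_borel (wave n f a)"
  unfolding wave_def[abs_def] by (intro bdd_borel_intros)

lemma avg_wave:
  assumes h: "bdd_borel h"
  shows "avg (\<lambda>\<xi>. cnj (wave n f a \<xi>) * h \<xi> * wave n f b \<xi>)
     = (\<Sum>x\<in>{1..int n}. \<Sum>y\<in>{1..int n}. cnj (f (a, x)) * f (b, y) * avg (\<lambda>\<xi>. fmode (y - x) \<xi> * h \<xi>))"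
proof -
  have "cnj (wave n f a \<xi>) * h \<xi> * wave n f b \<xi>
      = (\<Sum>x\<in>{1..int n}. \<Sum>y\<in>{1..int n}. (cnj (f (a, x)) * f (b, y)) * (fmode (y - x) \<xi> * h \<xi>))" for \<xi>
  proof -
    have c: "fmode (y - x) \<xi> = fmode (- x) \<xi> * fmode y \<xi>" for x y using fmode_add[of "- x" y \<xi>] by simp
    have "cnj (wave n f a \<xi>) * h \<xi> * wave n f b \<xi> = h \<xi> * (cnj (wave n f a \<xi>) * wave n f b \<xi>)" by simp
    also have "cnj (wave n f a \<xi>) * wave n f b \<xi>
       = (\<Sum>x\<in>{1..int n}. \<Sum>y\<in>{1..int n}. (cnj (f (a, x)) * fmode (- x) \<xi>) * (f (b, y) * fmode y \<xi>))"
      unfolding wave_def cnj_sum sum_product by (simp add: cnj_fmode)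
    finally show ?thesis unfolding c by (simp add: sum_distrib_left mult_ac)
  qed
  then have "avg (\<lambda>\<xi>. cnj (wave n f a \<xi>) * h \<xi> * wave n f b \<xi>)
     = avg (\<lambda>\<xi>. \<Sum>x\<in>{1..int n}. \<Sum>y\<in>{1..int n}. (cnj (f (a, x)) * f (b, y)) * (fmode (y - x) \<xi> * h \<xi>))"
    by simp
  also have "\<dots> = (\<Sum>x\<in>{1..int n}. \<Sum>y\<in>{1..int n}. (cnj (f (a, x)) * f (b, y)) * avg (\<lambda>\<xi>. fmode (y - x) \<xi> * h \<xi>))"
    using h by (simp add: avg_sum bdd_borel_intros avg_mult_left)
  finally show ?thesis .
qed

definition dens :: "nat \<Rightarrow> (bool \<times> int \<Rightarrow> complex) \<Rightarrow> real \<Rightarrow> real" where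
  "dens n f \<xi> = (cmod (wave n f True \<xi>))^2 + (cmod (wave n f False \<xi>))^2"

text \<open>The expectation of \<open>dir2\<close> sigma_2 + \<open>dir3\<close> sigma_3 in the
  vector formed by the two wave components; 2 Im(cnj u v) is that of sigma_2.\<close>

definition mag :: "nat \<Rightarrow> (bool \<times> int \<Rightarrow> complex) \<Rightarrow> real \<Rightarrow> real" where
  "mag n f \<xi> = dir3 \<xi> * ((cmod (wave n f True \<xi>))^2 - (cmod (wave n f False \<xi>))^2)
     + dir2 \<xi> * (2 * Im (cnj (wave n f True \<xi>) * wave n f False \<xi>))"

lemma bdd_borel_dens [bdd_borel_intros]: "bdd_borel (dens n f)" "bdd_borel (mag n f)"
  unfolding dens_def[abs_def] mag_def[abs_def] by (intro bdd_borel_intros)+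

text \<open>Cauchy-Schwarz for the direction, of length at most 1, and the spin vector (a, b), of
  length at most \<open>dens\<close>. It makes the weights (dens \<plusminus> mag)/2
  non-negative.\<close>

lemma mag_le_dens: "\<bar>mag n f \<xi>\<bar> \<le> dens n f \<xi>"
proof -
  let ?u = "wave n f True \<xi>" and ?v = "wave n f False \<xi>"
  define a where "a = (cmod ?u)^2 - (cmod ?v)^2"
  define b where "b = 2 * Im (cnj ?u * ?v)"
  have "b^2 \<le> (2 * (cmod ?u * cmod ?v))^2"
    unfolding b_def using abs_Im_le_cmod[of "cnj ?u * ?v"]
    by (intro power2_le_iff_abs_le[THEN iffD2]) (auto simp: norm_mult)
  moreover have "a^2 + (2 * (cmod ?u * cmod ?v))^2 = (dens n f \<xi>)^2"
    unfolding a_def dens_def by (simp add: power2_eq_square algebra_simps)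
  ultimately have ab: "a^2 + b^2 \<le> (dens n f \<xi>)^2" by linarith
  \<comment> \<open>Lagrange's identity in the plane; discarding the second square leaves
    Cauchy-Schwarz.\<close>
  have "(dir3 \<xi> * a + dir2 \<xi> * b)^2 + (dir3 \<xi> * b - dir2 \<xi> * a)^2 = ((dir2 \<xi>)^2 + (dir3 \<xi>)^2) * (a^2 + b^2)"
    by (simp add: power2_eq_square algebra_simps)
  also have "\<dots> \<le> 1 * (a^2 + b^2)" by (intro mult_right_mono) (auto simp: dir_norm)
  finally have "(dir3 \<xi> * a + dir2 \<xi> * b)^2 + (dir3 \<xi> * b - dir2 \<xi> * a)^2 \<le> a^2 + b^2" by simp
  then have "(dir3 \<xi> * a + dir2 \<xi> * b)^2 \<le> a^2 + b^2"
    by (rule order_trans[rotated]) simp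
  then have "(mag n f \<xi>)^2 \<le> a^2 + b^2"
    unfolding mag_def a_def[symmetric] b_def[symmetric] .
  then have "(mag n f \<xi>)^2 \<le> (dens n f \<xi>)^2" using ab by linarith
  moreover have "dens n f \<xi> \<ge> 0" by (simp add: dens_def)
  ultimately show ?thesis using power2_le_iff_abs_le by blast
qed

lemma avg_dens: "of_real (avg (dens n f)) = inn (block_index n) f f"
proof -
  have "of_real (avg (dens n f)) = avg (\<lambda>\<xi>. complex_of_real (dens n f \<xi>))"
    by (rule avg_of_real[symmetric]) (rule bdd_borel_intros)
  also have "\<dots> = avg (\<lambda>\<xi>. cnj (wave n f True \<xi>) * 1 * wave n f True \<xi> + cnj (wave n f False \<xi>) * 1 * wave n f False \<xi>)"
    unfolding dens_def of_real_add complex_norm_square by (simp add: mult.commute)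
  also have "\<dots> = (\<Sum>a\<in>UNIV. \<Sum>x\<in>{1..int n}. \<Sum>y\<in>{1..int n}. cnj (f (a, x)) * f (a, y) * (if y = x then 1 else 0))"
    by (subst avg_add, (intro bdd_borel_intros)+, subst (1 2) avg_wave, (intro bdd_borel_intros)+)
       (simp add: UNIV_bool avg_fmode add.commute)
  also have "\<dots> = inn (block_index n) f f"
    by (simp add: inn_def sum_block_index if_distrib[of "\<lambda>x. _ * x"] cong: if_cong)
  finally show ?thesis .
qed

lemma sym_mat_wave: "(\<Sum>a\<in>UNIV. \<Sum>b\<in>UNIV. cnj (wave n f a \<xi>) * sym_mat a b \<xi> * wave n f b \<xi>)
   = of_real (- phi_sgn \<xi> * dens n f \<xi> + phi_bd \<xi> * mag n f \<xi>)"
proof -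
  define u where "u = wave n f True \<xi>"
  define v where "v = wave n f False \<xi>"
  have "(\<Sum>a\<in>UNIV. \<Sum>b\<in>UNIV. cnj (wave n f a \<xi>) * sym_mat a b \<xi> * wave n f b \<xi>)
      = of_real (sym_pp \<xi>) * (cnj u * u) + of_real (sym_mm \<xi>) * (cnj v * v)
       + of_real (sym_pm \<xi>) * (- \<i> * (cnj u * v - cnj (cnj u * v)))"
    by (simp add: UNIV_bool sym_mat_def u_def v_def algebra_simps)
  also have "cnj u * u = of_real ((cmod u)^2)" by (simp only: complex_norm_square mult.commute)
  also have "cnj v * v = of_real ((cmod v)^2)" by (simp only: complex_norm_square mult.commute)
  also have "- \<i> * (cnj u * v - cnj (cnj u * v)) = of_real (2 * Im (cnj u * v))"
    by (simp add: complex_eq_iff)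
  also have "of_real (sym_pp \<xi>) * complex_of_real ((cmod u)^2) + of_real (sym_mm \<xi>) * of_real ((cmod v)^2) + of_real (sym_pm \<xi>) * of_real (2 * Im (cnj u * v))
     = of_real (sym_pp \<xi> * (cmod u)^2 + sym_mm \<xi> * (cmod v)^2 + sym_pm \<xi> * (2 * Im (cnj u * v)))" by simp
  also have "sym_pp \<xi> * (cmod u)^2 + sym_mm \<xi> * (cmod v)^2 + sym_pm \<xi> * (2 * Im (cnj u * v))
     = - phi_sgn \<xi> * dens n f \<xi> + phi_bd \<xi> * mag n f \<xi>"
    unfolding sym_pp_def sym_mm_def sym_pm_def dens_def mag_def u_def[symmetric] v_def[symmetric] by (simp add: algebra_simps)
  finally show ?thesis .
qed

text \<open>The entries of T_n = 2 S - 1 are Fourier coefficients of t, so its quadratic form at f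
  is the average of t(xi) taken in the wave of f. For a unit eigenvector this makes the eigenvalue a
  mean.\<close>

lemma avg_sym_mat_wave:
  "of_real (avg (\<lambda>\<xi>. - phi_sgn \<xi> * dens n f \<xi> + phi_bd \<xi> * mag n f \<xi>))
     = 2 * inn (block_index n) f (lin_ap (block_index n) (\<lambda>(a, x) (b, y). Sker \<beta> \<delta> \<gamma> lam a b x y) f)
       - inn (block_index n) f f"
proof -
  have "of_real (avg (\<lambda>\<xi>. - phi_sgn \<xi> * dens n f \<xi> + phi_bd \<xi> * mag n f \<xi>))
      = avg (\<lambda>\<xi>. complex_of_real (- phi_sgn \<xi> * dens n f \<xi> + phi_bd \<xi> * mag n f \<xi>))"
    by (rule avg_of_real[symmetric]) (intro bdd_borel_intros)
  also have "\<dots> = avg (\<lambda>\<xi>. \<Sum>a\<in>UNIV. \<Sum>b\<in>UNIV. cnj (wave n f a \<xi>) * sym_mat a b \<xi> * wave n f b \<xi>)"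
    unfolding sym_mat_wave ..
  also have "\<dots> = (\<Sum>a\<in>UNIV. \<Sum>b\<in>UNIV. \<Sum>x\<in>{1..int n}. \<Sum>y\<in>{1..int n}.
      cnj (f (a, x)) * f (b, y) * avg (\<lambda>\<xi>. fmode (y - x) \<xi> * sym_mat a b \<xi>))"
    by (simp add: avg_sum bdd_borel_intros avg_wave)
  also have "\<dots> = (\<Sum>a\<in>UNIV. \<Sum>b\<in>UNIV. \<Sum>x\<in>{1..int n}. \<Sum>y\<in>{1..int n}.
      2 * (cnj (f (a, x)) * Sker \<beta> \<delta> \<gamma> lam a b x y * f (b, y)) - cnj (f (a, x)) * (if a = b \<and> x = y then f (b, y) else 0))"
    unfolding Sker_sym_mat by (intro sum.cong refl) (simp add: field_simps)
  also have "\<dots> = 2 * (\<Sum>a\<in>UNIV. \<Sum>b\<in>UNIV. \<Sum>x\<in>{1..int n}. \<Sum>y\<in>{1..int n}.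
      cnj (f (a, x)) * Sker \<beta> \<delta> \<gamma> lam a b x y * f (b, y))
      - (\<Sum>a\<in>UNIV. \<Sum>b\<in>UNIV. \<Sum>x\<in>{1..int n}. \<Sum>y\<in>{1..int n}. cnj (f (a, x)) * (if a = b \<and> x = y then f (b, y) else 0))"
    by (simp only: sum_subtractf sum_distrib_left)
  also have "(\<Sum>a\<in>UNIV. \<Sum>b\<in>UNIV. \<Sum>x\<in>{1..int n}. \<Sum>y\<in>{1..int n}. cnj (f (a, x)) * (if a = b \<and> x = y then f (b, y) else 0))
      = inn (block_index n) f f"
    unfolding inn_def sum_block_index UNIV_bool
    by (simp add: if_distrib[of "\<lambda>x. _ * x"] cong: if_cong)
  also have "(\<Sum>a\<in>UNIV. \<Sum>b\<in>UNIV. \<Sum>x\<in>{1..int n}. \<Sum>y\<in>{1..int n}. cnj (f (a, x)) * Sker \<beta> \<delta> \<gamma> lam a b x y * f (b, y))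
      = inn (block_index n) f (lin_ap (block_index n) (\<lambda>(a, x) (b, y). Sker \<beta> \<delta> \<gamma> lam a b x y) f)"
  proof -
    have "inn (block_index n) f (lin_ap (block_index n) (\<lambda>(a, x) (b, y). Sker \<beta> \<delta> \<gamma> lam a b x y) f)
      = (\<Sum>a\<in>UNIV. \<Sum>x\<in>{1..int n}. \<Sum>b\<in>UNIV. \<Sum>y\<in>{1..int n}. cnj (f (a, x)) * Sker \<beta> \<delta> \<gamma> lam a b x y * f (b, y))"
      unfolding inn_def lin_ap_def sum_block_index sum_distrib_left by (simp add: mult.assoc)
    then show ?thesis by (simp only:) (intro sum.cong refl sum.swap)
  qed
  finally show ?thesis .
qed

text \<open>Completeness of the basis leaves only equal sites, and each of the n sites contributes
  |exp(i x xi)|^2 = 1. The identity is pointwise in xi, not merely on average.\<close>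

lemma wave_completeness:
  assumes "block_spectrum \<beta> \<delta> \<gamma> lam n u \<nu>"
  shows "(\<Sum>p\<in>UNIV \<times> {..<n}. wave n (block_spectrum.basis u p) a \<xi> * cnj (wave n (block_spectrum.basis u p) b \<xi>))
     = (if a = b then of_nat n else 0)"
proof -
  interpret block_spectrum \<beta> \<delta> \<gamma> lam n u \<nu> by fact
  let ?K = "(UNIV::bool set) \<times> {..<n}"
  have compl: "(\<Sum>p\<in>?K. basis p (a, x) * cnj (basis p (b, y))) = (if a = b \<and> x = y then 1 else 0)"
    if "x \<in> {1..int n}" "y \<in> {1..int n}" for x y
  proof -
    have "(\<Sum>p\<in>?K. basis p (a, x) * cnj (basis p (b, y))) = (if (a, x) = (b, y) then 1 else 0)"
    proof (rule orthonormal_family_complete[OF _ card_block_index(1) card_basis])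
      show "(\<Sum>i\<in>block_index n. cnj (basis k i) * basis l i) = (if k = l then 1 else 0)"
        if "k \<in> ?K" "l \<in> ?K" for k l
        using basis_orthonormal[OF that] by (simp add: inn_def)
    qed (use that in \<open>auto simp: block_index_def\<close>)
    then show ?thesis by simp
  qed
  have "(\<Sum>p\<in>?K. wave n (basis p) a \<xi> * cnj (wave n (basis p) b \<xi>))
     = (\<Sum>p\<in>?K. \<Sum>x\<in>{1..int n}. \<Sum>y\<in>{1..int n}. fmode x \<xi> * cnj (fmode y \<xi>) * (basis p (a, x) * cnj (basis p (b, y))))"
    unfolding wave_def cnj_sum sum_product by (intro sum.cong refl) (simp add: mult_ac)
  also have "\<dots> = (\<Sum>x\<in>{1..int n}. \<Sum>y\<in>{1..int n}. fmode x \<xi> * cnj (fmode y \<xi>) * (\<Sum>p\<in>?K. basis p (a, x) * cnj (basis p (b, y))))"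
    unfolding sum_distrib_left by (rule sum_rotate)
  also have "\<dots> = (\<Sum>x\<in>{1..int n}. \<Sum>y\<in>{1..int n}. if y = x then (if a = b then 1 else 0) else 0)"
  proof (intro sum.cong refl)
    fix x y assume xy: "x \<in> {1..int n}" "y \<in> {1..int n}"
    have "fmode x \<xi> * cnj (fmode x \<xi>) = 1" using fmode_add[of x "- x" \<xi>] by (simp add: cnj_fmode)
    then show "fmode x \<xi> * cnj (fmode y \<xi>) * (\<Sum>p\<in>?K. basis p (a, x) * cnj (basis p (b, y)))
       = (if y = x then (if a = b then 1 else 0) else 0)"
      unfolding compl[OF xy] by auto
  qed
  also have "\<dots> = (if a = b then of_nat n else 0)" by simp
  finally show ?thesis .
qed

lemma sum_dens_mag:
  assumes "block_spectrum \<beta> \<delta> \<gamma> lam n u \<nu>"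
  shows "(\<Sum>p\<in>UNIV \<times> {..<n}. dens n (block_spectrum.basis u p) \<xi>) = 2 * real n"
    "(\<Sum>p\<in>UNIV \<times> {..<n}. mag n (block_spectrum.basis u p) \<xi>) = 0"
proof -
  let ?K = "(UNIV::bool set) \<times> {..<n}" and ?w = "\<lambda>p a. wave n (block_spectrum.basis u p) a \<xi>"
  have d: "(\<Sum>p\<in>?K. (cmod (?w p a))^2) = real n" for a
  proof -
    have "complex_of_real (\<Sum>p\<in>?K. (cmod (?w p a))^2) = (\<Sum>p\<in>?K. ?w p a * cnj (?w p a))"
      unfolding of_real_sum complex_norm_square ..
    also have "\<dots> = of_real (real n)" using wave_completeness[OF assms, of a \<xi> a] by simp
    finally show ?thesis by (simp only: of_real_eq_iff)
  qed
  have o: "(\<Sum>p\<in>?K. Im (cnj (?w p True) * ?w p False)) = 0"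
  proof -
    have "(\<Sum>p\<in>?K. cnj (?w p True) * ?w p False) = 0"
      using wave_completeness[OF assms, of False \<xi> True] by (simp add: mult.commute)
    then show ?thesis by (metis Im_sum zero_complex.sel(2))
  qed
  show "(\<Sum>p\<in>?K. dens n (block_spectrum.basis u p) \<xi>) = 2 * real n"
    unfolding dens_def by (simp only: sum.distrib d)
  have "(\<Sum>p\<in>?K. mag n (block_spectrum.basis u p) \<xi>)
     = dir3 \<xi> * ((\<Sum>p\<in>?K. (cmod (?w p True))^2) - (\<Sum>p\<in>?K. (cmod (?w p False))^2))
       + dir2 \<xi> * (2 * (\<Sum>p\<in>?K. Im (cnj (?w p True) * ?w p False)))"
    unfolding mag_def by (simp only: sum.distrib sum_distrib_left sum_subtractf right_diff_distrib)
  then show "(\<Sum>p\<in>?K. mag n (block_spectrum.basis u p) \<xi>) = 0" unfolding d o by simp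
qed

text \<open>Both sides are tr T_n^2: the squared norms of T applied to an orthonormal eigenbasis
  equal, by completeness, the sum of the squared moduli of all entries.\<close>

lemma sum_eigenvalues_square:
  assumes "block_spectrum \<beta> \<delta> \<gamma> lam n u \<nu>"
  shows "(\<Sum>p\<in>UNIV \<times> {..<n}. (2 * block_spectrum.basis_ev \<nu> p - 1)^2)
     = toeplitz_hs sym_pp n + toeplitz_hs sym_mm n + 2 * toeplitz_hs sym_pm n"
proof -
  interpret block_spectrum \<beta> \<delta> \<gamma> lam n u \<nu> by fact
  let ?K = "(UNIV::bool set) \<times> {..<n}" and ?I = "block_index n"
  define T where "T i j = 2 * Sm i j - (if i = j then 1 else 0)" for i j :: "bool \<times> int"
  let ?\<kappa> = "\<lambda>p. 2 * basis_ev p - 1"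
  have T: "(\<Sum>j\<in>?I. T i j * basis p j) = of_real (?\<kappa> p) * basis p i" if "p \<in> ?K" "i \<in> ?I" for p i
  proof -
    have "(\<Sum>j\<in>?I. T i j * basis p j) = 2 * lin_ap ?I Sm (basis p) i - (\<Sum>j\<in>?I. (if i = j then 1 else 0) * basis p j)"
      unfolding T_def lin_ap_def by (simp add: left_diff_distrib sum_subtractf sum_distrib_left mult.assoc)
    also have "(\<Sum>j\<in>?I. (if i = j then 1 else 0) * basis p j) = basis p i"
      using that(2) card_block_index(1) by (simp add: if_distrib[of "\<lambda>x. x * _"] cong: if_cong)
    also have "lin_ap ?I Sm (basis p) i = of_real (basis_ev p) * basis p i" by (rule basis_eigen[OF that])
    finally show ?thesis by (simp add: algebra_simps)
  qed
  have compl: "(\<Sum>p\<in>?K. basis p i * cnj (basis p j)) = (if i = j then 1 else 0)" if "i \<in> ?I" "j \<in> ?I" for i j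
    by (rule orthonormal_family_complete[OF _ card_block_index(1) card_basis _ that])
       (use basis_orthonormal in \<open>simp_all add: inn_def\<close>)
  have "of_real (\<Sum>p\<in>?K. (?\<kappa> p)^2) = (\<Sum>p\<in>?K. \<Sum>i\<in>?I. (of_real (?\<kappa> p) * basis p i) * cnj (of_real (?\<kappa> p) * basis p i))"
    unfolding of_real_sum
  proof (rule sum.cong[OF refl])
    fix p assume p: "p \<in> ?K"
    have "(\<Sum>i\<in>?I. (of_real (?\<kappa> p) * basis p i) * cnj (of_real (?\<kappa> p) * basis p i))
      = of_real ((?\<kappa> p)^2) * inn ?I (basis p) (basis p)"
      by (simp add: inn_def sum_distrib_left power2_eq_square mult_ac)
    then show "complex_of_real ((?\<kappa> p)^2) = (\<Sum>i\<in>?I. (of_real (?\<kappa> p) * basis p i) * cnj (of_real (?\<kappa> p) * basis p i))"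
      using basis_orthonormal[OF p p] by simp
  qed
  also have "\<dots> = (\<Sum>p\<in>?K. \<Sum>i\<in>?I. (\<Sum>j\<in>?I. T i j * basis p j) * cnj (\<Sum>j\<in>?I. T i j * basis p j))"
    by (intro sum.cong refl) (simp only: T)
  also have "\<dots> = (\<Sum>i\<in>?I. \<Sum>p\<in>?K. \<Sum>j\<in>?I. \<Sum>j'\<in>?I. T i j * cnj (T i j') * (basis p j * cnj (basis p j')))"
    unfolding cnj_sum sum_product by (subst sum.swap) (intro sum.cong refl, simp add: mult_ac)
  also have "\<dots> = (\<Sum>i\<in>?I. \<Sum>j\<in>?I. \<Sum>j'\<in>?I. T i j * cnj (T i j') * (\<Sum>p\<in>?K. basis p j * cnj (basis p j')))"
    unfolding sum_distrib_left by (intro sum.cong refl sum_rotate)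
  also have "\<dots> = (\<Sum>i\<in>?I. \<Sum>j\<in>?I. \<Sum>j'\<in>?I. if j' = j then T i j * cnj (T i j) else 0)"
    by (intro sum.cong refl) (auto simp: compl)
  also have "\<dots> = (\<Sum>i\<in>?I. \<Sum>j\<in>?I. of_real ((cmod (T i j))^2))"
    using card_block_index(1) by (simp add: complex_norm_square del: of_real_power)
  finally have "(\<Sum>p\<in>?K. (?\<kappa> p)^2) = (\<Sum>i\<in>?I. \<Sum>j\<in>?I. (cmod (T i j))^2)"
    by (simp only: of_real_sum[symmetric] of_real_eq_iff)
  also have "\<dots> = (\<Sum>a\<in>UNIV. \<Sum>x\<in>{1..int n}. \<Sum>b\<in>UNIV. \<Sum>y\<in>{1..int n}.
      (cmod (avg (\<lambda>\<xi>. fmode (y - x) \<xi> * sym_mat a b \<xi>)))^2)"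
    unfolding sum_block_index T_def by (intro sum.cong refl) (auto simp: Sker_sym_mat add_divide_distrib)
  also have "\<dots> = (\<Sum>a\<in>UNIV. \<Sum>b\<in>UNIV. toeplitz_hs (if a = b then if a then sym_pp else sym_mm else sym_pm) n)"
  proof -
    \<comment> \<open>The factors -i and i have modulus 1, so both off-diagonal blocks yield the
      same Toeplitz norm; this is the coefficient 2.\<close>
    have "cmod (avg (\<lambda>\<xi>. fmode k \<xi> * sym_mat a b \<xi>)) = cmod (fourier (if a = b then if a then sym_pp else sym_mm else sym_pm) k)" for a b k
    proof -
      have 1: "avg (\<lambda>\<xi>. fmode k \<xi> * (c * of_real (sym_pm \<xi>))) = c * fourier sym_pm k" for c
        unfolding fourier_def by (subst avg_mult_left[symmetric]) (intro bdd_borel_intros, simp add: mult_ac)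
      show ?thesis using 1[of "- \<i>"] 1[of \<i>]
        by (cases a; cases b) (simp_all add: sym_mat_def fourier_def norm_mult)
    qed
    then show ?thesis unfolding toeplitz_hs_def by (simp only:) (intro sum.cong refl sum.swap)
  qed
  also have "\<dots> = toeplitz_hs sym_pp n + toeplitz_hs sym_mm n + 2 * toeplitz_hs sym_pm n" by (simp add: UNIV_bool)
  finally show ?thesis .
qed

definition mean_entropy :: real where "mean_entropy = avg (\<lambda>\<xi>. hent (ev_plus \<xi>) + hent (ev_minus \<xi>))"

definition symbol_hs :: real where
  "symbol_hs = avg (\<lambda>\<xi>. (sym_pp \<xi>)^2) + avg (\<lambda>\<xi>. (sym_mm \<xi>)^2) + 2 * avg (\<lambda>\<xi>. (sym_pm \<xi>)^2)"

lemma symbol_hs_eq: "symbol_hs = avg (\<lambda>\<xi>. (ev_plus \<xi>)^2 + (ev_minus \<xi>)^2)"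
proof -
  have "symbol_hs = avg (\<lambda>\<xi>. (sym_pp \<xi>)^2 + (sym_mm \<xi>)^2 + 2 * (sym_pm \<xi>)^2)"
    unfolding symbol_hs_def by (simp add: avg_add avg_mult_left bdd_borel_intros)
  also have "(\<lambda>\<xi>. (sym_pp \<xi>)^2 + (sym_mm \<xi>)^2 + 2 * (sym_pm \<xi>)^2) = (\<lambda>\<xi>. (ev_plus \<xi>)^2 + (ev_minus \<xi>)^2)"
    unfolding sym_squares by (simp add: ev_plus_def ev_minus_def power2_eq_square algebra_simps fun_eq_iff)
  finally show ?thesis .
qed

text \<open>The first bound is Jensen's inequality for the concave function h, the second one for the
  convex function h(x) + x^2 / (1 - r^2).\<close>

lemma block_entropy_bounds:
  "real n * mean_entropy \<le> 2 * block_entropy \<beta> \<delta> \<gamma> lam n"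
  "2 * block_entropy \<beta> \<delta> \<gamma> lam n \<le> real n * mean_entropy
     + (real n * symbol_hs - (toeplitz_hs sym_pp n + toeplitz_hs sym_mm n + 2 * toeplitz_hs sym_pm n)) / (1 - r_max^2)"
proof -
  obtain u \<nu> where bs: "block_spectrum \<beta> \<delta> \<gamma> lam n u \<nu>" using block_spectrum_exists by blast
  interpret block_spectrum \<beta> \<delta> \<gamma> lam n u \<nu> by (rule bs)
  let ?K = "(UNIV::bool set) \<times> {..<n}" and ?I = "block_index n"
  let ?\<kappa> = "\<lambda>p. 2 * basis_ev p - 1"
  define wp where "wp p \<xi> = (dens n (basis p) \<xi> + mag n (basis p) \<xi>) / 2" for p \<xi>
  define wm where "wm p \<xi> = (dens n (basis p) \<xi> - mag n (basis p) \<xi>) / 2" for p \<xi>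
  have bw: "bdd_borel (wp p)" "bdd_borel (wm p)" for p
    using bdd_borel_mult[OF bdd_borel_const[of "1/2::real"] bdd_borel_add[OF bdd_borel_dens(1)[of n "basis p"] bdd_borel_dens(2)[of n "basis p"]]]
      bdd_borel_mult[OF bdd_borel_const[of "1/2::real"] bdd_borel_diff[OF bdd_borel_dens(1)[of n "basis p"] bdd_borel_dens(2)[of n "basis p"]]]
    by (simp_all add: wp_def[abs_def] wm_def[abs_def])
  have w: "wp p \<xi> \<ge> 0" "wm p \<xi> \<ge> 0" for p \<xi>
    using mag_le_dens[of n "basis p" \<xi>] by (auto simp: wp_def wm_def abs_le_iff)
  have mass: "avg (\<lambda>\<xi>. wp p \<xi> + wm p \<xi>) = 1" if "p \<in> ?K" for p
  proof -
    have "(\<lambda>\<xi>. wp p \<xi> + wm p \<xi>) = dens n (basis p)" by (simp add: wp_def wm_def fun_eq_iff field_simps)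
    moreover have "of_real (avg (dens n (basis p))) = complex_of_real 1"
      unfolding avg_dens using basis_orthonormal[OF that that] by simp
    ultimately show ?thesis by (simp only: of_real_eq_iff)
  qed
  have mean: "avg (\<lambda>\<xi>. wp p \<xi> * ev_plus \<xi> + wm p \<xi> * ev_minus \<xi>) = ?\<kappa> p" if p: "p \<in> ?K" for p
  proof -
    have e: "(\<lambda>\<xi>. wp p \<xi> * ev_plus \<xi> + wm p \<xi> * ev_minus \<xi>)
        = (\<lambda>\<xi>. - phi_sgn \<xi> * dens n (basis p) \<xi> + phi_bd \<xi> * mag n (basis p) \<xi>)"
      by (simp add: wp_def wm_def ev_plus_def ev_minus_def fun_eq_iff field_simps)
    have "inn ?I (basis p) (lin_ap ?I Sm (basis p)) = inn ?I (basis p) (\<lambda>i. of_real (basis_ev p) * basis p i)"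
      using basis_eigen[OF p] by (intro inn_cong) auto
    also have "\<dots> = of_real (basis_ev p) * inn ?I (basis p) (basis p)"
      by (simp add: inn_def sum_distrib_left mult_ac)
    finally have "inn ?I (basis p) (lin_ap ?I Sm (basis p)) = of_real (basis_ev p)"
      using basis_orthonormal[OF p p] by simp
    then have "of_real (avg (\<lambda>\<xi>. wp p \<xi> * ev_plus \<xi> + wm p \<xi> * ev_minus \<xi>)) = complex_of_real (?\<kappa> p)"
      unfolding e avg_sym_mat_wave using basis_orthonormal[OF p p] by simp
    then show ?thesis by (simp only: of_real_eq_iff)
  qed
  note J = jensen_hent[OF bw(1) bw(2) bdd_borel_ev w(1) w(2) ev_bounds r_max(2) mass mean]
  have sumw: "(\<Sum>p\<in>?K. wp p \<xi>) = real n" "(\<Sum>p\<in>?K. wm p \<xi>) = real n" for \<xi>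
    unfolding wp_def wm_def sum_divide_distrib[symmetric] sum.distrib sum_subtractf sum_dens_mag[OF bs] by simp_all
  \<comment> \<open>As both families of weights sum to n at every xi, the weighted averages add up
    to n times the plain average of tr g(t). It is used for g = h and for the square.\<close>
  have comb: "(\<Sum>p\<in>?K. avg (\<lambda>\<xi>. wp p \<xi> * g (ev_plus \<xi>) + wm p \<xi> * g (ev_minus \<xi>)))
      = real n * avg (\<lambda>\<xi>. g (ev_plus \<xi>) + g (ev_minus \<xi>))"
    if g: "bdd_borel (\<lambda>\<xi>. g (ev_plus \<xi>))" "bdd_borel (\<lambda>\<xi>. g (ev_minus \<xi>))" for g :: "real \<Rightarrow> real"
  proof -
    have "(\<Sum>p\<in>?K. avg (\<lambda>\<xi>. wp p \<xi> * g (ev_plus \<xi>) + wm p \<xi> * g (ev_minus \<xi>)))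
       = avg (\<lambda>\<xi>. \<Sum>p\<in>?K. wp p \<xi> * g (ev_plus \<xi>) + wm p \<xi> * g (ev_minus \<xi>))"
      by (rule avg_sum[symmetric]) (auto intro!: bdd_borel_intros bw g)
    also have "(\<lambda>\<xi>. \<Sum>p\<in>?K. wp p \<xi> * g (ev_plus \<xi>) + wm p \<xi> * g (ev_minus \<xi>)) = (\<lambda>\<xi>. real n * (g (ev_plus \<xi>) + g (ev_minus \<xi>)))"
      by (simp only: sum.distrib sum_distrib_right[symmetric] sumw distrib_left)
    finally show ?thesis by (simp add: avg_mult_left bdd_borel_add g)
  qed
  \<comment> \<open>The eigenvalue 2 \<nu> - 1 is a mean of values in [-\<open>r_max\<close>,
    \<open>r_max\<close>], which puts \<nu> strictly between 0 and 1.\<close>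
  have \<nu>: "0 < \<nu> k \<and> \<nu> k < 1" if "k < n" for k
    using J(1)[of "(False, k)"] that r_max(2) by (auto simp: basis_ev_def abs_le_iff)
  \<comment> \<open>u_k and J u_k have opposite eigenvalues of T_n and h is even, so the sum over
    the full basis counts the entropy twice.\<close>
  have ent: "2 * block_entropy \<beta> \<delta> \<gamma> lam n = (\<Sum>p\<in>?K. hent (?\<kappa> p))"
  proof -
    have "hent (2 * (1 - \<nu> k) - 1) = hent (2 * \<nu> k - 1)" for k
      using hent_minus[of "2 * \<nu> k - 1"] by (simp add: algebra_simps)
    moreover have "block_entropy \<beta> \<delta> \<gamma> lam n = (\<Sum>k<n. hent (2 * \<nu> k - 1))"
      by (rule block_entropy_sum) (rule \<nu>)
    ultimately show ?thesis unfolding sum_bool_times by (simp add: basis_ev_def)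
  qed
  have "real n * mean_entropy = (\<Sum>p\<in>?K. avg (\<lambda>\<xi>. wp p \<xi> * hent (ev_plus \<xi>) + wm p \<xi> * hent (ev_minus \<xi>)))"
    unfolding mean_entropy_def by (rule comb[symmetric]) (intro bdd_borel_intros)+
  also have "\<dots> \<le> (\<Sum>p\<in>?K. hent (?\<kappa> p))" by (intro sum_mono J)
  finally show "real n * mean_entropy \<le> 2 * block_entropy \<beta> \<delta> \<gamma> lam n" unfolding ent .
  have "2 * block_entropy \<beta> \<delta> \<gamma> lam n \<le> (\<Sum>p\<in>?K. avg (\<lambda>\<xi>. wp p \<xi> * hent (ev_plus \<xi>) + wm p \<xi> * hent (ev_minus \<xi>))
        + (avg (\<lambda>\<xi>. wp p \<xi> * (ev_plus \<xi>)^2 + wm p \<xi> * (ev_minus \<xi>)^2) - (?\<kappa> p)^2) / (1 - r_max^2))"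
    unfolding ent by (intro sum_mono J)
  also have "\<dots> = real n * mean_entropy + (real n * avg (\<lambda>\<xi>. (ev_plus \<xi>)^2 + (ev_minus \<xi>)^2) - (\<Sum>p\<in>?K. (?\<kappa> p)^2)) / (1 - r_max^2)"
    unfolding sum.distrib sum_divide_distrib[symmetric] sum_subtractf mean_entropy_def
    by (subst (1 2) comb) (simp_all add: bdd_borel_intros)
  finally show "2 * block_entropy \<beta> \<delta> \<gamma> lam n \<le> real n * mean_entropy
     + (real n * symbol_hs - (toeplitz_hs sym_pp n + toeplitz_hs sym_mm n + 2 * toeplitz_hs sym_pm n)) / (1 - r_max^2)"
    unfolding symbol_hs_eq sum_eigenvalues_square[OF bs] .
qed

lemma symbol_hs_error:
  assumes "\<epsilon> > 0"
  shows "\<exists>M. \<forall>n. real n * symbol_hs - (toeplitz_hs sym_pp n + toeplitz_hs sym_mm n + 2 * toeplitz_hs sym_pm n) \<le> \<epsilon> * real n + M"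
proof -
  \<comment> \<open>One share for each of the four entries of t; \<open>sym_pm\<close> occurs
    twice.\<close>
  define \<eta> where "\<eta> = \<epsilon> / 4"
  have \<eta>: "\<eta> > 0" using assms by (simp add: \<eta>_def)
  obtain m1 m2 m3 where
    "avg (\<lambda>\<xi>. (sym_pp \<xi>)^2) - \<eta> \<le> (\<Sum>l\<in>{- int m1..int m1}. (cmod (fourier sym_pp l))^2)"
    "avg (\<lambda>\<xi>. (sym_mm \<xi>)^2) - \<eta> \<le> (\<Sum>l\<in>{- int m2..int m2}. (cmod (fourier sym_mm l))^2)"
    "avg (\<lambda>\<xi>. (sym_pm \<xi>)^2) - \<eta> \<le> (\<Sum>l\<in>{- int m3..int m3}. (cmod (fourier sym_pm l))^2)"
    using parseval_sym[OF \<eta>] by blast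
  note L = toeplitz_hs_lower[OF this(1) bdd_borel_sym(1) \<eta>] toeplitz_hs_lower[OF this(2) bdd_borel_sym(2) \<eta>]
    toeplitz_hs_lower[OF this(3) bdd_borel_sym(3) \<eta>]
  define M where "M = 2 * real m1 * avg (\<lambda>\<xi>. (sym_pp \<xi>)^2) + 2 * real m2 * avg (\<lambda>\<xi>. (sym_mm \<xi>)^2)
     + 2 * (2 * real m3 * avg (\<lambda>\<xi>. (sym_pm \<xi>)^2))"
  have "real n * symbol_hs - (toeplitz_hs sym_pp n + toeplitz_hs sym_mm n + 2 * toeplitz_hs sym_pm n) \<le> \<epsilon> * real n + M" for n
  proof -
    have "4 * (\<eta> * real n) = \<epsilon> * real n" by (simp add: \<eta>_def)
    moreover have "real n * symbol_hs = real n * avg (\<lambda>\<xi>. (sym_pp \<xi>)^2) + real n * avg (\<lambda>\<xi>. (sym_mm \<xi>)^2)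
        + 2 * (real n * avg (\<lambda>\<xi>. (sym_pm \<xi>)^2))" by (simp add: symbol_hs_def algebra_simps)
    ultimately show ?thesis using L[of n] unfolding M_def by linarith
  qed
  then show ?thesis by blast
qed

text \<open>\<open>kappa\<close> factors as 2 sin \<xi> (lam - (1 - \<gamma>^2) cos \<xi>). Since
  |\<gamma>| < 1, the second factor determines cos \<xi>, which leaves finitely many zeros.\<close>

lemma kappa_zeros_negligible: "negligible {\<xi>\<in>{0..2*pi}. \<kappa> \<xi> = 0}"
proof (rule negligible_subset)
  define c where "c = lam / (1 - \<gamma>^2)"
  have g: "1 - \<gamma>^2 > 0" using \<gamma> by (simp add: abs_square_less_1)
  show "negligible {0, pi, 2 * pi, arccos c, 2 * pi - arccos c}" by (rule negligible_finite) simp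
  show "{\<xi>\<in>{0..2*pi}. \<kappa> \<xi> = 0} \<subseteq> {0, pi, 2 * pi, arccos c, 2 * pi - arccos c}"
  proof
    fix \<xi> assume "\<xi> \<in> {\<xi>\<in>{0..2*pi}. \<kappa> \<xi> = 0}"
    then have r: "0 \<le> \<xi>" "\<xi> \<le> 2 * pi" and k: "\<kappa> \<xi> = 0" by auto
    have "\<kappa> \<xi> = 2 * sin \<xi> * (lam - (1 - \<gamma>^2) * cos \<xi>)"
      unfolding kappa_def sin_double by (simp add: algebra_simps)
    then consider "sin \<xi> = 0" | "lam = (1 - \<gamma>^2) * cos \<xi>" using k by auto
    then show "\<xi> \<in> {0, pi, 2 * pi, arccos c, 2 * pi - arccos c}"
    proof cases
      case 1
      then obtain i where i: "\<xi> = of_int i * pi" by (auto simp: sin_zero_iff_int2)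
      have "0 \<le> i" "i \<le> 2"
        using r mult_le_cancel_right_pos[OF pi_gt_zero, of 0 "of_int i"]
          mult_le_cancel_right_pos[OF pi_gt_zero, of "of_int i" 2] unfolding i by simp_all
      then have "i = 0 \<or> i = 1 \<or> i = 2" by auto
      then show ?thesis using i by auto
    next
      case 2
      then have c: "cos \<xi> = c" using g by (simp add: c_def)
      show ?thesis
      proof (cases "\<xi> \<le> pi")
        case True
        then have "arccos c = \<xi>" using arccos_cos[of \<xi>] r c by simp
        then show ?thesis by simp
      next
        case False
        have "cos (2 * pi - \<xi>) = c" using c by (simp add: cos_diff)
        then have "arccos c = 2 * pi - \<xi>" using arccos_cos[of "2 * pi - \<xi>"] r False by simp
        then show ?thesis by simp
      qed
    qed
  qed
qed

text \<open>Away from the zeros of \<open>kappa\<close> the sign is 1 or -1. As h is even, changing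
  the sign of \<open>phi_db\<close> only exchanges the two summands.\<close>

lemma Cconst_eq: "Cconst \<beta> \<delta> \<gamma> lam = mean_entropy / 2"
proof -
  let ?f = "\<lambda>\<xi>. hent (phi_bd \<xi> + phi_db \<xi>) + hent (phi_bd \<xi> - phi_db \<xi>)"
  have "integral {0..2*pi} (\<lambda>\<xi>. hent (ev_plus \<xi>) + hent (ev_minus \<xi>)) = integral {0..2*pi} ?f"
  proof (rule integral_spike[OF kappa_zeros_negligible])
    fix \<xi> assume "\<xi> \<in> {0..2*pi} - {\<xi>\<in>{0..2*pi}. \<kappa> \<xi> = 0}"
    then have "\<kappa> \<xi> \<noteq> 0" by auto
    then have "phi_sgn \<xi> = phi_db \<xi> \<or> phi_sgn \<xi> = - phi_db \<xi>" by (auto simp: phi_sgn_def sgn_if)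
    moreover have "hent (ev_minus \<xi>) = hent (phi_bd \<xi> + phi_sgn \<xi>)" proof -
      have "ev_minus \<xi> = - (phi_bd \<xi> + phi_sgn \<xi>)" by (simp add: ev_minus_def)
      then show ?thesis by (simp only: hent_minus)
    qed
    moreover have "hent (ev_plus \<xi>) = hent (phi_bd \<xi> - phi_sgn \<xi>)" by (simp add: ev_plus_def)
    ultimately show "?f \<xi> = hent (ev_plus \<xi>) + hent (ev_minus \<xi>)" by auto
  qed
  moreover have e: "z / (2 * pi) = z /\<^sub>R (2 * pi)" for z
    by (metis divide_inverse mult.commute real_scaleR_def)
  ultimately show ?thesis
    unfolding Cconst_def mean_entropy_def avg_def phi_bd_def phi_db_def e integral_cmul by simp
qed

lemma mean_entropy_pos: "mean_entropy > 0"
proof -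
  have r_sq: "r_max^2 < 1" using r_max by (simp add: abs_square_less_1)
  have "1 - r_max^2 = avg (\<lambda>_. 1 - r_max^2)" by (simp add: avg_const)
  also have "\<dots> \<le> mean_entropy" unfolding mean_entropy_def
  proof (intro avg_mono bdd_borel_intros)
    fix \<xi>
    have "(1 - r_max^2) / 2 \<le> hent y" if "\<bar>y\<bar> \<le> r_max" for y
    proof -
      have "y^2 \<le> r_max^2" using that r_max by (simp add: abs_le_square_iff[symmetric])
      then show ?thesis using hent_ge[of y] that r_max by (simp add: field_simps)
    qed
    from this[OF ev_bounds(1)] this[OF ev_bounds(2)]
    show "1 - r_max^2 \<le> hent (ev_plus \<xi>) + hent (ev_minus \<xi>)" by (simp add: field_simps) (smt (verit))
  qed
  finally show ?thesis using r_sq by linarith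
qed

lemma block_entropy_asymptotics:
  "(\<lambda>n. block_entropy \<beta> \<delta> \<gamma> lam n - Cconst \<beta> \<delta> \<gamma> lam * real n) \<in> o(\<lambda>n. real n)"
proof (rule landau_o.smallI)
  fix c :: real assume c: "c > 0"
  have r_sq: "1 - r_max^2 > 0" using r_max by (simp add: abs_square_less_1)
  \<comment> \<open>Chosen so that division by 1 - \<open>r_max\<close>^2 returns c n. The remaining
    constant is eventually at most c n as well, and the total 2 c n matches the factor 2 in front of
    the entropy.\<close>
  define \<epsilon> where "\<epsilon> = c * (1 - r_max^2)"
  have \<epsilon>: "\<epsilon> > 0" using c r_sq by (simp add: \<epsilon>_def)
  obtain M where M: "\<And>n. real n * symbol_hs - (toeplitz_hs sym_pp n + toeplitz_hs sym_mm n + 2 * toeplitz_hs sym_pm n) \<le> \<epsilon> * real n + M"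
    using symbol_hs_error[OF \<epsilon>] by blast
  have "eventually (\<lambda>n. M / (1 - r_max^2) \<le> c * real n) sequentially"
  proof -
    obtain N :: nat where N: "M / (1 - r_max^2) / c \<le> real N" using real_arch_simple by blast
    have "M / (1 - r_max^2) \<le> c * real n" if "n \<ge> N" for n
    proof -
      have "M / (1 - r_max^2) / c \<le> real n" using N that by (meson le_trans of_nat_le_iff order_trans)
      then show ?thesis using pos_divide_le_eq[OF c] by (simp only: mult.commute)
    qed
    then show ?thesis by (auto simp: eventually_sequentially)
  qed
  then show "eventually (\<lambda>n. norm (block_entropy \<beta> \<delta> \<gamma> lam n - Cconst \<beta> \<delta> \<gamma> lam * real n) \<le> c * norm (real n)) sequentially"
  proof (rule eventually_mono)
    fix n assume n: "M / (1 - r_max^2) \<le> c * real n"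
    let ?E = "real n * symbol_hs - (toeplitz_hs sym_pp n + toeplitz_hs sym_mm n + 2 * toeplitz_hs sym_pm n)"
    have "?E / (1 - r_max^2) \<le> (\<epsilon> * real n + M) / (1 - r_max^2)" using M[of n] r_sq by (intro divide_right_mono) auto
    also have "\<dots> = c * real n + M / (1 - r_max^2)" using r_sq by (simp add: \<epsilon>_def add_divide_distrib)
    finally have "?E / (1 - r_max^2) \<le> 2 * (c * real n)" using n by linarith
    then have "2 * block_entropy \<beta> \<delta> \<gamma> lam n \<le> real n * mean_entropy + 2 * (c * real n)"
      using block_entropy_bounds(2)[of n] by linarith
    then have "\<bar>block_entropy \<beta> \<delta> \<gamma> lam n - real n * mean_entropy / 2\<bar> \<le> c * real n"
      using block_entropy_bounds(1)[of n] by linarith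
    moreover have "Cconst \<beta> \<delta> \<gamma> lam * real n = real n * mean_entropy / 2" by (simp add: Cconst_eq)
    ultimately show "norm (block_entropy \<beta> \<delta> \<gamma> lam n - Cconst \<beta> \<delta> \<gamma> lam * real n) \<le> c * norm (real n)"
      by (simp only: real_norm_def abs_of_nat)
  qed
qed

end

theorem theorem1:
  fixes \<beta>L \<beta>R \<gamma> lam :: real
  defines "\<beta> \<equiv> (\<beta>R + \<beta>L) / 2" and "\<delta> \<equiv> (\<beta>R - \<beta>L) / 2"
  assumes "0 \<le> \<delta>" and "\<delta> < \<beta>" and "-1 < \<gamma>" and "\<gamma> < 1"
  shows "(\<lambda>n. block_entropy \<beta> \<delta> \<gamma> lam n - Cconst \<beta> \<delta> \<gamma> lam * real n) \<in> o(\<lambda>n. real n)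
         \<and> Cconst \<beta> \<delta> \<gamma> lam > 0"
proof -
  interpret xy_params \<beta> \<delta> \<gamma> lam by unfold_locales (use assms in auto)
  show ?thesis using block_entropy_asymptotics mean_entropy_pos unfolding Cconst_eq by simp
qed

end
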